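(* Let $G$ be a divisor supported on $\{P_\infty,P_0\}$ and let $K$ be a canonical divisor of $X$. Suppose that $G$ satisfies either (1) $\deg G<\deg K$, or (2) $\deg K\le\deg G\le\deg K+q$ with $G\sim sP_\infty$ or $G\sim tP_0$ for some $s,t\in\mathbb{Z}$. If $G=aP_\infty+bP_0$ with $$a=a_0(q+1)+a_1,\quad 0\le a_1\le q,\qquad b=b_0(q+1)+b_1,\quad 0\le b_1\le q,$$ where $a_0,a_1,b_0,b_1$ are integers, then $$d(C(D,G)^\perp)=a_0+b_0+2.$$
   Context: Let $q$ be a prime power and let $X$ be the Hermitian curve over $\mathbb{F}_{q^2}$, i.e. the smooth projective curve with affine equation $y^q+y=x^{q+1}$. It has $q^3+1$ rational points and genus $g=q(q-1)/2$. $P_\infty$ is its point at infinity and $P_0=(0,0)$. One has $(q+1)P_\infty\sim(q+1)P_0$, and the canonical class is that of $(q-2)(q+1)P_\infty$, of degree $2g-2$; $\sim$ denotes linear equivalence. For a divisor $G$, $L(G)=\{f\in\mathbb{F}_{q^2}(X)^*: (f)+G\ge 0\}\cup\{0\}$. $D=P_1+\cdots+P_n$ is the sum of all $n=q^3-1$ rational points of $X$ other than $P_\infty,P_0$. For $G$ supported on $\{P_\infty,P_0\}$, the code $C(D,G)\subseteq\mathbb{F}_{q^2}^n$ is the image of $L(G)$ under $f\mapsto(f(P_1),\ldots,f(P_n))$, and $C(D,G)^\perp$ is its dual with respect to the standard dot product on $\mathbb{F}_{q^2}^n$. The minimum distance $d(C)$ of a nonzero linear code $C$ is the minimum Hamming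 weight of its nonzero words.
   Formalization: The formal theorem adds the hypothesis a_0+b_0+2 ≥ 1; without it the claim fails, e.g. for G = -2(q+1)P_∞, where L(G)=0, the dual code is the whole space and d=1, while a_0+b_0+2=0. *)

theory Defs
  imports
    "HOL-Computational_Algebra.Polynomial"
    "HOL-Number_Theory.Prime_Powers"
    "HOL-Library.Poly_Mapping"
    "HOL-Algebra.Algebraic_Closure_Type"
    "Jordan_Normal_Form.Matrix"
begin

text \<open>
  The finite field with \<open>q\<^sup>2\<close> elements is a type \<open>'k\<close>, and \<open>'k alg_closure\<close> is its algebraic
  closure.  The type \<open>'f\<close> is the function field of the Hermitian curve \<open>X\<close> over the algebraic
  closure, with constants embedded by \<open>emb\<close>.  Divisors are those of \<open>X\<close> over the algebraic
  closure; linear equivalence, the spaces \<open>L(G)\<close> and the differentials defining canonical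
  divisors use the function field over \<open>'k\<close> only.
\<close>

definition field_embedding :: "('c::field \<Rightarrow> 'f::field) \<Rightarrow> bool" where
  "field_embedding emb \<longleftrightarrow>
     emb 1 = 1 \<and> (\<forall>a b. emb (a + b) = emb a + emb b) \<and> (\<forall>a b. emb (a * b) = emb a * emb b)"

definition eval2 :: "('c::field \<Rightarrow> 'f::field) \<Rightarrow> 'f \<Rightarrow> 'f \<Rightarrow> 'c poly poly \<Rightarrow> 'f" where
  "eval2 emb x y g = poly (map_poly (\<lambda>p. poly (map_poly emb p) x) g) y"

text \<open>The subfield generated by the constants and \<open>x\<close>, \<open>y\<close>.\<close>

definition rational_functions :: "('c::field \<Rightarrow> 'f::field) \<Rightarrow> 'f \<Rightarrow> 'f \<Rightarrow> 'f set" where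
  "rational_functions emb x y =
     {eval2 emb x y g / eval2 emb x y h | g h. eval2 emb x y h \<noteq> 0}"

definition hermitian_curve ::
    "nat \<Rightarrow> ('k::{field,finite} alg_closure \<Rightarrow> 'f::field) \<Rightarrow> 'f \<Rightarrow> 'f \<Rightarrow> bool" where
  "hermitian_curve q emb x y \<longleftrightarrow>
     primepow q \<and> card (UNIV :: 'k set) = q\<^sup>2 \<and> field_embedding emb \<and>
     y ^ q + y = x ^ (q + 1) \<and>
     (\<forall>p. p \<noteq> 0 \<longrightarrow> poly (map_poly emb p) x \<noteq> 0) \<and>
     rational_functions emb x y = UNIV"

abbreviation (input) const :: "('k::field alg_closure \<Rightarrow> 'f::field) \<Rightarrow> 'k \<Rightarrow> 'f" where
  "const emb c \<equiv> emb (to_ac c)"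

text \<open>The function field of \<open>X\<close> over \<open>'k\<close> itself.\<close>

definition base_functions ::
    "('k::field alg_closure \<Rightarrow> 'f::field) \<Rightarrow> 'f \<Rightarrow> 'f \<Rightarrow> 'f set" where
  "base_functions emb x y = rational_functions (const emb) x y"

text \<open>
  A point of the smooth projective curve is given by its order-of-vanishing function, i.e. a
  normalized discrete valuation trivial on the constants.  The value at \<open>0\<close> is fixed to be \<open>0\<close>
  (in place of infinity) only to make this function unique.
\<close>

definition curve_point :: "('c::field \<Rightarrow> 'f::field) \<Rightarrow> ('f \<Rightarrow> int) \<Rightarrow> bool" where
  "curve_point emb P \<longleftrightarrow>
     P 0 = 0 \<and>
     (\<forall>f g. f \<noteq> 0 \<longrightarrow> g \<noteq> 0 \<longrightarrow> P (f * g) = P f + P g) \<and>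
     (\<forall>f g. f \<noteq> 0 \<longrightarrow> g \<noteq> 0 \<longrightarrow> f + g \<noteq> 0 \<longrightarrow> P (f + g) \<ge> min (P f) (P g)) \<and>
     (\<forall>c. c \<noteq> 0 \<longrightarrow> P (emb c) = 0) \<and>
     (\<exists>t. P t = 1)"

definition vanishes_at :: "('f::field \<Rightarrow> int) \<Rightarrow> 'f \<Rightarrow> bool" where
  "vanishes_at P f \<longleftrightarrow> f = 0 \<or> P f > 0"

definition regular_at :: "('f::field \<Rightarrow> int) \<Rightarrow> 'f \<Rightarrow> bool" where
  "regular_at P f \<longleftrightarrow> f = 0 \<or> P f \<ge> 0"

definition point_at_infinity ::
    "('c::field \<Rightarrow> 'f::field) \<Rightarrow> 'f \<Rightarrow> 'f \<Rightarrow> ('f \<Rightarrow> int) \<Rightarrow> bool" where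
  "point_at_infinity emb x y P \<longleftrightarrow>
     curve_point emb P \<and> \<not> (regular_at P x \<and> regular_at P y)"

definition affine_point ::
    "('c::field \<Rightarrow> 'f::field) \<Rightarrow> 'f \<Rightarrow> 'f \<Rightarrow> 'c \<Rightarrow> 'c \<Rightarrow> ('f \<Rightarrow> int) \<Rightarrow> bool" where
  "affine_point emb x y a b P \<longleftrightarrow>
     curve_point emb P \<and> vanishes_at P (x - emb a) \<and> vanishes_at P (y - emb b)"

text \<open>Rational points: the residue field of the function field over \<open>'k\<close> is \<open>'k\<close>.\<close>

definition rational_points ::
    "('k::field alg_closure \<Rightarrow> 'f::field) \<Rightarrow> 'f \<Rightarrow> 'f \<Rightarrow> ('f \<Rightarrow> int) set" where
  "rational_points emb x y =
     {P. curve_point emb P \<and>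
         (\<forall>f\<in>base_functions emb x y. regular_at P f \<longrightarrow>
            (\<exists>c. vanishes_at P (f - const emb c)))}"

definition value_at ::
    "('k::field alg_closure \<Rightarrow> 'f::field) \<Rightarrow> ('f \<Rightarrow> int) \<Rightarrow> 'f \<Rightarrow> 'k" where
  "value_at emb P f = (THE c. vanishes_at P (f - const emb c))"


type_synonym 'f divisor = "('f \<Rightarrow> int) \<Rightarrow>\<^sub>0 int"

definition is_divisor :: "('c::field \<Rightarrow> 'f::field) \<Rightarrow> 'f divisor \<Rightarrow> bool" where
  "is_divisor emb D \<longleftrightarrow> (\<forall>P\<in>Poly_Mapping.keys D. curve_point emb P)"

definition div_degree :: "'f divisor \<Rightarrow> int" where
  "div_degree D = (\<Sum>P\<in>Poly_Mapping.keys D. Poly_Mapping.lookup D P)"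

definition lin_equiv ::
    "('k::field alg_closure \<Rightarrow> 'f::field) \<Rightarrow> 'f \<Rightarrow> 'f \<Rightarrow> 'f divisor \<Rightarrow> 'f divisor \<Rightarrow> bool" where
  "lin_equiv emb x y D E \<longleftrightarrow>
     (\<exists>f\<in>base_functions emb x y. f \<noteq> 0 \<and>
        (\<forall>P. curve_point emb P \<longrightarrow> Poly_Mapping.lookup D P - Poly_Mapping.lookup E P = P f))"

definition riemann_roch_space ::
    "('k::field alg_closure \<Rightarrow> 'f::field) \<Rightarrow> 'f \<Rightarrow> 'f \<Rightarrow> 'f divisor \<Rightarrow> 'f set" where
  "riemann_roch_space emb x y G =
     {f \<in> base_functions emb x y. f \<noteq> 0 \<longrightarrow>
        (\<forall>P. curve_point emb P \<longrightarrow> P f + Poly_Mapping.lookup G P \<ge> 0)}"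

definition derivation :: "('c::field \<Rightarrow> 'f::field) \<Rightarrow> ('f \<Rightarrow> 'f) \<Rightarrow> bool" where
  "derivation emb \<delta> \<longleftrightarrow>
     (\<forall>f g. \<delta> (f + g) = \<delta> f + \<delta> g) \<and>
     (\<forall>f g. \<delta> (f * g) = f * \<delta> g + g * \<delta> f) \<and>
     (\<forall>c. \<delta> (emb c) = 0)"

text \<open>
  Differentials are regarded as linear forms on the derivations, with \<open>dg\<close> the form
  \<open>\<delta> \<mapsto> \<delta> g\<close>.  A function \<open>t\<close> with \<open>P t = 1\<close> is a uniformizer at \<open>P\<close>.
\<close>

definition same_differential ::
    "('c::field \<Rightarrow> 'f::field) \<Rightarrow> 'f \<Rightarrow> 'f \<Rightarrow> 'f \<Rightarrow> 'f \<Rightarrow> bool" where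
  "same_differential emb f g h t \<longleftrightarrow> (\<forall>\<delta>. derivation emb \<delta> \<longrightarrow> f * \<delta> g = h * \<delta> t)"

text \<open>
  The divisor of a nonzero differential \<open>f dg\<close> has at \<open>P\<close> the coefficient \<open>P h\<close>, where
  \<open>f dg = h dt\<close> for a uniformizer \<open>t\<close> at \<open>P\<close>.  Such an \<open>h\<close> exists for every \<open>t\<close>, and \<open>P h\<close>
  does not depend on \<open>t\<close>.
\<close>

definition canonical_divisor ::
    "('k::field alg_closure \<Rightarrow> 'f::field) \<Rightarrow> 'f \<Rightarrow> 'f \<Rightarrow> 'f divisor \<Rightarrow> bool" where
  "canonical_divisor emb x y K \<longleftrightarrow>
     is_divisor emb K \<and>
     (\<exists>f\<in>base_functions emb x y. \<exists>g\<in>base_functions emb x y.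
        (\<exists>\<delta>. derivation emb \<delta> \<and> f * \<delta> g \<noteq> 0) \<and>
        (\<forall>P t h. curve_point emb P \<longrightarrow> P t = 1 \<longrightarrow> same_differential emb f g h t \<longrightarrow>
           Poly_Mapping.lookup K P = P h))"


text \<open>The list \<open>Ps\<close> enumerates the points of the divisor \<open>D\<close>.\<close>

definition ag_code ::
    "('k::field alg_closure \<Rightarrow> 'f::field) \<Rightarrow> 'f \<Rightarrow> 'f \<Rightarrow> ('f \<Rightarrow> int) list \<Rightarrow> 'f divisor \<Rightarrow> 'k vec set" where
  "ag_code emb x y Ps G =
     (\<lambda>f. vec (length Ps) (\<lambda>i. value_at emb (Ps ! i) f)) ` riemann_roch_space emb x y G"

definition dual_code :: "nat \<Rightarrow> 'k::field vec set \<Rightarrow> 'k vec set" where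
  "dual_code n C = {w \<in> carrier_vec n. \<forall>c\<in>C. w \<bullet> c = 0}"

definition hamming_weight :: "'k::field vec \<Rightarrow> nat" where
  "hamming_weight w = card {i. i < dim_vec w \<and> vec_index w i \<noteq> 0}"

definition min_distance :: "nat \<Rightarrow> 'k::field vec set \<Rightarrow> nat" where
  "min_distance n C = (LEAST d. \<exists>w\<in>C. w \<noteq> 0\<^sub>v n \<and> hamming_weight w = d)"

end

theory Submission
  imports Defs "HOL-Number_Theory.Residues"
begin

text \<open>
  Since \<open>div y = (q + 1) (P\<^sub>0 - P\<^sub>\<infinity>)\<close> and \<open>y\<close> does not vanish on \<open>D\<close>, multiplying by a power of \<open>y\<close>
  only rescales coordinates, and \<open>k = a\<^sub>0 + b\<^sub>0\<close> governs the code.  The space \<open>L(G)\<close> contains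
  \<open>y powi (- b\<^sub>0)\<close> times every product of \<open>k\<close> linear polynomials, and such products separate one of
  \<open>k + 1\<close> points from the others; hence \<open>d \<ge> k + 2\<close>.  Conversely, functions regular at all affine
  points are polynomials in \<open>x\<close> and \<open>y\<close>, and the bound on the pole order at \<open>P\<^sub>\<infinity>\<close> shows that on a
  suitable line every \<open>f * y powi b\<^sub>0\<close> with \<open>f\<close> in \<open>L(G)\<close> is a polynomial in \<open>y\<close> of degree at most \<open>k\<close>;
  any \<open>k + 2\<close> points of \<open>D\<close> on that line carry a dual word, given by Lagrange weights.  The line is
  \<open>x = 0\<close> if \<open>k < q - 2\<close>; otherwise \<open>k = q - 2\<close>, and it is \<open>x = 1\<close> if \<open>G \<sim> sP\<^sub>\<infinity>\<close> and \<open>x = y\<close>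
  if \<open>G \<sim> tP\<^sub>0\<close>.

  Places and divisors are controlled by the norm \<open>\<Prod>\<^sub>c g(x, y + c)\<close> over the \<open>c\<close> with \<open>c\<^sup>q + c = 0\<close>,
  which is a polynomial in \<open>x\<close>.  It bounds vanishing orders, so that \<open>x - a\<close> is a uniformizer at every
  affine point over \<open>a\<close>, and it shows that principal divisors have degree \<open>0\<close>.  Together with
  \<open>dx = - y powi (2 - q) d(x / y)\<close> this gives the degree of every canonical divisor.
\<close>

section \<open>Polynomial functions and the norm\<close>

text \<open>Write k for \<open>a0 + b0\<close>. As deg G is at least k (q + 1), the degree
  hypotheses give k < q - 2 in case (1) and k <= q - 2 in case (2). A dual word of weight k + 2
  needs k + 2 points of D on a line. The line x = 0 has q affine points, but one of them is P0, so
  for k = q - 2 it is one point short. On x = 1 all q points lie in D; there, however, no zero at y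
  = 0 allows a factor y to be divided out, so the smaller power y^b0 must already clear the pole at
  P0. This means b1 = 0, which G ~ sPinf forces. The line x = y passes through P0 and q points of D;
  its restriction mixes powers of x and y, and a1 = 0 is what excludes the term x^q.

  Points are abstract valuations, so even the irreducibility of the curve equation is extracted from
  one of them: at infinity the terms p(x) y^j with j < q have pole orders distinct modulo q and
  cannot cancel. Valuations live over the closure while the code lives over \<open>'k\<close>; the
  local theory is therefore developed over general constants and used for both fields.\<close>

lemma comm_ring_hom_poly_map_poly:
  fixes h :: "'a::comm_ring_1 \<Rightarrow> 'b::comm_ring_1"
  assumes "comm_ring_hom h"
  shows "comm_ring_hom (\<lambda>p. poly (map_poly h p) z)"
proof -
  interpret h: comm_ring_hom h by fact
  have add: "map_poly h (p + r) = map_poly h p + map_poly h r" for p r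
    by (intro poly_eqI) (simp add: coeff_map_poly h.hom_add)
  have mult: "poly (map_poly h (p * r)) z = poly (map_poly h p) z * poly (map_poly h r) z" for p r
  proof (induction p)
    case (pCons a p)
    have "map_poly h (smult a r) = smult (h a) (map_poly h r)"
      by (intro poly_eqI) (simp add: coeff_map_poly h.hom_mult)
    then show ?case
      by (simp add: add map_poly_pCons pCons.IH algebra_simps)
  qed simp
  show ?thesis
    by unfold_locales (simp_all add: add mult)
qed

lemma field_embedding_hom:
  assumes "field_embedding emb"
  shows "field_hom emb"
proof -
  have add: "emb (a + b) = emb a + emb b" and mult: "emb (a * b) = emb a * emb b"
    and one: "emb 1 = 1" for a b
    using assms by (auto simp: field_embedding_def)
  have "emb 0 + emb 0 = emb 0 + 0"
    unfolding add[symmetric] by simp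
  then have "emb 0 = 0"
    by (rule add_left_imp_eq)
  then show ?thesis
    by unfold_locales (simp_all add: add mult one)
qed

lemma eval2_hom:
  assumes "field_embedding emb"
  shows "comm_ring_hom (eval2 emb x y)"
proof -
  interpret emb: field_hom emb by (rule field_embedding_hom) fact
  have "comm_ring_hom emb" by unfold_locales
  then show ?thesis
    unfolding eval2_def by (intro comm_ring_hom_poly_map_poly)
qed

locale polynomial_functions =
  fixes emb :: "'c::field \<Rightarrow> 'f::field"
  assumes emb: "field_embedding emb"
begin

sublocale emb: field_hom emb
  by (rule field_embedding_hom[OF emb])

lemma comm_ring_hom_emb: "comm_ring_hom emb" ..

definition ev :: "'f \<Rightarrow> 'c poly \<Rightarrow> 'f"
  where "ev x p = poly (map_poly emb p) x"

sublocale ev: comm_ring_hom "ev x" for x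
  unfolding ev_def by (rule comm_ring_hom_poly_map_poly) (rule comm_ring_hom_emb)

sublocale eval2: comm_ring_hom "eval2 emb x y" for x y
  by (rule eval2_hom[OF emb])

lemma ev_pCons [simp]: "ev x (pCons c p) = emb c + x * ev x p"
  by (simp add: ev_def map_poly_pCons)

lemma ev_monom [simp]: "ev x (monom c n) = emb c * x ^ n"
  by (simp add: ev_def map_poly_monom poly_monom)

lemma ev_smult [simp]: "ev x (smult c p) = emb c * ev x p"
  using ev.hom_mult[of x "[:c:]" p] by simp

lemma eval2_altdef: "eval2 emb x y g = poly (map_poly (ev x) g) y"
  by (simp add: eval2_def ev_def[abs_def])

lemma eval2_pCons [simp]: "eval2 emb x y (pCons p g) = ev x p + y * eval2 emb x y g"
  by (simp add: eval2_altdef map_poly_pCons)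

lemma eval2_monom [simp]: "eval2 emb x y (monom p n) = ev x p * y ^ n"
  by (simp add: eval2_altdef map_poly_monom poly_monom)

lemma eval2_smult [simp]: "eval2 emb x y (smult p g) = ev x p * eval2 emb x y g"
  using eval2.hom_mult[of x y "[:p:]" g] by simp

lemma eval2_sum: "eval2 emb x y g = (\<Sum>j\<le>degree g. ev x (coeff g j) * y ^ j)"
  by (subst poly_as_sum_of_monoms[symmetric]) (simp only: eval2.hom_sum eval2_monom)

lemma eval2_pcompose:
  "eval2 emb x y (pcompose g [:[:c:], 1:]) = eval2 emb x (y + emb c) g"
  by (induction g) (simp_all add: pcompose_pCons eval2.hom_add eval2.hom_mult algebra_simps)

lemma ev_linear: "ev x [:- a, 1:] = x - emb a"
  by (simp add: emb.hom_uminus)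

lemma eval2_rational: "eval2 emb x y g \<in> rational_functions emb x y"
  unfolding rational_functions_def by (rule CollectI, intro exI[of _ g] exI[of _ 1]) simp

lemma rational_functions_mult:
  assumes "f \<in> rational_functions emb x y" "g \<in> rational_functions emb x y"
  shows "f * g \<in> rational_functions emb x y"
proof -
  obtain f1 f2 where "f = eval2 emb x y f1 / eval2 emb x y f2" "eval2 emb x y f2 \<noteq> 0"
    using assms(1) by (auto simp: rational_functions_def)
  moreover obtain g1 g2 where "g = eval2 emb x y g1 / eval2 emb x y g2" "eval2 emb x y g2 \<noteq> 0"
    using assms(2) by (auto simp: rational_functions_def)
  ultimately show ?thesis
    unfolding rational_functions_def
    by (intro CollectI exI[of _ "f1 * g1"] exI[of _ "f2 * g2"]) (simp add: eval2.hom_mult)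
qed

lemma rational_functions_inverse:
  "f \<in> rational_functions emb x y \<Longrightarrow> inverse f \<in> rational_functions emb x y"
proof (cases "f = 0")
  case True
  assume "f \<in> rational_functions emb x y"
  with True show ?thesis by simp
next
  case False
  assume "f \<in> rational_functions emb x y"
  then obtain g h where "f = eval2 emb x y g / eval2 emb x y h" "eval2 emb x y h \<noteq> 0"
    by (auto simp: rational_functions_def)
  moreover from this False have "eval2 emb x y g \<noteq> 0" by auto
  ultimately show ?thesis
    unfolding rational_functions_def by (intro CollectI exI[of _ h] exI[of _ g]) simp
qed

lemma rational_functions_power_int:
  "f \<in> rational_functions emb x y \<Longrightarrow> f powi m \<in> rational_functions emb x y"
proof -
  have power: "f ^ k \<in> rational_functions emb x y" if "f \<in> rational_functions emb x y" for f k
    using that eval2_rational[of x y 1]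
    by (induction k) (auto intro: rational_functions_mult)
  assume "f \<in> rational_functions emb x y"
  then show ?thesis
    unfolding power_int_def by (auto intro: power rational_functions_inverse)
qed

lemma rational_functions_x_minus: "x - emb c \<in> rational_functions emb x y"
  using eval2_rational[of x y "[:[:- c, 1:]:]"] by (simp add: emb.hom_uminus)

lemma rational_functions_y_minus: "y - emb c \<in> rational_functions emb x y"
  using eval2_rational[of x y "[:[:- c:], 1:]"] by (simp add: emb.hom_uminus)

lemma rational_functions_prod:
  "(\<And>i. i \<in> A \<Longrightarrow> f i \<in> rational_functions emb x y) \<Longrightarrow> (\<Prod>i\<in>A. f i) \<in> rational_functions emb x y"
  using eval2_rational[of x y 1]
  by (induction A rule: infinite_finite_induct) (auto intro: rational_functions_mult)

end

lemma poly_poly_pcompose: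
  "poly (poly (pcompose g [:[:c:], 1:]) [:b:]) a = poly (poly g [:b + c:]) a"
  for g :: "'a::comm_ring_1 poly poly"
  by (simp add: poly_pcompose add.commute)

lemma degree_pcompose_shift [simp]: "degree (pcompose g [:c, 1:]) = degree g"
  for g :: "'a::idom poly"
  by (simp add: degree_pcompose)

section \<open>The curve equation as a monic polynomial in y over polynomials in x\<close>

definition curve_poly :: "nat \<Rightarrow> 'c::comm_ring_1 poly poly"
  where "curve_poly q = monom 1 q + (monom 1 1 - [:monom 1 (q + 1):])"

lemma degree_curve_poly: "degree (curve_poly q :: 'c::comm_ring_1 poly poly) = q"
  and lead_coeff_curve_poly: "lead_coeff (curve_poly q :: 'c::comm_ring_1 poly poly) = 1"
  if "q > 1"
proof -
  have "degree (monom 1 1 - [:monom 1 (q + 1):] :: 'c poly poly) \<le> 1"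
    by (intro degree_diff_le) (simp_all add: degree_monom_le)
  then have less: "degree (monom 1 1 - [:monom 1 (q + 1):] :: 'c poly poly)
      < degree (monom 1 q :: 'c poly poly)"
    using that by (simp add: degree_monom_eq)
  then show "degree (curve_poly q :: 'c poly poly) = q"
    by (simp add: curve_poly_def degree_add_eq_left degree_monom_eq)
  show "lead_coeff (curve_poly q :: 'c poly poly) = 1"
    unfolding curve_poly_def degree_add_eq_left[OF less]
    using that less by (simp add: degree_monom_eq coeff_eq_0 del: coeff_diff)
qed

text \<open>The coefficients will be polynomials in x, hence only a ring. Pseudo-division scales the
  dividend by a power of the leading coefficient, which is 1 here.\<close>

lemma monic_division:
  fixes f g :: "'a::comm_ring_1 poly"
  assumes "lead_coeff g = 1"
  obtains s r where "f = g * s + r" "r = 0 \<or> degree r < degree g"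
proof -
  obtain s r where sr: "pseudo_divmod f g = (s, r)" by force
  have "g \<noteq> 0" using assms by auto
  from pseudo_divmod[OF this sr] assms show ?thesis
    by (intro that[of s r]) simp_all
qed

text \<open>Used twice: over the closure, and over \<open>'k\<close> as the sublocale
  \<open>base\<close>. Hence the two facts that depend on the constants are assumptions.
  \<open>indep\<close> plays the role of irreducibility of the curve equation;
  \<open>card_kernel\<close> says that the translations y -> y + c defined over the constants are as
  many as the degree q of the function field over the rational functions in x.\<close>

locale hermitian_base = polynomial_functions emb
  for emb :: "'c::field \<Rightarrow> 'f::field" +
  fixes x y :: 'f and q n :: nat
  assumes prime_char: "Factorial_Ring.prime CHAR('c)" and q_def: "q = CHAR('c) ^ n" and q_gt_1: "q > 1"
    and curve: "y ^ q + y = x ^ (q + 1)"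
    and card_kernel: "card {c::'c. c ^ q + c = 0} = q"
    and indep: "degree g < q \<Longrightarrow> eval2 emb x y g = 0 \<Longrightarrow> g = 0"
begin

abbreviation E where "E \<equiv> eval2 emb x y"

definition C :: "'c set" where "C = {c. c ^ q + c = 0}"

lemma card_C: "card C = q" and finite_C: "finite C" and zero_in_C: "0 \<in> C"
  using card_kernel q_gt_1 card.infinite[of C] by (auto simp: C_def power_0_left)

lemma CHAR_f: "CHAR('f) = CHAR('c)"
  by (rule CHAR_eqI) (auto simp flip: emb.hom_of_nat simp: of_nat_eq_0_iff_char_dvd)

lemma power_q_add: "(u + v) ^ q = u ^ q + v ^ q" for u v :: 'c
  using freshmans_dream'[OF prime_char q_def] .

lemma power_q_add_f: "(u + v) ^ q = u ^ q + v ^ q" for u v :: 'f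
  using prime_char q_def unfolding CHAR_f[symmetric] by (rule freshmans_dream')

lemma of_nat_q: "of_nat q = (0 :: 'c)"
  using q_def q_gt_1 by (cases n) (simp_all add: of_nat_eq_0_iff_char_dvd)

lemma power_q_minus: "(- u) ^ q = - (u ^ q)" for u :: 'c
  using power_q_add[of u "- u"] q_gt_1 by (simp add: power_0_left add_eq_0_iff)

lemma eval2_curve_poly:
  "eval2 emb x y' (curve_poly q) = 0 \<longleftrightarrow> y' ^ q + y' = x ^ (q + 1)"
  by (auto simp: curve_poly_def eval2.hom_add eval2.hom_minus add_diff_eq)

lemma poly_curve_poly:
  "poly (poly (curve_poly q) [:b:]) a = 0 \<longleftrightarrow> b ^ q + b = a ^ (q + 1)" for a b :: 'c
  by (auto simp: curve_poly_def poly_monom add_diff_eq)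

lemma reduce_mod_curve:
  obtains s r where "g = curve_poly q * s + r" "degree r < q" "E g = E r"
proof -
  obtain s r where sr: "g = curve_poly q * s + r" "r = 0 \<or> degree r < degree (curve_poly q :: 'c poly poly)"
    using monic_division[OF lead_coeff_curve_poly[OF q_gt_1]] by blast
  moreover have "E g = E r"
    using eval2_curve_poly[of y] curve by (simp add: sr eval2.hom_add eval2.hom_mult)
  ultimately show ?thesis
    using degree_curve_poly[where ?'c = 'c, OF q_gt_1] q_gt_1 that[of s r] by auto
qed

lemma E_eq_0_iff: "E g = 0 \<longleftrightarrow> curve_poly q dvd g"
proof
  assume "E g = 0"
  with indep show "curve_poly q dvd g"
    by (metis reduce_mod_curve add.right_neutral dvd_triv_left)
next
  assume "curve_poly q dvd g"
  then obtain s where "g = curve_poly q * s" ..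
  with eval2_curve_poly[of y] curve show "E g = 0"
    by (simp add: eval2.hom_mult)
qed

text \<open>Two polynomials that agree at (x, y) differ by a multiple of the curve equation, so they
  agree at every other solution. For y' = y + c with c in \<open>C\<close> this makes the
  translation well defined on functions.\<close>

lemma eval2_cong:
  assumes "E g = E h" and "y' ^ q + y' = x ^ (q + 1)"
  shows "eval2 emb x y' g = eval2 emb x y' h"
proof -
  have "curve_poly q dvd g - h"
    using assms(1) by (simp flip: E_eq_0_iff add: eval2.hom_minus)
  then obtain s where "g - h = curve_poly q * s" ..
  then have "eval2 emb x y' (g - h) = 0"
    using eval2_curve_poly[of y'] assms(2) by (simp add: eval2.hom_mult)
  then show ?thesis by (simp add: eval2.hom_minus)
qed

lemma poly_cong:
  assumes "E g = E h" and "b ^ q + b = a ^ (q + 1)"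
  shows "poly (poly g [:b:]) a = poly (poly h [:b:]) a"
proof -
  have "curve_poly q dvd g - h"
    using assms(1) by (simp flip: E_eq_0_iff add: eval2.hom_minus)
  then obtain s where "g - h = curve_poly q * s" ..
  then have "poly (poly (g - h) [:b:]) a = 0"
    using poly_curve_poly[of b a] assms(2) by simp
  then show ?thesis by simp
qed

lemma curve_shift: "c \<in> C \<Longrightarrow> (y + emb c) ^ q + (y + emb c) = x ^ (q + 1)"
proof -
  assume "c \<in> C"
  then have "emb (c ^ q + c) = 0" by (simp add: C_def)
  then have "emb c ^ q + emb c = 0" by (simp only: emb.hom_power emb.hom_add)
  moreover have "(y + emb c) ^ q + (y + emb c) = (y ^ q + y) + (emb c ^ q + emb c)"
    by (simp only: power_q_add_f add_ac)
  ultimately show ?thesis using curve by simp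
qed

abbreviation shift :: "'c \<Rightarrow> 'c poly poly \<Rightarrow> 'c poly poly"
  where "shift c g \<equiv> pcompose g [:[:c:], 1:]"

lemma ev_eq_0_iff [simp]: "ev x p = 0 \<longleftrightarrow> p = 0"
  using indep[of "[:p:]"] q_gt_1 by auto

text \<open>Translation preserves the degree in y, so the reduced representative of g stays reduced
  and \<open>indep\<close> applies to it.\<close>

lemma E_shift_nonzero:
  assumes "c \<in> C" "E g \<noteq> 0"
  shows "E (shift c g) \<noteq> 0"
proof
  assume eq: "E (shift c g) = 0"
  obtain s r where r: "g = curve_poly q * s + r" "degree r < q" "E g = E r"
    by (rule reduce_mod_curve)
  have "eval2 emb x (y + emb c) g = eval2 emb x (y + emb c) r"
    using eval2_cong[OF r(3) curve_shift] assms by simp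
  with eq have "E (shift c r) = 0"
    by (simp add: eval2_pcompose)
  with indep[of "shift c r"] r have "shift c r = 0"
    by simp
  then have "r = 0"
    by (simp add: pcompose_eq_0_iff)
  with r assms show False by simp
qed

section \<open>The norm to polynomials in x\<close>

definition norm_poly :: "'c poly poly \<Rightarrow> 'c poly"
  where "norm_poly g = (SOME R. (\<Prod>c\<in>C. E (shift c g)) = ev x R)"

lemma C_add: "c \<in> C \<Longrightarrow> d \<in> C \<Longrightarrow> c + d \<in> C"
  and C_minus: "c \<in> C \<Longrightarrow> - c \<in> C"
proof -
  assume c: "c \<in> C"
  have "- (c ^ q) + - c = - (c ^ q + c)" by simp
  with c show "- c \<in> C" by (auto simp: C_def power_q_minus)
  assume d: "d \<in> C"
  have "(c + d) ^ q + (c + d) = (c ^ q + c) + (d ^ q + d)"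
    by (simp add: power_q_add)
  with c d show "c + d \<in> C" by (simp add: C_def)
qed

text \<open>The norm is invariant under all q translations, and a reduced polynomial in y of degree
  below q with that symmetry is constant in y.\<close>

lemma norm_poly: "(\<Prod>c\<in>C. E (shift c g)) = ev x (norm_poly g)"
proof -
  define N where "N = (\<Prod>c\<in>C. shift c g)"
  obtain s r where r: "N = curve_poly q * s + r" "degree r < q" "E N = E r"
    by (rule reduce_mod_curve)
  \<comment> \<open>Translating by d permutes the factors of the product. Both sides are reduced, so
    equality as functions is equality as polynomials.\<close>
  have r_shift: "shift d r = r" if d: "d \<in> C" for d
  proof -
    have bij: "bij_betw (\<lambda>c. c + d) C C"
      by (rule bij_betwI[where g = "\<lambda>c. c - d"])
         (use d C_add C_minus C_add[OF _ C_minus] in auto)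
    have "E (shift d r) = eval2 emb x (y + emb d) r"
      by (simp add: eval2_pcompose)
    also have "\<dots> = eval2 emb x (y + emb d) N"
      using eval2_cong[OF r(3) curve_shift[OF d]] by simp
    also have "\<dots> = (\<Prod>c\<in>C. eval2 emb x (y + emb (c + d)) g)"
      by (simp add: N_def eval2.hom_prod eval2_pcompose emb.hom_add add_ac)
    also have "\<dots> = (\<Prod>c\<in>C. eval2 emb x (y + emb c) g)"
      by (rule prod.reindex_bij_betw[OF bij])
    also have "\<dots> = E N"
      by (simp add: N_def eval2.hom_prod eval2_pcompose)
    finally have "E (shift d r - r) = 0"
      by (simp add: eval2.hom_minus r(3))
    moreover have "degree (shift d r - r) < q"
      using r(2) by (intro degree_diff_less) simp_all
    ultimately show ?thesis
      using indep by force
  qed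
  \<comment> \<open>Invariance gives r the same value at all q constants in \<open>C\<close>; the
    difference has q roots but degree below q.\<close>
  have "r - [:poly r 0:] = 0"
  proof (rule ccontr)
    assume nz: "r - [:poly r 0:] \<noteq> 0"
    have "poly r [:d:] = poly r 0" if "d \<in> C" for d
    proof -
      have "poly (shift d r) 0 = poly r [:d:]"
        by (simp add: poly_pcompose)
      with r_shift[OF that] show ?thesis by simp
    qed
    then have sub: "(\<lambda>d. [:d:]) ` C \<subseteq> {z. poly (r - [:poly r 0:]) z = 0}"
      by auto
    have "q = card ((\<lambda>d. [:d:]) ` C)"
      by (subst card_image) (auto simp: inj_on_def card_C)
    also have "\<dots> \<le> card {z. poly (r - [:poly r 0:]) z = 0}"
      using sub poly_roots_finite[OF nz] by (rule card_mono[rotated])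
    also have "\<dots> \<le> degree (r - [:poly r 0:])"
      using nz by (rule card_poly_roots_bound)
    also have "\<dots> < q"
      using r(2) q_gt_1 by (intro degree_diff_less) simp_all
    finally show False by simp
  qed
  then have "E r = E [:poly r 0:]" by simp
  then have "(\<Prod>c\<in>C. E (shift c g)) = ev x (poly r 0)"
    using r(3) by (simp add: N_def eval2.hom_prod)
  then show ?thesis
    unfolding norm_poly_def by (rule someI)
qed

lemma norm_poly_nonzero: "E g \<noteq> 0 \<Longrightarrow> norm_poly g \<noteq> 0"
proof -
  assume "E g \<noteq> 0"
  then have "(\<Prod>c\<in>C. E (shift c g)) \<noteq> 0"
    using E_shift_nonzero finite_C by simp
  then show "norm_poly g \<noteq> 0"
    unfolding norm_poly by simp
qed

text \<open>The factor for c = 0 of the norm is \<open>E g\<close> itself; the other factors form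
  the cofactor.\<close>

lemma multiple_in_x:
  assumes "E g \<noteq> 0"
  obtains u where "E u * E g = ev x (norm_poly g)"
proof
  have "(\<Prod>c\<in>C. E (shift c g)) = E (shift 0 g) * (\<Prod>c\<in>C - {0}. E (shift c g))"
    by (rule prod.remove[OF finite_C zero_in_C])
  then show "E (\<Prod>c\<in>C - {0}. shift c g) * E g = ev x (norm_poly g)"
    using norm_poly[of g] by (simp add: eval2.hom_prod eval2_pcompose mult.commute)
qed

section \<open>Local analysis at an affine point\<close>

abbreviation pt_eval :: "'c \<Rightarrow> 'c \<Rightarrow> 'c poly poly \<Rightarrow> 'c"
  where "pt_eval a b g \<equiv> poly (poly g [:b:]) a"

definition on_curve :: "'c \<Rightarrow> 'c \<Rightarrow> bool"
  where "on_curve a b \<longleftrightarrow> b ^ q + b = a ^ (q + 1)"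

text \<open>f is a unit of the local ring at (a, b) times the m-th power of x - a. The unit is the
  quotient of g by h; the denominator is multiplied out, so that identities can be compared as
  polynomials modulo the curve.\<close>

definition local_form :: "'c \<Rightarrow> 'c \<Rightarrow> 'f \<Rightarrow> int \<Rightarrow> bool"
  where "local_form a b f m \<longleftrightarrow>
    (\<exists>g h. pt_eval a b g \<noteq> 0 \<and> pt_eval a b h \<noteq> 0 \<and> f * E h = (x - emb a) powi m * E g)"

lemma pt_eval_cong: "on_curve a b \<Longrightarrow> E g = E h \<Longrightarrow> pt_eval a b g = pt_eval a b h"
  unfolding on_curve_def by (rule poly_cong)

lemma E_nonzero: "on_curve a b \<Longrightarrow> pt_eval a b g \<noteq> 0 \<Longrightarrow> E g \<noteq> 0"
  using pt_eval_cong[of a b g 0] by auto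

lemma x_minus_nonzero: "x - emb a \<noteq> 0"
  using ev_eq_0_iff[of "[:- a, 1:]"] by (simp add: emb.hom_uminus)

lemma E_const_x: "E [:p:] = ev x p"
  by simp

lemma E_x_minus: "E [:[:- a, 1:]:] = x - emb a"
  by (simp add: emb.hom_uminus)

text \<open>By additivity of the q-th power, (y - b) ((y - b)^(q-1) + 1) = x^(q+1) - a^(q+1), which
  is divisible by x - a. The cofactor of y - b takes the value 1 at (a, b), so y - b is a local
  multiple of x - a.\<close>

lemma y_minus_times_unit:
  assumes "on_curve a b"
  obtains w w' where "pt_eval a b w = 1" "(y - emb b) * E w = (x - emb a) * E w'"
proof -
  define Y :: "'c poly poly" where "Y = [:[:- b:], 1:]"
  have "poly (monom 1 (q + 1) - [:a ^ (q + 1):]) a = 0"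
    by (simp add: poly_monom)
  then obtain w' where w': "monom 1 (q + 1) - [:a ^ (q + 1):] = [:- a, 1:] * w'"
    unfolding poly_eq_0_iff_dvd by (elim dvdE)
  have EY: "E Y = y - emb b"
    by (simp add: Y_def emb.hom_uminus)
  have "(y - emb b) ^ q = y ^ q - emb b ^ q"
    using power_q_add_f[of "y - emb b" "emb b"] by simp
  then have "(y - emb b) ^ q + (y - emb b) = (y ^ q + y) - emb (b ^ q + b)"
    by (simp add: emb.hom_add emb.hom_power)
  also have "\<dots> = x ^ (q + 1) - emb (a ^ (q + 1))"
    using curve assms by (simp add: on_curve_def)
  also have "\<dots> = ev x (monom 1 (q + 1) - [:a ^ (q + 1):])"
    by (simp add: ev.hom_minus)
  also have "\<dots> = (x - emb a) * E [:w':]"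
    unfolding w' by (simp only: ev.hom_mult ev_linear E_const_x)
  finally have 1: "(y - emb b) ^ q + (y - emb b) = (x - emb a) * E [:w':]" .
  have "(y - emb b) * E (Y ^ (q - 1) + 1) = (y - emb b) ^ q + (y - emb b)"
    using q_gt_1 by (simp add: eval2.hom_add eval2.hom_power EY distrib_left flip: power_Suc)
  with 1 have "(y - emb b) * E (Y ^ (q - 1) + 1) = (x - emb a) * E [:w':]"
    by simp
  moreover have "pt_eval a b (Y ^ (q - 1) + 1) = 1"
    using q_gt_1 by (simp add: Y_def power_0_left)
  ultimately show ?thesis by (rule that[rotated])
qed

lemma vanishing_poly:
  fixes g :: "'c poly poly"
  assumes "pt_eval a b g = 0"
  obtains g1 g2 where "g = [:[:- b:], 1:] * g1 + [:[:- a, 1:]:] * [:g2:]"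
proof -
  have "poly (g - [:poly g [:b:]:]) [:b:] = 0" by simp
  then have "[:- [:b:], 1:] dvd g - [:poly g [:b:]:]"
    by (simp only: poly_eq_0_iff_dvd)
  then obtain g1 where g1: "g - [:poly g [:b:]:] = [:- [:b:], 1:] * g1" ..
  from assms obtain g2 where "poly g [:b:] = [:- a, 1:] * g2"
    by (auto simp: poly_eq_0_iff_dvd)
  then have "[:poly g [:b:]:] = [:[:- a, 1:]:] * [:g2:]" by simp
  with g1 have "g = [:[:- b:], 1:] * g1 + [:[:- a, 1:]:] * [:g2:]"
    by (simp add: diff_eq_eq)
  then show ?thesis by (rule that)
qed

text \<open>The ideal of the point is generated by x - a and y - b; multiplication by the unit w
  from \<open>y_minus_times_unit\<close> leaves x - a as sole generator.\<close>

lemma divide_by_uniformizer: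
  assumes "on_curve a b" "pt_eval a b g = 0"
  obtains w g' where "pt_eval a b w \<noteq> 0" "E w * E g = (x - emb a) * E g'"
proof -
  obtain w w' where w: "pt_eval a b w = 1" "(y - emb b) * E w = (x - emb a) * E w'"
    using y_minus_times_unit[OF assms(1)] by blast
  obtain g1 g2 where g: "g = [:[:- b:], 1:] * g1 + [:[:- a, 1:]:] * [:g2:]"
    using vanishing_poly[OF assms(2)] by blast
  have "E g = (y - emb b) * E g1 + (x - emb a) * E [:g2:]"
    unfolding g by (simp only: eval2.hom_add eval2.hom_mult E_x_minus) (simp add: emb.hom_uminus)
  then have "E w * E g = ((y - emb b) * E w) * E g1 + (x - emb a) * (E [:g2:] * E w)"
    by (simp only: distrib_left ac_simps)
  also have "\<dots> = (x - emb a) * E (w' * g1 + [:g2:] * w)"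
    unfolding w(2) by (simp only: eval2.hom_add eval2.hom_mult distrib_left mult.assoc)
  finally show ?thesis
    using w(1) by (intro that[of w "w' * g1 + [:g2:] * w"]) auto
qed

text \<open>The power of \<open>x - a\<close> in the norm bounds the number of divisions by \<open>x - a\<close>.\<close>

lemma local_form_poly_aux:
  assumes "on_curve a b" "pt_eval a b p \<noteq> 0" "E u * E g = (x - emb a) ^ m * E p"
  shows "\<exists>k h h'. pt_eval a b h \<noteq> 0 \<and> pt_eval a b h' \<noteq> 0 \<and> E g * E h' = (x - emb a) ^ k * E h"
  using assms(2,3)
proof (induction m arbitrary: g u p)
  case 0
  then have "pt_eval a b (u * g) = pt_eval a b p"
    by (intro pt_eval_cong assms(1)) (simp add: eval2.hom_mult)
  with 0 have "pt_eval a b g \<noteq> 0" by auto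
  then show ?case
    by (intro exI[of _ 0] exI[of _ g] exI[of _ 1]) simp
next
  case (Suc m)
  show ?case
  proof (cases "pt_eval a b g = 0")
    case False
    then show ?thesis
      by (intro exI[of _ 0] exI[of _ g] exI[of _ 1]) simp
  next
    case True
    obtain w g' where w: "pt_eval a b w \<noteq> 0" "E w * E g = (x - emb a) * E g'"
      using divide_by_uniformizer[OF assms(1) True] by blast
    have "(x - emb a) * (E u * E g') = E u * (E w * E g)"
      unfolding w(2) by (simp only: ac_simps)
    also have "\<dots> = E w * (E u * E g)"
      by (simp only: ac_simps)
    also have "\<dots> = (x - emb a) * ((x - emb a) ^ m * E (w * p))"
      unfolding Suc.prems(2) by (simp add: eval2.hom_mult ac_simps)
    \<comment> \<open>One factor x - a has been cancelled on both sides, so the available power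
      drops from m + 1 to m.\<close>
    finally have "E u * E g' = (x - emb a) ^ m * E (w * p)"
      using x_minus_nonzero by simp
    moreover have "pt_eval a b (w * p) \<noteq> 0"
      using w Suc.prems by simp
    ultimately obtain k h h' where h: "pt_eval a b h \<noteq> 0" "pt_eval a b h' \<noteq> 0"
        "E g' * E h' = (x - emb a) ^ k * E h"
      using Suc.IH by blast
    have "E g * E (h' * w) = (E w * E g) * E h'"
      by (simp add: eval2.hom_mult ac_simps)
    also have "\<dots> = (x - emb a) ^ Suc k * E h"
      unfolding w(2) using h(3) by (simp add: ac_simps)
    finally show ?thesis
      using h w by (intro exI[of _ "Suc k"] exI[of _ h] exI[of _ "h' * w"]) auto
  qed
qed

lemma ev_order:
  assumes "p \<noteq> 0"
  obtains p' where "poly p' a \<noteq> 0" "ev x p = (x - emb a) ^ order a p * ev x p'"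
proof -
  obtain p' where p': "p = [:- a, 1:] ^ order a p * p'" "\<not> [:- a, 1:] dvd p'"
    using order_decomp[OF assms] by blast
  have "ev x p = ev x ([:- a, 1:] ^ order a p * p')"
    using p'(1) by simp
  then have "ev x p = (x - emb a) ^ order a p * ev x p'"
    by (simp only: ev.hom_mult ev.hom_power ev_linear)
  with p'(2) show ?thesis
    by (intro that[of p']) (auto simp: poly_eq_0_iff_dvd)
qed

text \<open>The norm is the multiple of \<open>E g\<close> from which the induction starts: a power
  of x - a times a polynomial in x that is nonzero at a.\<close>

lemma local_form_poly:
  assumes "on_curve a b" "E g \<noteq> 0"
  obtains k where "local_form a b (E g) (int k)"
proof -
  obtain u where u: "E u * E g = ev x (norm_poly g)"
    using multiple_in_x[OF assms(2)] by blast
  obtain p' where p': "poly p' a \<noteq> 0"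
      "ev x (norm_poly g) = (x - emb a) ^ order a (norm_poly g) * ev x p'"
    using ev_order[OF norm_poly_nonzero[OF assms(2)]] by blast
  have "pt_eval a b [:p':] \<noteq> 0" "E u * E g = (x - emb a) ^ order a (norm_poly g) * E [:p':]"
    using p' u by simp_all
  from local_form_poly_aux[OF assms(1) this]
  obtain k h h' where "pt_eval a b h \<noteq> 0 \<and> pt_eval a b h' \<noteq> 0 \<and> E g * E h' = (x - emb a) ^ k * E h"
    by blast
  then show ?thesis
    by (intro that[of k]) (auto simp: local_form_def)
qed

lemma local_form_mult:
  assumes "local_form a b f m" "local_form a b g k"
  shows "local_form a b (f * g) (m + k)"
proof -
  obtain f1 f2 where f: "pt_eval a b f1 \<noteq> 0" "pt_eval a b f2 \<noteq> 0" "f * E f2 = (x - emb a) powi m * E f1"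
    using assms(1) by (auto simp: local_form_def)
  obtain g1 g2 where g: "pt_eval a b g1 \<noteq> 0" "pt_eval a b g2 \<noteq> 0" "g * E g2 = (x - emb a) powi k * E g1"
    using assms(2) by (auto simp: local_form_def)
  have "f * g * E (f2 * g2) = (f * E f2) * (g * E g2)"
    by (simp add: eval2.hom_mult)
  also have "\<dots> = (x - emb a) powi (m + k) * E (f1 * g1)"
    using f(3) g(3) x_minus_nonzero by (simp add: eval2.hom_mult power_int_add)
  finally show ?thesis
    unfolding local_form_def using f g by (intro exI[of _ "f1 * g1"] exI[of _ "f2 * g2"]) simp
qed

lemma local_form_inverse:
  assumes "on_curve a b" "local_form a b f m"
  shows "local_form a b (inverse f) (- m)"
proof -
  obtain f1 f2 where f: "pt_eval a b f1 \<noteq> 0" "pt_eval a b f2 \<noteq> 0" "f * E f2 = (x - emb a) powi m * E f1"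
    using assms(2) by (auto simp: local_form_def)
  then have nz: "E f1 \<noteq> 0" "E f2 \<noteq> 0"
    using E_nonzero assms(1) by auto
  with f(3) x_minus_nonzero have "f \<noteq> 0"
    by auto
  then have "inverse f * E f1 = (x - emb a) powi (- m) * E f2"
    using f(3) nz x_minus_nonzero by (simp add: power_int_minus field_simps)
  with f(1,2) show ?thesis
    unfolding local_form_def by blast
qed

lemma local_form_exists:
  assumes "on_curve a b" "f \<in> rational_functions emb x y" "f \<noteq> 0"
  obtains m where "local_form a b f m"
proof -
  obtain g h where gh: "f = E g / E h" "E h \<noteq> 0"
    using assms(2) by (auto simp: rational_functions_def)
  then have "E g \<noteq> 0" using assms(3) by auto
  obtain k where k: "local_form a b (E g) (int k)"
    using local_form_poly[OF assms(1) \<open>E g \<noteq> 0\<close>] .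
  obtain l where l: "local_form a b (E h) (int l)"
    using local_form_poly[OF assms(1) \<open>E h \<noteq> 0\<close>] .
  from local_form_mult[OF k local_form_inverse[OF assms(1) l]] gh(1) show ?thesis
    by (intro that) (simp add: divide_inverse)
qed

text \<open>If m > k, cancelling the k-th power of x - a equates a polynomial nonzero at (a, b) with
  one divisible by x - a.\<close>

lemma local_form_unique_aux:
  assumes "on_curve a b" "local_form a b f m" "local_form a b f k"
  shows "m \<le> k"
proof (rule ccontr)
  assume "\<not> m \<le> k"
  then have km: "k < m" by simp
  obtain f1 f2 where f: "pt_eval a b f1 \<noteq> 0" "pt_eval a b f2 \<noteq> 0" "f * E f2 = (x - emb a) powi m * E f1"
    using assms(2) by (auto simp: local_form_def)
  obtain g1 g2 where g: "pt_eval a b g1 \<noteq> 0" "pt_eval a b g2 \<noteq> 0" "f * E g2 = (x - emb a) powi k * E g1"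
    using assms(3) by (auto simp: local_form_def)
  have m: "(x - emb a) powi m = (x - emb a) powi k * (x - emb a) ^ nat (m - k)"
    using km x_minus_nonzero power_int_add[of "x - emb a" k "m - k"] by (simp add: power_int_def)
  have "(x - emb a) powi k * E (g1 * f2) = (f * E g2) * E f2"
    using g(3) by (simp add: eval2.hom_mult)
  also have "\<dots> = (f * E f2) * E g2"
    by simp
  also have "\<dots> = (x - emb a) powi k * ((x - emb a) ^ nat (m - k) * E (f1 * g2))"
    using f(3) m by (simp add: eval2.hom_mult)
  finally have "E (g1 * f2) = (x - emb a) ^ nat (m - k) * E (f1 * g2)"
    using x_minus_nonzero by simp
  also have "\<dots> = E ([:[:- a, 1:]:] ^ nat (m - k) * (f1 * g2))"
    by (simp only: eval2.hom_mult eval2.hom_power E_x_minus)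
  finally have "pt_eval a b (g1 * f2) = pt_eval a b ([:[:- a, 1:]:] ^ nat (m - k) * (f1 * g2))"
    by (rule pt_eval_cong[OF assms(1)])
  also have "\<dots> = 0"
    using km by simp
  finally show False
    using f g by simp
qed

lemma local_form_unique:
  "on_curve a b \<Longrightarrow> local_form a b f m \<Longrightarrow> local_form a b f k \<Longrightarrow> m = k"
  using local_form_unique_aux by (intro antisym)

text \<open>After the smaller power of x - a is factored out, the cofactor is a polynomial over a
  unit, and polynomials have nonnegative order.\<close>

lemma local_form_add:
  assumes "on_curve a b" "local_form a b f m" "local_form a b g k" "f + g \<noteq> 0" "m \<le> k"
  obtains l where "local_form a b (f + g) l" "m \<le> l"
proof -
  obtain f1 f2 where f: "pt_eval a b f1 \<noteq> 0" "pt_eval a b f2 \<noteq> 0" "f * E f2 = (x - emb a) powi m * E f1"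
    using assms(2) by (auto simp: local_form_def)
  obtain g1 g2 where g: "pt_eval a b g1 \<noteq> 0" "pt_eval a b g2 \<noteq> 0" "g * E g2 = (x - emb a) powi k * E g1"
    using assms(3) by (auto simp: local_form_def)
  have k: "(x - emb a) powi k = (x - emb a) powi m * (x - emb a) ^ nat (k - m)"
    using assms(5) x_minus_nonzero power_int_add[of "x - emb a" m "k - m"]
    by (simp add: power_int_def)
  define s where "s = f1 * g2 + [:[:- a, 1:]:] ^ nat (k - m) * (g1 * f2)"
  have s: "E s = E f1 * E g2 + (x - emb a) ^ nat (k - m) * (E g1 * E f2)"
    by (simp only: s_def eval2.hom_add eval2.hom_mult eval2.hom_power E_x_minus)
  have "(f + g) * E (f2 * g2) = (f * E f2) * E g2 + (g * E g2) * E f2"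
    by (simp add: eval2.hom_mult algebra_simps)
  also have "\<dots> = (x - emb a) powi m * E s"
    unfolding s f(3) g(3) k by (simp only: distrib_left ac_simps)
  finally have fg: "(f + g) * E (f2 * g2) = (x - emb a) powi m * E s" .
  have nz: "E (f2 * g2) \<noteq> 0"
    using f g E_nonzero[OF assms(1), of "f2 * g2"] by simp
  with fg assms(4) have "E s \<noteq> 0" by auto
  then obtain l where l: "local_form a b (E s) (int l)"
    using local_form_poly[OF assms(1)] by blast
  have 1: "local_form a b ((x - emb a) powi m) m"
    unfolding local_form_def by (intro exI[of _ 1]) simp
  have "local_form a b (E (f2 * g2)) 0"
    unfolding local_form_def using f g by (intro exI[of _ "f2 * g2"] exI[of _ 1]) simp
  then have "local_form a b (((x - emb a) powi m * E s) * inverse (E (f2 * g2))) (m + int l + - 0)"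
    by (intro local_form_mult local_form_inverse 1 l assms(1))
  also have "((x - emb a) powi m * E s) * inverse (E (f2 * g2)) = f + g"
    unfolding fg[symmetric] using nz by simp
  finally show ?thesis
    by (rule that) simp
qed

lemma local_form_const: "c \<noteq> 0 \<Longrightarrow> local_form a b (emb c) 0"
  unfolding local_form_def by (intro exI[of _ "[:[:c:]:]"] exI[of _ 1]) simp

lemma local_form_uniformizer: "local_form a b (x - emb a) 1"
  unfolding local_form_def by (intro exI[of _ 1]) simp

end

section \<open>Places\<close>

locale place = polynomial_functions emb
  for emb :: "'c::field \<Rightarrow> 'f::field" +
  fixes P :: "'f \<Rightarrow> int"
  assumes curve_point: "curve_point emb P"
begin

lemma P_0 [simp]: "P 0 = 0"
  and P_mult: "f \<noteq> 0 \<Longrightarrow> g \<noteq> 0 \<Longrightarrow> P (f * g) = P f + P g"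
  and P_add: "f \<noteq> 0 \<Longrightarrow> g \<noteq> 0 \<Longrightarrow> f + g \<noteq> 0 \<Longrightarrow> P (f + g) \<ge> min (P f) (P g)"
  and P_const [simp]: "P (emb c) = 0"
  using curve_point by (auto simp: curve_point_def) (metis emb.hom_zero)

lemma P_1 [simp]: "P 1 = 0"
  using P_const[of 1] by simp

lemma P_minus [simp]: "P (- f) = P f"
proof (cases "f = 0")
  case False
  then have "P (emb (- 1) * f) = P f"
    by (subst P_mult) auto
  then show ?thesis by (simp add: emb.hom_uminus)
qed simp

lemma P_inverse: "P (inverse f) = - P f"
  using P_mult[of f "inverse f"] by (cases "f = 0") auto

lemma P_divide: "f \<noteq> 0 \<Longrightarrow> g \<noteq> 0 \<Longrightarrow> P (f / g) = P f - P g"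
  by (simp add: divide_inverse P_mult P_inverse)

lemma P_power: "P (f ^ k) = int k * P f"
proof (cases "f = 0")
  case False
  then show ?thesis
    by (induction k) (auto simp: P_mult algebra_simps)
qed (simp add: power_0_left)

lemma P_power_int: "P (f powi k) = k * P f"
  by (simp add: power_int_def P_power P_inverse power_inverse)

lemma P_prod: "finite A \<Longrightarrow> (\<And>i. i \<in> A \<Longrightarrow> f i \<noteq> 0) \<Longrightarrow> P (\<Prod>i\<in>A. f i) = (\<Sum>i\<in>A. P (f i))"
  by (induction A rule: finite_induct) (auto simp: P_mult)

lemma P_add_less:
  assumes "f \<noteq> 0" "P f < P g \<or> g = 0"
  shows "f + g \<noteq> 0 \<and> P (f + g) = P f"
proof (cases "g = 0")
  case False
  with assms have less: "P f < P g" by simp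
  have nz: "f + g \<noteq> 0"
    using less by (auto simp: add_eq_0_iff)
  have "P f \<ge> min (P (f + g)) (P (- g))"
    using P_add[of "f + g" "- g"] nz False assms by simp
  with P_add[OF assms(1) False nz] less nz show ?thesis by auto
qed (use assms in auto)

text \<open>Distinct orders leave a single dominant term at every stage of the sum. This rules out
  cancellation between the terms of a polynomial at infinity.\<close>

lemma P_sum_distinct:
  assumes "finite J" "J \<noteq> {}" "\<And>j. j \<in> J \<Longrightarrow> f j \<noteq> 0" "inj_on (\<lambda>j. P (f j)) J"
  shows "sum f J \<noteq> 0 \<and> P (sum f J) = Min ((\<lambda>j. P (f j)) ` J)"
  using assms
proof (induction J rule: finite_ne_induct)
  case (insert i J)
  then have IH: "sum f J \<noteq> 0" "P (sum f J) = Min ((\<lambda>j. P (f j)) ` J)"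
    by (auto simp: inj_on_insert)
  have "Min ((\<lambda>j. P (f j)) ` J) \<in> (\<lambda>j. P (f j)) ` J"
    using insert by (intro Min_in) auto
  then have "P (f i) \<noteq> P (sum f J)"
    using insert(3) insert.prems(2) by (simp add: IH(2) inj_on_insert) (metis Diff_insert_absorb)
  then consider "P (f i) < P (sum f J)" | "P (sum f J) < P (f i)"
    by linarith
  then show ?case
  proof cases
    case 1
    with P_add_less[of "f i" "sum f J"] insert IH show ?thesis by auto
  next
    case 2
    with P_add_less[of "sum f J" "f i"] insert IH show ?thesis by (auto simp: add.commute)
  qed
qed auto

lemma regular_at_0 [simp]: "regular_at P 0"
  by (simp add: regular_at_def)

lemma vanishes_at_0 [simp]: "vanishes_at P 0"
  by (simp add: vanishes_at_def)

lemma regular_at_add: "regular_at P f \<Longrightarrow> regular_at P g \<Longrightarrow> regular_at P (f + g)"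
  using P_add[of f g] by (cases "f = 0"; cases "g = 0"; cases "f + g = 0") (auto simp: regular_at_def)

lemma regular_at_mult: "regular_at P f \<Longrightarrow> regular_at P g \<Longrightarrow> regular_at P (f * g)"
  using P_mult[of f g] by (cases "f = 0"; cases "g = 0") (auto simp: regular_at_def)

lemma regular_at_const [simp]: "regular_at P (emb c)"
  by (simp add: regular_at_def)

lemma vanishes_at_add: "vanishes_at P f \<Longrightarrow> vanishes_at P g \<Longrightarrow> vanishes_at P (f + g)"
  using P_add[of f g] by (cases "f = 0"; cases "g = 0"; cases "f + g = 0") (auto simp: vanishes_at_def)

lemma vanishes_at_mult: "vanishes_at P f \<Longrightarrow> regular_at P g \<Longrightarrow> vanishes_at P (f * g)"
  using P_mult[of f g] by (cases "f = 0"; cases "g = 0") (auto simp: vanishes_at_def regular_at_def)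

lemma vanishes_at_minus: "vanishes_at P f \<Longrightarrow> vanishes_at P (- f)"
  by (auto simp: vanishes_at_def)

lemma vanishes_at_diff: "vanishes_at P f \<Longrightarrow> vanishes_at P g \<Longrightarrow> vanishes_at P (f - g)"
  using vanishes_at_add[OF _ vanishes_at_minus, of f g] by simp

lemma vanishes_at_imp_regular: "vanishes_at P f \<Longrightarrow> regular_at P f"
  by (auto simp: vanishes_at_def regular_at_def)

lemma vanishes_at_const [simp]: "vanishes_at P (emb c) \<longleftrightarrow> c = 0"
  by (auto simp: vanishes_at_def)

lemma regular_at_ev: "regular_at P x \<Longrightarrow> regular_at P (ev x p)"
  by (induction p) (auto intro!: regular_at_add regular_at_mult)

lemma regular_at_eval2: "regular_at P x \<Longrightarrow> regular_at P y \<Longrightarrow> regular_at P (eval2 emb x y g)"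
  by (induction g) (auto intro!: regular_at_add regular_at_mult regular_at_ev)

lemma regular_at_of_vanishes_diff: "vanishes_at P (f - emb c) \<Longrightarrow> regular_at P f"
  using regular_at_add[OF vanishes_at_imp_regular[of "f - emb c"] regular_at_const[of c]] by simp

lemma vanishes_at_mult_diff:
  assumes "vanishes_at P (f - emb c)" "vanishes_at P (g - emb d)"
  shows "vanishes_at P (f * g - emb (c * d))"
proof -
  have "f * g - emb (c * d) = (f - emb c) * g + (g - emb d) * emb c"
    by (simp add: emb.hom_mult algebra_simps)
  then show ?thesis
    using assms regular_at_of_vanishes_diff by (auto intro!: vanishes_at_add vanishes_at_mult)
qed

lemma vanishes_at_add_diff:
  assumes "vanishes_at P (f - emb c)" "vanishes_at P (g - emb d)"
  shows "vanishes_at P (f + g - emb (c + d))"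
  using vanishes_at_add[OF assms] by (simp add: emb.hom_add algebra_simps)

lemma vanishes_at_ev:
  "vanishes_at P (x - emb a) \<Longrightarrow> vanishes_at P (ev x p - emb (poly p a))"
  by (induction p) (auto intro!: vanishes_at_add_diff vanishes_at_mult_diff)

lemma vanishes_at_eval2:
  "vanishes_at P (x - emb a) \<Longrightarrow> vanishes_at P (y - emb b) \<Longrightarrow>
    vanishes_at P (eval2 emb x y g - emb (poly (poly g [:b:]) a))"
  by (induction g)
    (auto intro!: vanishes_at_add_diff vanishes_at_mult_diff vanishes_at_ev)

lemma unit_of_vanishes_diff:
  assumes "vanishes_at P (f - emb c)" "c \<noteq> 0"
  shows "f \<noteq> 0" "P f = 0"
proof -
  show f: "f \<noteq> 0"
    using assms vanishes_at_const[of "- c"] by (auto simp: emb.hom_uminus)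
  show "P f = 0"
  proof (cases "f = emb c")
    case False
    then have "P (f - emb c) > 0"
      using assms(1) by (auto simp: vanishes_at_def)
    then show ?thesis
      using P_add_less[of "emb c" "f - emb c"] assms(2) by simp
  qed simp
qed

lemma vanishes_at_inverse_diff:
  assumes "vanishes_at P (f - emb c)" "c \<noteq> 0"
  shows "vanishes_at P (inverse f - emb (inverse c))"
proof -
  note f = unit_of_vanishes_diff[OF assms]
  have "inverse f - emb (inverse c) = (f - emb c) * (- inverse f * emb (inverse c))"
    unfolding emb.hom_inverse using f assms(2) emb.hom_0_iff[of c] by (simp add: field_simps)
  moreover have "regular_at P (- inverse f * emb (inverse c))"
    using f by (intro regular_at_mult) (auto simp: regular_at_def P_inverse)
  ultimately show ?thesis
    using assms(1) by (simp only: vanishes_at_mult)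
qed

lemma vanishes_at_power_diff: "vanishes_at P (f - emb c) \<Longrightarrow> vanishes_at P (f ^ m - emb (c ^ m))"
  by (induction m) (auto intro: vanishes_at_mult_diff)

lemma vanishes_at_power_int_diff:
  "vanishes_at P (f - emb c) \<Longrightarrow> c \<noteq> 0 \<Longrightarrow> vanishes_at P (f powi m - emb (c powi m))"
  unfolding power_int_def
  by (auto intro!: vanishes_at_power_diff vanishes_at_inverse_diff)

lemma vanishes_at_prod_diff:
  "(\<And>i. i \<in> A \<Longrightarrow> vanishes_at P (f i - emb (c i))) \<Longrightarrow>
    vanishes_at P ((\<Prod>i\<in>A. f i) - emb (\<Prod>i\<in>A. c i))"
  by (induction A rule: infinite_finite_induct) (auto intro: vanishes_at_mult_diff)

lemma vanishes_at_diff_unique: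
  "vanishes_at P (f - emb c) \<Longrightarrow> vanishes_at P (f - emb d) \<Longrightarrow> c = d"
  using vanishes_at_diff[of "f - emb c" "f - emb d"] vanishes_at_const[of "d - c"]
  by (simp add: emb.hom_minus)

end

section \<open>The place at infinity\<close>

text \<open>The pole order of \<open>x\<^sup>iy\<^sup>j\<close> at infinity is \<open>q i + (q + 1) j\<close>.\<close>

definition weight :: "nat \<Rightarrow> 'c::zero poly poly \<Rightarrow> nat"
  where "weight q g = Max ((\<lambda>j. q * degree (coeff g j) + (q + 1) * j) ` {j. coeff g j \<noteq> 0})"

lemma finite_coeff_nonzero: "finite {j. coeff g j \<noteq> 0}"
  by (rule finite_subset[of _ "{..degree g}"]) (auto intro: le_degree)

lemma coeff_weight_le: "coeff g j \<noteq> 0 \<Longrightarrow> q * degree (coeff g j) + (q + 1) * j \<le> weight q g"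
  unfolding weight_def using finite_coeff_nonzero[of g] by (intro Max_ge) auto

text \<open>The curve equation alone forces the two orders only up to a common factor
  \<open>e\<close>. The factor is kept because the formula for pole orders is needed to obtain
  \<open>indep\<close>, before functions can be written as quotients of reduced polynomials and e =
  1 can be shown.\<close>

locale pole_place = place emb P
  for emb :: "'c::field \<Rightarrow> 'f::field" and P +
  fixes x y :: 'f and q :: nat and e :: int
  assumes P_x: "P x = - (int q * e)" and P_y: "P y = - (int (q + 1) * e)" and e_pos: "e > 0"
    and q_gt_1: "q > 1"
begin

lemma x_nonzero: "x \<noteq> 0" and y_nonzero: "y \<noteq> 0"
  using P_x P_y e_pos q_gt_1 P_0 by auto

lemma P_ev: "p \<noteq> 0 \<Longrightarrow> ev x p \<noteq> 0 \<and> P (ev x p) = - (int q * e * int (degree p))"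
proof (induction p)
  case (pCons c p)
  show ?case
  proof (cases "p = 0")
    case True
    with pCons show ?thesis by auto
  next
    case False
    with pCons have IH: "ev x p \<noteq> 0" "P (ev x p) = - (int q * e * int (degree p))"
      by auto
    then have *: "P (x * ev x p) = - (int q * e * int (degree (pCons c p)))"
      using x_nonzero False by (simp add: P_mult P_x algebra_simps)
    moreover have "int q * e * int (degree (pCons c p)) > 0"
      using e_pos q_gt_1 False by simp
    ultimately have "P (x * ev x p) < P (emb c)"
      by simp
    with P_add_less[of "x * ev x p" "emb c"] * IH x_nonzero show ?thesis
      by (auto simp: add.commute)
  qed
qed auto

text \<open>The weight q i + (q + 1) j is congruent to j modulo q, so for j < q the terms have
  pairwise distinct orders. The nonvanishing in the conclusion is the linear independence of 1, y,
  ..., y^(q-1) over the rational functions in x.\<close>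

lemma P_eval2:
  assumes "g \<noteq> 0" "degree g < q"
  shows "eval2 emb x y g \<noteq> 0 \<and> P (eval2 emb x y g) = - (e * int (weight q g))"
proof -
  define J where "J = {j. coeff g j \<noteq> 0}"
  define f where "f j = ev x (coeff g j) * y ^ j" for j
  define w where "w j = q * degree (coeff g j) + (q + 1) * j" for j
  have J: "finite J" "J \<noteq> {}"
    using finite_coeff_nonzero[of g] assms(1) leading_coeff_neq_0[of g]
    unfolding J_def by blast+
  have Jq: "j < q" if "j \<in> J" for j
    using that assms(2) le_degree[of g j] by (auto simp: J_def)
  have nz: "f j \<noteq> 0" if "j \<in> J" for j
    using that P_ev y_nonzero by (simp add: f_def J_def)
  have P: "P (f j) = - (e * int (w j))" if "j \<in> J" for j
    using that P_ev[of "coeff g j"] y_nonzero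
    by (auto simp: f_def J_def P_mult P_power P_y w_def algebra_simps)
  have inj: "inj_on w J"
  proof (rule inj_onI)
    fix i j assume ij: "i \<in> J" "j \<in> J" "w i = w j"
    then have "w i mod q = w j mod q" by simp
    moreover have "w k = k + q * (degree (coeff g k) + k)" for k
      by (simp add: w_def algebra_simps)
    ultimately show "i = j"
      using Jq ij by simp
  qed
  have "inj_on (\<lambda>j. P (f j)) J"
    using inj e_pos by (auto simp: inj_on_def P)
  from P_sum_distinct[OF J nz this]
  have 1: "sum f J \<noteq> 0" "P (sum f J) = Min ((\<lambda>j. P (f j)) ` J)" by auto
  have 2: "eval2 emb x y g = sum f J"
    unfolding eval2_sum f_def
    by (rule sum.mono_neutral_right) (auto simp: J_def intro: le_degree)
  have "Min ((\<lambda>j. P (f j)) ` J) = - (e * int (weight q g))"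
  proof (rule Min_eqI)
    show "finite ((\<lambda>j. P (f j)) ` J)"
      using J by simp
    have "weight q g \<in> w ` J"
      unfolding weight_def w_def[symmetric] J_def[symmetric] using J by (intro Max_in) auto
    then obtain j where j: "j \<in> J" "weight q g = w j" by auto
    then show "- (e * int (weight q g)) \<in> (\<lambda>j. P (f j)) ` J"
      using P by force
    fix z assume "z \<in> (\<lambda>j. P (f j)) ` J"
    then obtain i where i: "i \<in> J" "z = P (f i)" by auto
    then have "w i \<le> weight q g"
      using coeff_weight_le[of g i q] by (simp add: J_def w_def)
    then show "- (e * int (weight q g)) \<le> z"
      using i P e_pos by simp
  qed
  with 1 2 show ?thesis by simp
qed

end

text \<open>If y were regular, the curve equation would make x regular too. So y has a pole, y^q
  dominates y, and q P(y) = (q + 1) P(x); coprimality of q and q + 1 yields the shape of both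
  orders.\<close>

lemma point_at_infinity_pole_place:
  assumes emb: "field_embedding emb" and "point_at_infinity emb x y P"
    and curve: "y ^ q + y = x ^ (q + 1)" and q: "q > 1"
  obtains e where "pole_place emb P x y q e"
proof -
  interpret place emb P
    using assms by unfold_locales (auto simp: point_at_infinity_def)
  have nreg: "\<not> (regular_at P x \<and> regular_at P y)"
    using assms by (auto simp: point_at_infinity_def)
  have y_neg: "y \<noteq> 0 \<and> P y < 0"
  proof (rule ccontr)
    assume "\<not> (y \<noteq> 0 \<and> P y < 0)"
    then have y: "regular_at P y" by (auto simp: regular_at_def)
    have "regular_at P (y ^ k)" for k
      using y by (auto simp: regular_at_def P_power)
    then have "regular_at P (x ^ (q + 1))"
      unfolding curve[symmetric] using y by (intro regular_at_add)
    then have "regular_at P x"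
      by (auto simp: regular_at_def P_power zero_le_mult_iff simp del: power_Suc)
    with y nreg show False by simp
  qed
  have Py: "P (y ^ q) < P y"
    using y_neg q mult_strict_right_mono_neg[of 1 "int q" "P y"] by (simp add: P_power)
  then have "P (y ^ q + y) = int q * P y" "y ^ q + y \<noteq> 0"
    using P_add_less[of "y ^ q" y] y_neg by (auto simp: P_power)
  then have eq: "int q * P y = int (q + 1) * P x"
    unfolding curve by (simp only: P_power)
  then have "int q dvd int (q + 1) * P x"
    by (metis dvd_triv_left)
  moreover have "coprime (int q) (int (q + 1))"
    by (simp only: of_nat_add of_nat_1 coprime_add_one_right)
  ultimately have "int q dvd P x"
    by (simp only: coprime_dvd_mult_right_iff)
  then obtain k where k: "P x = int q * k" ..
  with eq have "int q * P y = int q * (int (q + 1) * k)"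
    by (simp only: ac_simps)
  then have y: "P y = int (q + 1) * k"
    using q by simp
  with y_neg have "k < 0"
    by (simp add: mult_less_0_iff)
  then show ?thesis
    using k y q by (intro that[of "- k"]) (unfold_locales, auto)
qed

section \<open>Polynomials in one variable\<close>

lemma sum_order_eq_degree:
  fixes p :: "'a::alg_closed_field poly"
  assumes "p \<noteq> 0"
  shows "(\<Sum>a | poly p a = 0. order a p) = degree p"
  using assms
proof (induction "degree p" arbitrary: p)
  case 0
  then obtain c where c: "p = [:c:]" by (metis degree_eq_zeroE)
  with 0 show ?case by simp
next
  case (Suc m)
  then obtain a where "poly p a = 0"
    using alg_closed_imp_poly_has_root[of p] by auto
  then obtain r where r: "p = [:- a, 1:] * r"
    unfolding poly_eq_0_iff_dvd by (elim dvdE)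
  with Suc have nz: "r \<noteq> 0" by auto
  have deg: "degree p = Suc (degree r)"
    unfolding r using nz by (subst degree_mult_eq) auto
  have order: "order b p = (if b = a then 1 else 0) + order b r" for b
    using Suc.prems order_mult[of "[:- a, 1:]" r b] order_power_n_n[of a 1] order_0I[of "[:- a, 1:]" b]
    by (auto simp: r simp del: mult_pCons_left)
  have fin: "finite {b. poly p b = 0}"
    using Suc.prems by (rule poly_roots_finite)
  have "(\<Sum>b | poly p b = 0. order b p) = 1 + (\<Sum>b | poly p b = 0. order b r)"
    using \<open>poly p a = 0\<close> fin by (simp add: order sum.distrib)
  also have "(\<Sum>b | poly p b = 0. order b r) = (\<Sum>b | poly r b = 0. order b r)"
    using fin by (intro sum.mono_neutral_right) (auto simp: r order_root nz)
  also have "\<dots> = degree r"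
    using Suc.hyps deg nz by auto
  finally show ?case using deg by simp
qed

lemma monic_prod_linear:
  assumes "finite S"
  shows "degree (\<Prod>l\<in>S. [:- l, 1:]) = card S" "coeff (\<Prod>l\<in>S. [:- l, 1 :: 'a::field:]) (card S) = 1"
proof -
  have "degree (\<Prod>l\<in>S. [:- l, 1:]) = card S \<and> lead_coeff (\<Prod>l\<in>S. [:- l, 1 :: 'a:]) = 1"
    using assms
  proof (induction S rule: finite_induct)
    case (insert b S)
    have nz: "(\<Prod>l\<in>S. [:- l, 1 :: 'a:]) \<noteq> 0"
      using insert.hyps by (subst prod_zero_iff) auto
    have "(\<Prod>l\<in>insert b S. [:- l, 1 :: 'a:]) = [:- b, 1:] * (\<Prod>l\<in>S. [:- l, 1:])"
      using insert.hyps by (rule prod.insert)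
    moreover have "degree ([:- b, 1:] * (\<Prod>l\<in>S. [:- l, 1 :: 'a:])) = Suc (card S)"
      using insert nz by (subst degree_mult_eq) auto
    moreover have "lead_coeff ([:- b, 1:] * (\<Prod>l\<in>S. [:- l, 1 :: 'a:])) = 1"
      using insert.IH unfolding lead_coeff_mult by auto
    ultimately show ?case
      using insert.hyps by (simp only: card_insert_disjoint) simp
  qed simp
  then show "degree (\<Prod>l\<in>S. [:- l, 1:]) = card S" "coeff (\<Prod>l\<in>S. [:- l, 1 :: 'a::field:]) (card S) = 1"
    by auto
qed

text \<open>The sum is the coefficient of degree \<open>card S - 1\<close> of the Lagrange interpolation polynomial of \<open>p\<close>.\<close>

lemma sum_lagrange_weights:
  fixes S :: "'a::field set"
  assumes "finite S" "\<And>j. coeff p j \<noteq> 0 \<Longrightarrow> j + 1 < card S"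
  shows "(\<Sum>b\<in>S. poly p b / (\<Prod>l\<in>S - {b}. b - l)) = 0"
proof (cases "S = {}")
  case False
  define w where "w b = poly p b / (\<Prod>l\<in>S - {b}. b - l)" for b
  \<comment> \<open>The difference of p and its Lagrange interpolant: it vanishes on S and has
    degree below \<open>card S\<close>, so it is 0.\<close>
  define r where "r = p - (\<Sum>b\<in>S. smult (w b) (\<Prod>l\<in>S - {b}. [:- l, 1:]))"
  have card: "card (S - {b}) = card S - 1" if "b \<in> S" for b
    using that assms(1) by simp
  have S: "card S > 0" using False assms(1) by (simp add: card_gt_0_iff)
  have high: "coeff r j = 0" if "j \<ge> card S" for j
  proof -
    have "coeff p j = 0" using assms(2)[of j] that by force
    moreover have "coeff (\<Prod>l\<in>S - {b}. [:- l, 1:]) j = 0" if "b \<in> S" for b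
      using monic_prod_linear(1)[of "S - {b}"] card[OF that] S assms(1) \<open>j \<ge> card S\<close>
      by (intro coeff_eq_0) simp
    ultimately show ?thesis
      by (simp add: r_def coeff_sum)
  qed
  have roots: "poly r c = 0" if c: "c \<in> S" for c
  proof -
    have "poly (\<Sum>b\<in>S. smult (w b) (\<Prod>l\<in>S - {b}. [:- l, 1:])) c
        = (\<Sum>b\<in>S. w b * (\<Prod>l\<in>S - {b}. c - l))"
      by (simp add: poly_sum poly_prod)
    also have "\<dots> = (\<Sum>b\<in>S. if b = c then poly p c else 0)"
    proof (intro sum.cong refl)
      fix b assume "b \<in> S"
      show "w b * (\<Prod>l\<in>S - {b}. c - l) = (if b = c then poly p c else 0)"
      proof (cases "b = c")
        case True
        have "(\<Prod>l\<in>S - {c}. c - l) \<noteq> 0"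
          using assms(1) by (subst prod_zero_iff) auto
        with True show ?thesis by (simp add: w_def)
      next
        case False
        then have "(\<Prod>l\<in>S - {b}. c - l) = 0"
          using assms(1) c by (subst prod_zero_iff) auto
        with False show ?thesis by simp
      qed
    qed
    also have "\<dots> = poly p c"
      using assms(1) c by simp
    finally show ?thesis by (simp add: r_def)
  qed
  have "r = 0"
  proof (rule ccontr)
    assume nz: "r \<noteq> 0"
    then have "degree r < card S"
      using high leading_coeff_neq_0 not_le by blast
    moreover have "card S \<le> card {c. poly r c = 0}"
      using roots by (intro card_mono poly_roots_finite nz) auto
    ultimately show False
      using card_poly_roots_bound[OF nz] by simp
  qed
  then have "coeff r (card S - 1) = 0" by simp
  \<comment> \<open>The bound is on indices of nonzero coefficients, not on the degree, so that for
    \<open>card S = 1\<close> it says p = 0; a degree bound could not express this.\<close>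
  moreover have "coeff p (card S - 1) = 0"
    using assms(2)[of "card S - 1"] S by force
  moreover have "coeff (\<Prod>l\<in>S - {b}. [:- l, 1:]) (card S - 1) = 1" if "b \<in> S" for b
    using monic_prod_linear(2)[of "S - {b}"] card[OF that] assms(1) by simp
  ultimately have "(\<Sum>b\<in>S. w b) = 0"
    by (simp add: r_def coeff_sum)
  then show ?thesis by (simp add: w_def)
qed simp

text \<open>The derivative of c^q + c is 1 because q = 0 in the field, so all roots are simple and
  their number is the degree.\<close>

lemma card_additive_kernel:
  fixes q :: nat
  assumes "q > 1" "of_nat q = (0 :: 'c::alg_closed_field)"
  shows "card {c::'c. c ^ q + c = 0} = q"
proof -
  define p :: "'c poly" where "p = monom 1 q + monom 1 1"
  have deg: "degree p = q"
    unfolding p_def using assms(1)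
    by (subst degree_add_eq_left) (simp_all add: degree_monom_eq)
  then have nz: "p \<noteq> 0" using assms(1) by auto
  have pderiv: "pderiv p = 1"
    using assms(2) by (simp add: p_def pderiv_add pderiv_monom monom_0 one_pCons)
  have order: "order a p = 1" if "poly p a = 0" for a
  proof -
    have "\<not> [:- a, 1:] ^ 2 dvd p"
    proof
      assume "[:- a, 1:] ^ 2 dvd p"
      then obtain r where "p = [:- a, 1:] ^ 2 * r" ..
      then have "p = [:- a, 1:] * ([:- a, 1:] * r)"
        by (simp only: power2_eq_square mult.assoc)
      then have "poly (pderiv p) a = poly ([:- a, 1:] * pderiv ([:- a, 1:] * r) + ([:- a, 1:] * r) * pderiv [:- a, 1:]) a"
        by (simp only: pderiv_mult)
      also have "\<dots> = 0" by simp
      finally show False by (simp add: pderiv)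
    qed
    then have "order a p < 2"
      using order_1[of a p] power_le_dvd not_less by blast
    moreover have "order a p \<noteq> 0"
      using that nz by (simp add: order_root)
    ultimately show ?thesis by simp
  qed
  have "card {a. poly p a = 0} = (\<Sum>a | poly p a = 0. order a p)"
    using order by simp
  also have "\<dots> = q"
    using sum_order_eq_degree[OF nz] deg by simp
  finally show ?thesis
    by (simp add: p_def poly_monom)
qed

lemma poly_poly_map_poly:
  "poly (poly g [:b:]) a = poly (map_poly (\<lambda>p. poly p a) g) b" for a b :: "'a::comm_ring_1"
  by (induction g) (simp_all add: map_poly_pCons)

text \<open>The extra factor f on the left avoids the exponent m - 1.\<close>

lemma derivation_power:
  fixes emb :: "'c::field \<Rightarrow> 'f::field"
  assumes "derivation emb \<delta>"
  shows "\<delta> (f ^ m) * f = of_nat m * f ^ m * \<delta> f"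
proof (induction m)
  case 0
  have "\<delta> (1 * 1) = 1 * \<delta> 1 + 1 * \<delta> 1"
    using assms unfolding derivation_def by blast
  then have "\<delta> 1 = 0"
    by (simp only: mult_1 add_cancel_right_right)
  then show ?case by simp
next
  case (Suc m)
  have "\<delta> (f * f ^ m) = f * \<delta> (f ^ m) + f ^ m * \<delta> f"
    using assms unfolding derivation_def by blast
  then have "\<delta> (f ^ Suc m) * f = (\<delta> (f ^ m) * f) * f + f ^ m * \<delta> f * f"
    by (simp add: algebra_simps)
  then show ?case
    unfolding Suc.IH by (simp add: algebra_simps)
qed

section \<open>Principal and canonical divisors\<close>

locale hermitian = hermitian_base emb x y q n
  for emb :: "'c::alg_closed_field \<Rightarrow> 'f::field" and x y :: 'f and q n :: nat +
  fixes Pinf :: "'f \<Rightarrow> int"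
  assumes all_rational: "rational_functions emb x y = UNIV"
    and infinity: "point_at_infinity emb x y Pinf"
begin

lemma fraction:
  assumes "f \<noteq> 0"
  obtains g h where "degree g < q" "degree h < q" "g \<noteq> 0" "h \<noteq> 0" "f = E g / E h" "E h \<noteq> 0"
proof -
  have "f \<in> rational_functions emb x y"
    using all_rational by simp
  then obtain g h where gh: "f = E g / E h" "E h \<noteq> 0"
    by (auto simp: rational_functions_def)
  obtain g' where g': "degree g' < q" "E g = E g'"
    by (rule reduce_mod_curve)
  obtain h' where h': "degree h' < q" "E h = E h'"
    by (rule reduce_mod_curve)
  from gh g' h' assms show ?thesis
    by (intro that[of g' h']) auto
qed

text \<open>Every order is a multiple of \<open>e\<close> by the weight formula for numerator and
  denominator, and a normalized valuation attains 1.\<close>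

lemma pole_place_infinity:
  assumes "point_at_infinity emb x y P"
  shows "pole_place emb P x y q 1"
proof -
  obtain e where "pole_place emb P x y q e"
    using point_at_infinity_pole_place[OF emb assms curve q_gt_1] .
  then interpret pole_place emb P x y q e .
  obtain t where t: "P t = 1"
    using curve_point by (auto simp: curve_point_def)
  then have "t \<noteq> 0" by auto
  then obtain g h where gh: "degree g < q" "degree h < q" "g \<noteq> 0" "h \<noteq> 0" "t = E g / E h"
    using fraction by metis
  then have "P t = e * (int (weight q h) - int (weight q g))"
    using P_eval2[of g] P_eval2[of h] by (simp add: P_divide algebra_simps)
  with t have "e dvd 1" by (metis dvd_triv_left)
  with e_pos have "e = 1" by simp
  with \<open>pole_place emb P x y q e\<close> show ?thesis by simp
qed

sublocale inf: pole_place emb Pinf x y q 1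
  by (rule pole_place_infinity[OF infinity])

lemma Pinf_eval2: "degree g < q \<Longrightarrow> g \<noteq> 0 \<Longrightarrow> Pinf (E g) = - int (weight q g)"
  using inf.P_eval2 by simp

lemma point_at_infinity_unique:
  assumes "point_at_infinity emb x y P"
  shows "P = Pinf"
proof
  fix f
  interpret P: pole_place emb P x y q 1
    by (rule pole_place_infinity[OF assms])
  show "P f = Pinf f"
  proof (cases "f = 0")
    case False
    then obtain g h where "degree g < q" "degree h < q" "g \<noteq> 0" "h \<noteq> 0" "f = E g / E h"
      using fraction by metis
    then show ?thesis
      using P.P_eval2[of g] P.P_eval2[of h] inf.P_eval2[of g] inf.P_eval2[of h]
      by (simp add: P.P_divide inf.P_divide)
  qed simp
qed

section \<open>Affine places and the classification of all points\<close>

definition v :: "'c \<Rightarrow> 'c \<Rightarrow> 'f \<Rightarrow> int"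
  where "v a b f = (if f = 0 then 0 else THE m. local_form a b f m)"

lemma v_eqI: "on_curve a b \<Longrightarrow> local_form a b f m \<Longrightarrow> f \<noteq> 0 \<Longrightarrow> v a b f = m"
  unfolding v_def by (simp, rule the_equality) (auto dest: local_form_unique)

lemma local_form_v:
  assumes "on_curve a b" "f \<noteq> 0"
  shows "local_form a b f (v a b f)"
proof -
  obtain m where "local_form a b f m"
    using local_form_exists[of a b f] assms all_rational by auto
  with v_eqI[OF assms(1) this] assms show ?thesis by simp
qed

lemma curve_point_v:
  assumes "on_curve a b"
  shows "curve_point emb (v a b)"
  unfolding curve_point_def
proof (intro conjI allI impI)
  show "v a b 0 = 0" by (simp add: v_def)
  fix f g :: 'f assume nz: "f \<noteq> 0" "g \<noteq> 0"
  note f = local_form_v[OF assms nz(1)] and g = local_form_v[OF assms nz(2)]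
  show "v a b (f * g) = v a b f + v a b g"
    using local_form_mult[OF f g] nz by (intro v_eqI assms) auto
  assume nz': "f + g \<noteq> 0"
  then have nz'': "g + f \<noteq> 0" by (simp add: add.commute)
  show "min (v a b f) (v a b g) \<le> v a b (f + g)"
  proof (cases "v a b f \<le> v a b g")
    case True
    obtain l where "local_form a b (f + g) l" "v a b f \<le> l"
      using local_form_add[OF assms f g nz' True] .
    with v_eqI[OF assms this(1) nz'] show ?thesis by simp
  next
    case False
    then have le: "v a b g \<le> v a b f" by simp
    obtain l where "local_form a b (g + f) l" "v a b g \<le> l"
      using local_form_add[OF assms g f nz'' le] .
    with v_eqI[OF assms this(1) nz''] show ?thesis
      by (simp add: add.commute)
  qed
next
  fix c :: 'c assume "c \<noteq> 0"
  then show "v a b (emb c) = 0"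
    using local_form_const[of c a b] by (intro v_eqI assms) auto
next
  show "\<exists>t. v a b t = 1"
    using local_form_uniformizer x_minus_nonzero v_eqI[OF assms] by blast
qed

lemma place_v: "on_curve a b \<Longrightarrow> place emb (v a b)"
  using curve_point_v by unfold_locales

lemma v_uniformizer: "on_curve a b \<Longrightarrow> v a b (x - emb a) = 1"
  using local_form_uniformizer x_minus_nonzero by (intro v_eqI)

lemma v_poly_nonneg: "on_curve a b \<Longrightarrow> v a b (E g) \<ge> 0"
proof (cases "E g = 0")
  case False
  assume on: "on_curve a b"
  obtain k where "local_form a b (E g) (int k)"
    using local_form_poly[OF on False] .
  with v_eqI[OF on this False] show ?thesis by simp
qed (simp add: v_def)

lemma v_poly_zero: "on_curve a b \<Longrightarrow> pt_eval a b g \<noteq> 0 \<Longrightarrow> v a b (E g) = 0"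
proof (rule v_eqI)
  assume "pt_eval a b g \<noteq> 0"
  then show "local_form a b (E g) 0"
    unfolding local_form_def by (intro exI[of _ g] exI[of _ 1]) simp
  assume "on_curve a b"
  then show "E g \<noteq> 0"
    using \<open>pt_eval a b g \<noteq> 0\<close> by (rule E_nonzero)
qed

lemma v_vanishes_poly:
  assumes "on_curve a b"
  shows "vanishes_at (v a b) (E g) \<longleftrightarrow> pt_eval a b g = 0"
proof
  assume "pt_eval a b g = 0"
  then obtain w g' where w: "pt_eval a b w \<noteq> 0" "E w * E g = (x - emb a) * E g'"
    using divide_by_uniformizer[OF assms] by blast
  interpret P: place emb "v a b" by (rule place_v[OF assms])
  show "vanishes_at (v a b) (E g)"
  proof (cases "E g = 0")
    case False
    have "E w \<noteq> 0" using E_nonzero assms w by blast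
    with False w have "E g' \<noteq> 0" by auto
    have "v a b (E g) = v a b (E w * E g)"
      using False \<open>E w \<noteq> 0\<close> v_poly_zero[OF assms w(1)] by (simp add: P.P_mult)
    also have "\<dots> = 1 + v a b (E g')"
      unfolding w(2) using \<open>E g' \<noteq> 0\<close> x_minus_nonzero
      by (simp add: P.P_mult v_uniformizer[OF assms])
    finally show ?thesis
      using v_poly_nonneg[OF assms, of g'] by (simp add: vanishes_at_def)
  qed simp
next
  assume "vanishes_at (v a b) (E g)"
  then show "pt_eval a b g = 0"
    using v_poly_zero[OF assms, of g] E_nonzero[OF assms, of g]
    by (cases "pt_eval a b g = 0") (auto simp: vanishes_at_def)
qed

text \<open>A polynomial nonzero at (a, b) has order 0 at P, so the local form shows P to be
  \<open>v a b\<close> multiplied by P (x - a). This factor is positive and divides 1, as P attains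
  1.\<close>

lemma affine_place:
  assumes "curve_point emb P" "vanishes_at P (x - emb a)" "vanishes_at P (y - emb b)"
  shows "on_curve a b" "P = v a b"
proof -
  interpret place emb P by unfold_locales fact
  have eval: "vanishes_at P (E g - emb (pt_eval a b g))" for g
    using assms by (intro vanishes_at_eval2)
  show on_curve: "on_curve a b"
    using eval[of "curve_poly q"] eval2_curve_poly[of y] curve poly_curve_poly[of b a] P_const
    by (auto simp: on_curve_def vanishes_at_def)
  have unit: "P (E g) = 0" if "pt_eval a b g \<noteq> 0" for g
  proof (cases "E g = emb (pt_eval a b g)")
    case False
    then have "P (E g - emb (pt_eval a b g)) > 0"
      using eval[of g] by (auto simp: vanishes_at_def)
    then show ?thesis
      using P_add_less[of "emb (pt_eval a b g)" "E g - emb (pt_eval a b g)"] that by simp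
  qed simp
  have eq: "P f = v a b f * P (x - emb a)" if f: "f \<noteq> 0" for f
  proof -
    obtain g h where gh: "pt_eval a b g \<noteq> 0" "pt_eval a b h \<noteq> 0"
        "f * E h = (x - emb a) powi v a b f * E g"
      using local_form_v[OF on_curve f] by (auto simp: local_form_def)
    have "P f = P (f * E h)"
      using f gh(1,2) E_nonzero[OF on_curve] unit by (simp add: P_mult)
    also have "\<dots> = v a b f * P (x - emb a)"
      unfolding gh(3) using gh E_nonzero[OF on_curve] unit x_minus_nonzero
      by (simp add: P_mult P_power_int)
    finally show ?thesis .
  qed
  obtain t where t: "P t = 1"
    using curve_point by (auto simp: curve_point_def)
  then have "v a b t * P (x - emb a) = 1"
    using eq[of t] by (cases "t = 0") auto
  moreover have "P (x - emb a) > 0"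
    using assms(2) x_minus_nonzero by (auto simp: vanishes_at_def)
  ultimately have "P (x - emb a) = 1"
    using zmult_eq_1_iff[of "v a b t" "P (x - emb a)"] by auto
  with eq show "P = v a b"
    by (auto simp: fun_eq_iff v_def)
qed

lemma vanishes_at_v:
  assumes "on_curve a b"
  shows "vanishes_at (v a b) (x - emb a)" "vanishes_at (v a b) (y - emb b)"
  using v_vanishes_poly[OF assms, of "[:[:- a, 1:]:]"] v_vanishes_poly[OF assms, of "[:[:- b:], 1:]"]
  by (simp_all add: emb.hom_uminus)

lemma v_inj:
  assumes "on_curve a b" "on_curve a' b'" "v a b = v a' b'"
  shows "a = a' \<and> b = b'"
proof -
  interpret place emb "v a b" by (rule place_v[OF assms(1)])
  have "vanishes_at (v a b) ((x - emb a) - (x - emb a'))"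
    by (rule vanishes_at_diff[OF vanishes_at_v(1)[OF assms(1)]])
      (use vanishes_at_v(1)[OF assms(2)] assms(3) in simp)
  moreover have "vanishes_at (v a b) ((y - emb b) - (y - emb b'))"
    by (rule vanishes_at_diff[OF vanishes_at_v(2)[OF assms(1)]])
      (use vanishes_at_v(2)[OF assms(2)] assms(3) in simp)
  ultimately have "vanishes_at (v a b) (emb (a' - a))" "vanishes_at (v a b) (emb (b' - b))"
    by (simp_all add: emb.hom_minus)
  then show ?thesis by simp
qed

lemma v_neq_Pinf: "on_curve a b \<Longrightarrow> v a b \<noteq> Pinf"
proof
  assume on: "on_curve a b" and eq: "v a b = Pinf"
  have "regular_at Pinf x \<and> regular_at Pinf y"
    using vanishes_at_v[OF on] inf.regular_at_of_vanishes_diff eq by auto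
  with infinity show False
    by (auto simp: point_at_infinity_def)
qed

definition fibre :: "'c \<Rightarrow> 'c set" where "fibre a = {b. on_curve a b}"

lemma fibre_translate: "on_curve a b \<Longrightarrow> fibre a = (\<lambda>c. b + c) ` C"
proof (intro equalityI subsetI)
  fix d assume "on_curve a b" "d \<in> fibre a"
  have "d - b \<in> C"
  proof -
    have "(d - b) ^ q + (d - b) = (d ^ q + d) - (b ^ q + b)"
      using power_q_add[of "d - b" b] by simp
    also have "\<dots> = 0"
      using \<open>on_curve a b\<close> \<open>d \<in> fibre a\<close> by (simp add: fibre_def on_curve_def)
    finally show ?thesis by (simp add: C_def)
  qed
  then have "b + (d - b) \<in> (\<lambda>c. b + c) ` C" by (rule imageI)
  then show "d \<in> (\<lambda>c. b + c) ` C" by simp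
next
  fix d assume "on_curve a b" "d \<in> (\<lambda>c. b + c) ` C"
  then obtain c where c: "c ^ q + c = 0" "d = b + c" by (auto simp: C_def)
  have "d ^ q + d = (b ^ q + b) + (c ^ q + c)"
    by (simp add: c(2) power_q_add)
  with c \<open>on_curve a b\<close> show "d \<in> fibre a"
    by (simp add: fibre_def on_curve_def)
qed

lemma fibre_nonempty: obtains b where "on_curve a b"
proof -
  define p :: "'c poly" where "p = monom 1 q + (monom 1 1 - [:a ^ (q + 1):])"
  have "degree (monom 1 1 - [:a ^ (q + 1):]) \<le> 1"
    by (intro degree_diff_le) (simp_all add: degree_monom_le)
  then have "degree p = q"
    unfolding p_def using q_gt_1 by (subst degree_add_eq_left) (simp_all add: degree_monom_eq)
  then obtain b where "poly p b = 0"
    using alg_closed_imp_poly_has_root[of p] q_gt_1 by auto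
  then show ?thesis
    by (intro that[of b]) (simp add: on_curve_def p_def poly_monom algebra_simps)
qed

lemma card_fibre: "card (fibre a) = q" and finite_fibre: "finite (fibre a)"
proof -
  obtain b where b: "on_curve a b" by (rule fibre_nonempty)
  show "card (fibre a) = q"
    unfolding fibre_translate[OF b] by (subst card_image) (auto simp: card_C)
  then show "finite (fibre a)"
    using q_gt_1 by (intro card_ge_0_finite) simp
qed

text \<open>A place where x and y are regular must reduce them to constants, by algebraic
  closedness; these constants lie on the curve and determine the place.\<close>

lemma curve_point_cases:
  assumes "curve_point emb P"
  obtains "P = Pinf" | a b where "on_curve a b" "P = v a b"
proof (cases "regular_at P x \<and> regular_at P y")
  case False
  with assms have "P = Pinf"
    by (intro point_at_infinity_unique) (simp add: point_at_infinity_def)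
  with that show ?thesis by blast
next
  case True
  interpret place emb P by unfold_locales fact
  \<comment> \<open>Otherwise all linear factors x - a have order 0, hence so do all polynomials in
    x, and via the norm all polynomials in x and y. Then P would be trivial, although it attains
    1.\<close>
  have "\<exists>a. vanishes_at P (x - emb a)"
  proof (rule ccontr)
    assume *: "\<not> (\<exists>a. vanishes_at P (x - emb a))"
    have lin: "P (x - emb a) = 0" for a
    proof -
      have "regular_at P (x - emb a)"
        using True regular_at_add[OF _ regular_at_const[of "- a"], of x] by (simp add: emb.hom_uminus)
      moreover have "\<not> vanishes_at P (x - emb a)"
        using * by blast
      ultimately show ?thesis
        by (auto simp: regular_at_def vanishes_at_def)
    qed
    have "P (ev x p) = 0" if "p \<noteq> 0" for p
      using that
    proof (induction "degree p" arbitrary: p)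
      case 0
      then obtain c where "p = [:c:]" by (metis degree_eq_zeroE)
      then show ?case by simp
    next
      case (Suc m)
      then obtain a where "poly p a = 0"
        using alg_closed_imp_poly_has_root[of p] by auto
      then obtain r where r: "p = [:- a, 1:] * r"
        unfolding poly_eq_0_iff_dvd by (elim dvdE)
      with Suc have nz: "r \<noteq> 0" by auto
      have "degree p = Suc (degree r)"
        unfolding r using nz by (subst degree_mult_eq) auto
      with Suc nz have "P (ev x r) = 0" by auto
      then show ?case
        unfolding r ev.hom_mult ev_linear using nz x_minus_nonzero lin by (simp add: P_mult)
    qed
    moreover have nonneg: "P (E g) \<ge> 0" for g
      using regular_at_eval2[of x y g] True by (cases "E g = 0") (auto simp: regular_at_def)
    ultimately have unit: "P (E g) = 0" if g: "E g \<noteq> 0" for g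
    proof -
      obtain u where u: "E u * E g = ev x (norm_poly g)"
        using multiple_in_x[OF g] by blast
      have nz: "norm_poly g \<noteq> 0" by (rule norm_poly_nonzero[OF g])
      then have "E u \<noteq> 0" using u by auto
      have "P (E u) + P (E g) = P (ev x (norm_poly g))"
        using g \<open>E u \<noteq> 0\<close> by (simp add: P_mult flip: u)
      also have "\<dots> = 0"
        using nz \<open>\<And>p. p \<noteq> 0 \<Longrightarrow> P (ev x p) = 0\<close> by simp
      finally show ?thesis
        using nonneg[of u] nonneg[of g] by simp
    qed
    obtain t where t: "P t = 1"
      using curve_point by (auto simp: curve_point_def)
    then have "t \<noteq> 0" by auto
    then obtain g h where "degree g < q" "degree h < q" "g \<noteq> 0" "h \<noteq> 0" "t = E g / E h"
      using fraction by metis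
    moreover from this have "E g \<noteq> 0" "E h \<noteq> 0"
      using indep by blast+
    ultimately show False
      using t unit by (simp add: P_divide)
  qed
  then obtain a where a: "vanishes_at P (x - emb a)" ..
  \<comment> \<open>The polynomial y^q + y - a^(q+1) splits into factors y - d with d in the fibre,
    all of order 0 by assumption. But it equals x^(q+1) - a^(q+1), which vanishes at P.\<close>
  have "\<exists>b\<in>fibre a. vanishes_at P (y - emb b)"
  proof (rule ccontr)
    assume *: "\<not> (\<exists>b\<in>fibre a. vanishes_at P (y - emb b))"
    have nz: "y - emb d \<noteq> 0 \<and> P (y - emb d) = 0" if "d \<in> fibre a" for d
    proof -
      have "regular_at P (y - emb d)"
        using True regular_at_add[OF _ regular_at_const[of "- d"], of y] by (simp add: emb.hom_uminus)
      with * that show ?thesis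
        by (force simp: regular_at_def vanishes_at_def)
    qed
    define p :: "'c poly" where "p = monom 1 q + (monom 1 1 - [:a ^ (q + 1):])"
    have "degree (monom 1 1 - [:a ^ (q + 1):]) \<le> 1"
      by (intro degree_diff_le) (simp_all add: degree_monom_le)
    then have deg: "degree p = q"
      unfolding p_def using q_gt_1 by (subst degree_add_eq_left) (simp_all add: degree_monom_eq)
    then have "p \<noteq> 0" using q_gt_1 by auto
    have roots: "{b. poly p b = 0} = fibre a"
      by (auto simp: fibre_def on_curve_def p_def poly_monom algebra_simps)
    obtain A where A: "size A = degree p" "p = smult (lead_coeff p) (\<Prod>b\<in>#A. [:- b, 1:])"
      using alg_closed_imp_factorization[OF \<open>p \<noteq> 0\<close>] by blast
    have "b \<in> fibre a" if "b \<in># A" for b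
    proof -
      have "poly (\<Prod>b\<in>#A. [:- b, 1:]) b = 0"
        using that by (auto simp: poly_prod_mset prod_mset_zero_iff)
      then have "poly p b = 0"
        by (subst A(2)) simp
      with roots show ?thesis by auto
    qed
    then have "ev y (\<Prod>b\<in>#A. [:- b, 1:]) \<noteq> 0 \<and> P (ev y (\<Prod>b\<in>#A. [:- b, 1:])) = 0"
    proof (induction A)
      case (add b A)
      have "ev y (\<Prod>b\<in>#add_mset b A. [:- b, 1:]) = (y - emb b) * ev y (\<Prod>b\<in>#A. [:- b, 1:])"
        by (simp only: image_mset_add_mset prod_mset.add_mset ev.hom_mult ev_linear)
      with add nz[of b] show ?case
        by (simp add: P_mult)
    qed simp
    then have "ev y p \<noteq> 0 \<and> P (ev y p) = 0"
      using \<open>p \<noteq> 0\<close> by (subst (1 2) A(2)) (simp add: P_mult)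
    moreover have "ev y p = ev x (monom 1 (q + 1) - [:a ^ (q + 1):])"
      using curve by (simp add: p_def ev.hom_add ev.hom_minus add_diff_eq)
    moreover have "vanishes_at P (ev x (monom 1 (q + 1) - [:a ^ (q + 1):]))"
      using vanishes_at_ev[OF a, of "monom 1 (q + 1) - [:a ^ (q + 1):]"] by (simp add: poly_monom)
    ultimately show False
      by (auto simp: vanishes_at_def)
  qed
  with a affine_place[OF assms a] that show ?thesis by blast
qed

section \<open>Principal divisors have degree 0\<close>

lemma on_curve_shift: "on_curve a b \<Longrightarrow> c \<in> C \<Longrightarrow> on_curve a (b + c)"
  using fibre_translate[of a b] by (auto simp: fibre_def)

text \<open>Translation fixes x - a, so it carries a local form at (a, b + c) to one at (a,
  b).\<close>

lemma v_shift:
  assumes "on_curve a b" "c \<in> C"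
  shows "v a b (E (shift c g)) = v a (b + c) (E g)"
proof (cases "E g = 0")
  case True
  then have "E (shift c g) = E (shift c 0)"
    using eval2_cong[of g 0 "y + emb c"] curve_shift[OF assms(2)] by (simp add: eval2_pcompose)
  with True show ?thesis by (simp add: v_def)
next
  case False
  note on = on_curve_shift[OF assms]
  obtain k where k: "local_form a (b + c) (E g) (int k)"
    using local_form_poly[OF on False] .
  then obtain g1 g2 where g: "pt_eval a (b + c) g1 \<noteq> 0" "pt_eval a (b + c) g2 \<noteq> 0"
      "E g * E g2 = (x - emb a) ^ k * E g1"
    by (auto simp: local_form_def)
  have "E (g * g2) = E ([:[:- a, 1:]:] ^ k * g1)"
    by (simp only: eval2.hom_mult eval2.hom_power E_x_minus g(3))
  then have "eval2 emb x (y + emb c) (g * g2) = eval2 emb x (y + emb c) ([:[:- a, 1:]:] ^ k * g1)"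
    by (rule eval2_cong[OF _ curve_shift[OF assms(2)]])
  moreover have "eval2 emb x (y + emb c) [:[:- a, 1:]:] = x - emb a"
    by (simp add: emb.hom_uminus)
  ultimately have "E (shift c g) * E (shift c g2) = (x - emb a) ^ k * E (shift c g1)"
    by (simp only: eval2.hom_mult eval2.hom_power eval2_pcompose)
  then have "local_form a b (E (shift c g)) (int k)"
    unfolding local_form_def using g
    by (intro exI[of _ "shift c g1"] exI[of _ "shift c g2"]) (simp add: poly_poly_pcompose)
  then show ?thesis
    using v_eqI[OF assms(1)] v_eqI[OF on k False] E_shift_nonzero[OF assms(2) False] by simp
qed

text \<open>Adding a constant does not change the pole order of y, so (x, y + c) satisfies the same
  hypotheses at infinity and the weight formula gives the same value.\<close>

lemma Pinf_shift:
  assumes "c \<in> C"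
  shows "Pinf (E (shift c g)) = Pinf (E g)"
proof -
  obtain s r where r: "g = curve_poly q * s + r" "degree r < q" "E g = E r"
    by (rule reduce_mod_curve)
  have shift: "E (shift c g) = eval2 emb x (y + emb c) r"
    using eval2_cong[OF r(3) curve_shift[OF assms]] by (simp add: eval2_pcompose)
  show ?thesis
  proof (cases "r = 0")
    case False
    have "Pinf y < 0"
      using inf.P_y by simp
    then have "Pinf (y + emb c) = Pinf y"
      using inf.P_add_less[of y "emb c"] inf.y_nonzero by simp
    then interpret s: pole_place emb Pinf x "y + emb c" q 1
      using inf.P_x inf.P_y q_gt_1 by unfold_locales auto
    show ?thesis
      using s.P_eval2[OF False r(2)] inf.P_eval2[OF False r(2)] by (simp add: shift r(3))
  qed (use shift r(3) in simp)
qed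

lemma v_ev: "on_curve a b \<Longrightarrow> p \<noteq> 0 \<Longrightarrow> v a b (ev x p) = int (order a p)"
proof -
  assume on: "on_curve a b" and p: "p \<noteq> 0"
  obtain p' where p': "poly p' a \<noteq> 0" "ev x p = (x - emb a) ^ order a p * ev x p'"
    using ev_order[OF p] .
  interpret place emb "v a b" by (rule place_v[OF on])
  have "v a b (E [:p':]) = 0"
    using p' by (intro v_poly_zero on) simp
  moreover have "p' \<noteq> 0" using p' by auto
  ultimately show ?thesis
    using x_minus_nonzero by (simp add: p'(2) P_mult P_power v_uniformizer[OF on])
qed

text \<open>Translation moves the orders at all points over a to a single point, where they add up
  to the order of the norm.\<close>

lemma sum_fibre_v:
  assumes "E g \<noteq> 0"
  shows "(\<Sum>b\<in>fibre a. v a b (E g)) = int (order a (norm_poly g))"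
proof -
  obtain b where b: "on_curve a b" by (rule fibre_nonempty)
  interpret place emb "v a b" by (rule place_v[OF b])
  have "(\<Sum>b\<in>fibre a. v a b (E g)) = (\<Sum>c\<in>C. v a (b + c) (E g))"
    unfolding fibre_translate[OF b] by (subst sum.reindex) auto
  also have "\<dots> = (\<Sum>c\<in>C. v a b (E (shift c g)))"
    using v_shift[OF b] by simp
  also have "\<dots> = v a b (\<Prod>c\<in>C. E (shift c g))"
    using E_shift_nonzero[OF _ assms] finite_C by (intro P_prod[symmetric])
  also have "\<dots> = int (order a (norm_poly g))"
    unfolding norm_poly by (intro v_ev b norm_poly_nonzero assms)
  finally show ?thesis .
qed

text \<open>All q translates have the same order at infinity, while x has a pole of order q there;
  the factor q cancels.\<close>

lemma degree_norm_poly: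
  assumes "E g \<noteq> 0"
  shows "int (degree (norm_poly g)) = - Pinf (E g)"
proof -
  have "int q * Pinf (E g) = (\<Sum>c\<in>C. Pinf (E (shift c g)))"
    using Pinf_shift card_C by simp
  also have "\<dots> = Pinf (\<Prod>c\<in>C. E (shift c g))"
    using E_shift_nonzero[OF _ assms] finite_C by (intro inf.P_prod[symmetric])
  also have "\<dots> = int q * - int (degree (norm_poly g))"
    unfolding norm_poly using inf.P_ev[OF norm_poly_nonzero[OF assms]] by simp
  finally have "Pinf (E g) = - int (degree (norm_poly g))"
    using q_gt_1 by (simp only: mult_cancel_left) simp
  then show ?thesis by simp
qed

lemma norm_poly_root: "on_curve a b \<Longrightarrow> E g \<noteq> 0 \<Longrightarrow> v a b (E g) \<noteq> 0 \<Longrightarrow> poly (norm_poly g) a = 0"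
proof (rule ccontr)
  assume on: "on_curve a b" and g: "E g \<noteq> 0" "v a b (E g) \<noteq> 0" and "poly (norm_poly g) a \<noteq> 0"
  then have "(\<Sum>b\<in>fibre a. v a b (E g)) = 0"
    by (simp add: sum_fibre_v order_0I)
  then have "v a b (E g) = 0"
    using sum_nonneg_eq_0_iff[OF finite_fibre, of a "\<lambda>b. v a b (E g)"] v_poly_nonneg on
    by (auto simp: fibre_def)
  with g show False by simp
qed

lemma sum_poly_v:
  assumes "E g \<noteq> 0" "finite S" "\<And>a. poly (norm_poly g) a = 0 \<Longrightarrow> a \<in> S"
  shows "(\<Sum>a\<in>S. \<Sum>b\<in>fibre a. v a b (E g)) = - Pinf (E g)"
proof -
  have "(\<Sum>a\<in>S. \<Sum>b\<in>fibre a. v a b (E g)) = (\<Sum>a\<in>S. int (order a (norm_poly g)))"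
    by (simp add: sum_fibre_v assms(1))
  also have "\<dots> = (\<Sum>a | poly (norm_poly g) a = 0. int (order a (norm_poly g)))"
    using assms by (intro sum.mono_neutral_right) (auto simp: order_0I)
  also have "\<dots> = - Pinf (E g)"
    using sum_order_eq_degree[OF norm_poly_nonzero[OF assms(1)]] degree_norm_poly[OF assms(1)]
    by (simp flip: of_nat_sum)
  finally show ?thesis .
qed

text \<open>The degree of div f is 0. The finite set S of x-coordinates carrying zeros and poles is
  exposed because the sum over all affine points would be infinite.\<close>

lemma sum_v_eq_minus_Pinf:
  assumes "f \<noteq> 0"
  obtains S where "finite S" "\<And>a b. on_curve a b \<Longrightarrow> v a b f \<noteq> 0 \<Longrightarrow> a \<in> S"
    "(\<Sum>a\<in>S. \<Sum>b\<in>fibre a. v a b f) = - Pinf f"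
proof -
  obtain g h where gh: "g \<noteq> 0" "h \<noteq> 0" "degree g < q" "degree h < q" "f = E g / E h"
    using fraction[OF assms] by metis
  then have nz: "E g \<noteq> 0" "E h \<noteq> 0" using indep by blast+
  define S where "S = {a. poly (norm_poly g) a = 0} \<union> {a. poly (norm_poly h) a = 0}"
  have v: "v a b f = v a b (E g) - v a b (E h)" if "on_curve a b" for a b
  proof -
    interpret place emb "v a b" by (rule place_v[OF that])
    show ?thesis using nz by (simp add: gh P_divide)
  qed
  have "finite S"
    using nz norm_poly_nonzero by (auto simp: S_def poly_roots_finite)
  moreover have "a \<in> S" if "on_curve a b" "v a b f \<noteq> 0" for a b
  proof -
    have "v a b (E g) \<noteq> 0 \<or> v a b (E h) \<noteq> 0"
      using that v[OF that(1)] by auto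
    then show ?thesis
      using norm_poly_root[OF that(1) nz(1)] norm_poly_root[OF that(1) nz(2)] by (auto simp: S_def)
  qed
  moreover have "(\<Sum>a\<in>S. \<Sum>b\<in>fibre a. v a b f)
      = (\<Sum>a\<in>S. \<Sum>b\<in>fibre a. v a b (E g) - v a b (E h))"
    by (intro sum.cong refl v) (simp add: fibre_def)
  then have "(\<Sum>a\<in>S. \<Sum>b\<in>fibre a. v a b f) = - Pinf f"
    using sum_poly_v[OF nz(1) \<open>finite S\<close>] sum_poly_v[OF nz(2) \<open>finite S\<close>] nz gh
    by (simp add: S_def sum_subtractf inf.P_divide)
  ultimately show ?thesis using that by blast
qed

text \<open>Restricted to x = a, g is a polynomial in y of degree below q with q roots, so it is 0
  and every coefficient is divisible by x - a.\<close>

lemma divide_by_x_minus: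
  assumes "degree g < q" "\<And>b. b \<in> fibre a \<Longrightarrow> pt_eval a b g = 0"
  obtains g' where "g = smult [:- a, 1:] g'"
proof -
  have "map_poly (\<lambda>p. poly p a) g = 0"
  proof (rule ccontr)
    assume nz: "map_poly (\<lambda>p. poly p a) g \<noteq> 0"
    have "q = card (fibre a)" by (simp add: card_fibre)
    also have "\<dots> \<le> card {b. poly (map_poly (\<lambda>p. poly p a) g) b = 0}"
      using assms(2) by (intro card_mono poly_roots_finite nz) (auto simp: poly_poly_map_poly)
    also have "\<dots> \<le> degree (map_poly (\<lambda>p. poly p a) g)"
      by (rule card_poly_roots_bound[OF nz])
    also have "\<dots> \<le> degree g"
      by (rule degree_le) (simp add: coeff_map_poly coeff_eq_0)
    finally show False using assms(1) by simp
  qed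
  then have root: "poly (coeff g j) a = 0" for j
    by (metis coeff_map_poly coeff_0 poly_0)
  have "[:- a, 1:] dvd coeff g j" for j
    using root by (simp add: poly_eq_0_iff_dvd)
  then have "g = smult [:- a, 1:] (map_poly (\<lambda>p. p div [:- a, 1:]) g)"
    by (intro poly_eqI) (simp add: coeff_map_poly del: mult_pCons_left)
  then show ?thesis by (rule that)
qed

text \<open>The affine coordinate ring is integrally closed.\<close>

lemma regular_affine_imp_poly:
  assumes "\<And>a b. on_curve a b \<Longrightarrow> regular_at (v a b) f"
  obtains g where "degree g < q" "f = E g"
proof -
  \<comment> \<open>The norm of the denominator provides a denominator p in x alone; its linear
    factors are then removed one at a time.\<close>
  have main: "\<exists>g. f = E g" if "p \<noteq> 0" "f * ev x p = E g" for p g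
    using that
  proof (induction "degree p" arbitrary: p g)
    case 0
    then obtain c where c: "p = [:c:]" "c \<noteq> 0" by (metis degree_eq_zeroE pCons_0_0)
    have "E (smult [:inverse c:] g) = (emb (inverse c) * emb c) * f"
      using 0(3) c by (simp flip: 0(3) add: mult_ac del: emb.hom_inverse)
    also have "emb (inverse c) * emb c = 1"
      using c by (simp flip: emb.hom_mult)
    finally have "f = E (smult [:inverse c:] g)"
      by simp
    then show ?case by blast
  next
    case (Suc m)
    then obtain a where "poly p a = 0"
      using alg_closed_imp_poly_has_root[of p] by auto
    then obtain p' where p': "p = [:- a, 1:] * p'"
      unfolding poly_eq_0_iff_dvd by (elim dvdE)
    with Suc have nz: "p' \<noteq> 0" by auto
    have deg: "degree p = Suc (degree p')"
      unfolding p' using nz by (subst degree_mult_eq) auto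
    obtain s r where r: "g = curve_poly q * s + r" "degree r < q" "E g = E r"
      by (rule reduce_mod_curve)
    have eq: "E r = (x - emb a) * (f * ev x p')"
      unfolding r(3)[symmetric] Suc(4)[symmetric] p' ev.hom_mult ev_linear by simp
    \<comment> \<open>Since f is regular over a, the numerator is x - a times a regular function and
      vanishes on the whole fibre.\<close>
    have "pt_eval a b r = 0" if "b \<in> fibre a" for b
    proof -
      have on: "on_curve a b" using that by (simp add: fibre_def)
      interpret place emb "v a b" by (rule place_v[OF on])
      have "regular_at (v a b) x"
        using vanishes_at_v(1)[OF on] by (rule regular_at_of_vanishes_diff)
      then have "vanishes_at (v a b) (E r)"
        unfolding eq by (intro vanishes_at_mult vanishes_at_v on regular_at_mult assms regular_at_ev)
      then show ?thesis by (simp add: v_vanishes_poly[OF on])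
    qed
    then obtain g' where g': "r = smult [:- a, 1:] g'"
      using divide_by_x_minus[OF r(2)] by blast
    have "E r = (x - emb a) * E g'"
      unfolding g' eval2_smult ev_linear ..
    with eq have "f * ev x p' = E g'"
      using x_minus_nonzero by simp
    with Suc deg nz show ?case by auto
  qed
  have "\<exists>g. f = E g"
  proof (cases "f = 0")
    case False
    obtain g h where gh: "g \<noteq> 0" "h \<noteq> 0" "degree h < q" "f = E g / E h"
      using fraction[OF False] by metis
    then have nz: "E h \<noteq> 0" using indep by blast
    obtain u where u: "E u * E h = ev x (norm_poly h)"
      using multiple_in_x[OF nz] by blast
    then have "f * ev x (norm_poly h) = E (g * u)"
      unfolding u[symmetric] using nz by (simp add: gh eval2.hom_mult)
    with norm_poly_nonzero[OF nz] show ?thesis by (rule main)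
  qed (auto intro: exI[of _ 0])
  then show ?thesis
    using that by (metis reduce_mod_curve)
qed

section \<open>Derivations and differentials\<close>

lemma derivation_eq:
  assumes "derivation emb \<delta>"
  shows "\<delta> (f + g) = \<delta> f + \<delta> g" "\<delta> (f * g) = f * \<delta> g + g * \<delta> f" "\<delta> (emb c) = 0" "\<delta> 0 = 0" "\<delta> 1 = 0"
proof -
  show "\<delta> (f + g) = \<delta> f + \<delta> g" "\<delta> (f * g) = f * \<delta> g + g * \<delta> f" and const: "\<delta> (emb c) = 0" for c
    using assms by (auto simp: derivation_def)
  show "\<delta> 0 = 0" "\<delta> 1 = 0"
    using const[of 0] const[of 1] by simp_all
qed

text \<open>Since q = 0 in the field, differentiating the curve equation kills y^q and leaves dy =
  x^q dx.\<close>

lemma derivation_y: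
  assumes "derivation emb \<delta>"
  shows "\<delta> y = x ^ q * \<delta> x"
proof -
  have q0: "of_nat q = (0 :: 'f)"
    using arg_cong[OF of_nat_q, of emb] by (simp add: emb.hom_of_nat)
  have "\<delta> (y ^ q) = 0"
    using derivation_power[OF assms, of y q] inf.y_nonzero q0 by simp
  then have "\<delta> y = \<delta> (y ^ q + y)"
    by (simp add: derivation_eq[OF assms])
  also have "\<dots> = \<delta> (x ^ (q + 1))"
    unfolding curve ..
  also have "\<dots> * x = (x ^ q * \<delta> x) * x"
    using derivation_power[OF assms, of x "q + 1"] q0 by (simp add: mult_ac)
  then have "\<delta> (x ^ (q + 1)) = x ^ q * \<delta> x"
    using inf.x_nonzero by simp
  finally show ?thesis .
qed

lemma derivation_zero:
  assumes "derivation emb \<delta>" "\<delta> x = 0"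
  shows "\<delta> f = 0"
proof -
  note d = derivation_eq[OF assms(1)]
  have y: "\<delta> y = 0"
    using derivation_y[OF assms(1)] assms(2) by simp
  have ev: "\<delta> (ev x p) = 0" for p
    by (induction p) (simp_all add: d assms(2))
  have E: "\<delta> (E g) = 0" for g
    by (induction g) (simp_all add: d y ev)
  show ?thesis
  proof (cases "f = 0")
    case False
    then obtain g h where gh: "f = E g / E h" "E h \<noteq> 0"
      using fraction by metis
    then have "\<delta> (f * E h) = 0" by (simp add: E)
    with gh(2) show ?thesis by (simp only: d E) simp
  qed (simp add: d)
qed

text \<open>Every differential is a multiple of \<open>dx\<close>.\<close>

lemma derivation_proportional:
  assumes "derivation emb \<delta>" "derivation emb \<delta>'"
  shows "\<delta> x * \<delta>' g = \<delta>' x * \<delta> g"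
proof -
  note d = derivation_eq[OF assms(1)] derivation_eq[OF assms(2)]
  \<comment> \<open>This combination is itself a derivation and vanishes at x, so it vanishes
    everywhere.\<close>
  have "derivation emb (\<lambda>f. \<delta> x * \<delta>' f - \<delta>' x * \<delta> f)"
    unfolding derivation_def by (auto simp: d algebra_simps)
  from derivation_zero[OF this, of g] show ?thesis
    by (simp add: mult.commute)
qed

text \<open>The function x / y has order (q + 1) - q = 1 at infinity and serves as uniformizer
  there. The formula is y^2 d(x/y) = y dx - x dy = (y - x^(q+1)) dx = - y^q dx.\<close>

lemma derivation_x_over_y:
  assumes "derivation emb \<delta>"
  shows "y ^ (q - 2) * \<delta> x = - \<delta> (x / y)"
proof -
  note d = derivation_eq[OF assms]
  have y: "y \<noteq> 0" by (rule inf.y_nonzero)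
  obtain k where k: "q = k + 2"
    using q_gt_1 by (metis add.commute le_add_diff_inverse Suc_1 Suc_leI)
  have "\<delta> x = \<delta> ((x / y) * y)"
    using y by simp
  also have "\<dots> = (x / y) * (x ^ q * \<delta> x) + y * \<delta> (x / y)"
    by (simp only: d derivation_y[OF assms])
  finally have "y * \<delta> x = x ^ (q + 1) * \<delta> x + y * y * \<delta> (x / y)"
    using y by (simp add: field_simps)
  also have "x ^ (q + 1) = y ^ k * y * y + y"
    unfolding curve[symmetric] by (simp add: k)
  finally have "y * y * (y ^ k * \<delta> x + \<delta> (x / y)) = 0"
    by (simp add: algebra_simps)
  then have "y ^ k * \<delta> x = - \<delta> (x / y)"
    using y by (simp add: eq_neg_iff_add_eq_0)
  then show ?thesis
    by (simp add: k)
qed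

section \<open>The divisor of y and multiples of P0 - Pinf\<close>

lemma on_curve_0 [simp]: "on_curve 0 0"
  using q_gt_1 by (simp add: on_curve_def)

lemma on_curve_y_0: "on_curve a 0 \<longleftrightarrow> a = 0"
  using q_gt_1 by (auto simp: on_curve_def power_0_left)

lemma v_y: "on_curve a b \<Longrightarrow> b \<noteq> 0 \<Longrightarrow> v a b y = 0"
  using v_poly_zero[of a b "[:0, 1:]"] by simp

text \<open>The divisor of f is supported on the two special points and has degree 0.\<close>

lemma v_0_eq_minus_Pinf:
  assumes "f \<noteq> 0" "\<And>a b. on_curve a b \<Longrightarrow> (a, b) \<noteq> (0, 0) \<Longrightarrow> v a b f = 0"
  shows "v 0 0 f = - Pinf f"
proof -
  obtain S where S: "finite S" "\<And>a b. on_curve a b \<Longrightarrow> v a b f \<noteq> 0 \<Longrightarrow> a \<in> S"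
      "(\<Sum>a\<in>S. \<Sum>b\<in>fibre a. v a b f) = - Pinf f"
    using sum_v_eq_minus_Pinf[OF assms(1)] by blast
  have inner: "(\<Sum>b\<in>fibre a. v a b f) = (if a = 0 then v 0 0 f else 0)" for a
  proof -
    have "(\<Sum>b\<in>fibre a. v a b f) = (\<Sum>b\<in>fibre a. if b = 0 then (if a = 0 then v 0 0 f else 0) else 0)"
      using assms(2) on_curve_y_0 by (intro sum.cong) (auto simp: fibre_def)
    also have "\<dots> = (if a = 0 then v 0 0 f else 0)"
      using finite_fibre[of a] by (subst sum.delta) (auto simp: fibre_def on_curve_y_0)
    finally show ?thesis .
  qed
  show ?thesis
    using S(2)[of 0 0] S(3) S(1) by (cases "0 \<in> S") (auto simp: inner)
qed

lemma v_0_y: "v 0 0 y = int (q + 1)"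
proof -
  have "v 0 0 y = - Pinf y"
    using on_curve_y_0 by (intro v_0_eq_minus_Pinf inf.y_nonzero v_y) auto
  then show ?thesis by (simp add: inf.P_y)
qed

lemma Pinf_poly_ge_imp:
  assumes "degree g < q" "g \<noteq> 0 \<Longrightarrow> Pinf (E g) \<ge> - m" "coeff g j \<noteq> 0"
  shows "int (q * degree (coeff g j) + (q + 1) * j) \<le> m"
proof -
  have "g \<noteq> 0" using assms(3) by auto
  then have "int (weight q g) \<le> m"
    using assms(1,2) Pinf_eval2[of g] by simp
  with coeff_weight_le[OF assms(3), of q] show ?thesis by linarith
qed

text \<open>The class of \<open>P\<^sub>0 - P\<^sub>\<infinity>\<close> has order \<open>q + 1\<close>.\<close>

lemma small_multiple_of_P0:
  assumes "f \<noteq> 0" "\<And>a b. on_curve a b \<Longrightarrow> (a, b) \<noteq> (0, 0) \<Longrightarrow> v a b f = 0"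
    and "v 0 0 f \<ge> 0" "v 0 0 f \<le> int q"
  shows "v 0 0 f = 0"
proof (rule ccontr)
  assume nz: "v 0 0 f \<noteq> 0"
  have "regular_at (v a b) f" if "on_curve a b" for a b
    using assms that by (cases "(a, b) = (0, 0)") (auto simp: regular_at_def)
  then obtain g where g: "degree g < q" "f = E g"
    using regular_affine_imp_poly by blast
  have Pinf: "Pinf (E g) \<ge> - int q"
    using v_0_eq_minus_Pinf[OF assms(1,2)] assms(4) g by simp
  have "coeff g j = 0" if "j > 0" for j
  proof (rule ccontr)
    assume "coeff g j \<noteq> 0"
    then have "q * degree (coeff g j) + (q + 1) * j \<le> q"
      using Pinf_poly_ge_imp[OF g(1) Pinf] by (simp only: of_nat_le_iff)
    then have "(q + 1) * j \<le> q"
      by (rule add_leD2)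
    moreover have "(q + 1) * 1 \<le> (q + 1) * j"
      using that by (intro mult_le_mono2) simp
    ultimately have "(q + 1) * 1 \<le> q"
      by (rule order_trans[rotated])
    then show False by simp
  qed
  then have "g = [:coeff g 0:]"
    by (intro poly_eqI) (auto simp: coeff_pCons split: nat.split)
  then obtain r where r: "g = [:r:]" ..
  have "vanishes_at (v 0 0) (E g)"
    using nz assms(3) g by (simp add: vanishes_at_def)
  then have "pt_eval 0 0 g = 0"
    using v_vanishes_poly[OF on_curve_0] by blast
  then have r0: "poly r 0 = 0"
    by (simp add: r)
  \<comment> \<open>A polynomial in x that vanishes at P0 vanishes on the whole line x = 0. As q >
    1, this line has a second curve point, where f has order 0 by assumption.\<close>
  have "card (fibre 0 - {0}) > 0"
    using q_gt_1 card_fibre[of 0] by (subst card_Diff_singleton) (auto simp: fibre_def)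
  then have "fibre 0 - {0} \<noteq> {}"
    by (metis card.empty less_irrefl)
  then obtain b where b: "on_curve 0 b" "b \<noteq> 0"
    by (auto simp: fibre_def)
  moreover have "pt_eval 0 b g = 0"
    using r0 by (simp add: r)
  ultimately have "vanishes_at (v 0 b) (E g)"
    using v_vanishes_poly by blast
  with b assms(1,2) g(2) show False
    by (auto simp: vanishes_at_def)
qed

end

section \<open>Rational points and the two-point code\<close>

lemma power_card_eq_same:
  fixes c :: "'k::{field,finite}"
  shows "c ^ card (UNIV :: 'k set) = c"
proof (cases "c = 0")
  case True
  then show ?thesis
    using finite_UNIV_card_ge_0[where ?'a = 'k] by (simp add: power_0_left)
next
  case False
  have "(\<Prod>x\<in>UNIV - {0}. c * x) = \<Prod>(UNIV - {0 :: 'k})"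
    by (rule prod.reindex_bij_witness[of _ "\<lambda>x. x / c" "\<lambda>x. c * x"]) (use False in auto)
  moreover have "(\<Prod>x\<in>UNIV - {0}. c * x) = c ^ card (UNIV - {0 :: 'k}) * \<Prod>(UNIV - {0 :: 'k})"
    by (simp add: prod.distrib)
  moreover have "\<Prod>(UNIV - {0 :: 'k}) \<noteq> 0"
    by simp
  ultimately have "c ^ card (UNIV - {0 :: 'k}) = 1"
    by simp
  moreover have "card (UNIV :: 'k set) = Suc (card (UNIV - {0 :: 'k}))"
    using finite_UNIV_card_ge_0[where ?'a = 'k] by simp
  ultimately show ?thesis by (simp only: power_Suc mult_1_right)
qed

text \<open>The equation on the right has at most as many roots as its degree, the number of
  elements of \<open>'k\<close>, and the image of \<open>'k\<close> already supplies that
  many.\<close>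

lemma range_to_ac_iff:
  fixes c :: "'k::{field,finite} alg_closure"
  shows "c \<in> range to_ac \<longleftrightarrow> c ^ card (UNIV :: 'k set) = c"
proof -
  let ?N = "card (UNIV :: 'k set)"
  define p :: "'k alg_closure poly" where "p = monom 1 ?N - monom 1 1"
  have "card {0, 1 :: 'k} \<le> ?N"
    by (intro card_mono) auto
  then have N: "?N > 1" by simp
  then have "degree p = ?N"
    unfolding p_def diff_conv_add_uminus
    by (subst degree_add_eq_left) (simp_all add: degree_monom_eq)
  with N have "p \<noteq> 0" by auto
  have roots: "{c. poly p c = 0} = {c. c ^ ?N = c}"
    by (simp add: p_def poly_monom)
  have "range to_ac \<subseteq> {c :: 'k alg_closure. c ^ ?N = c}"
    by (auto simp: power_card_eq_same simp flip: to_ac_power)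
  moreover have "finite {c :: 'k alg_closure. c ^ ?N = c}"
    using poly_roots_finite[OF \<open>p \<noteq> 0\<close>] roots by simp
  moreover have "card {c :: 'k alg_closure. c ^ ?N = c} \<le> card (range (to_ac :: 'k \<Rightarrow> 'k alg_closure))"
    using card_poly_roots_bound[OF \<open>p \<noteq> 0\<close>] roots \<open>degree p = ?N\<close>
    by (simp add: card_image[OF inj_to_ac])
  ultimately have "range to_ac = {c :: 'k alg_closure. c ^ ?N = c}"
    using card_seteq by blast
  then show ?thesis by auto
qed

lemma field_embedding_const: "field_embedding emb \<Longrightarrow> field_embedding (const emb)"
  by (simp add: field_embedding_def)

lemma eval2_const:
  assumes "field_embedding emb"
  shows "eval2 (const emb) x y g = eval2 emb x y (map_poly (map_poly to_ac) g)"
proof -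
  interpret K: polynomial_functions emb by unfold_locales fact
  interpret k: polynomial_functions "const emb"
    by unfold_locales (rule field_embedding_const[OF assms])
  have ev: "k.ev x p = K.ev x (map_poly to_ac p)" for p
    by (induction p) (simp_all add: map_poly_pCons)
  show ?thesis
    by (induction g) (simp_all add: map_poly_pCons ev)
qed

locale hermitian_code = hermitian emb x y q n Pinf
  for emb :: "'k::{field,finite} alg_closure \<Rightarrow> 'f::field" and x y q n Pinf +
  assumes card_k: "card (UNIV :: 'k set) = q\<^sup>2"
begin

text \<open>The element s = a^(q+1) satisfies s^q = s. From b^q = s - b one gets b^(q^2) = s - b^q =
  b, so b lies in the field with q^2 elements.\<close>

lemma fibre_rational:
  assumes "on_curve (to_ac a) b"
  shows "b \<in> range to_ac"
proof -
  define s where "s = to_ac a ^ (q + 1)"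
  have "s ^ q = (to_ac a ^ q\<^sup>2) * to_ac a ^ q"
    by (simp add: s_def power_mult power2_eq_square power_mult_distrib power_add mult.commute
        flip: power_mult)
  also have "to_ac a ^ q\<^sup>2 = to_ac a"
    using range_to_ac_iff[of "to_ac a"] card_k by simp
  finally have s: "s ^ q = s"
    by (simp add: s_def)
  have b: "b ^ q = s - b"
    using assms by (simp add: on_curve_def s_def algebra_simps)
  have "b ^ q\<^sup>2 = (b ^ q) ^ q"
    by (simp add: power2_eq_square power_mult)
  also have "\<dots> = s ^ q + (- b) ^ q"
    unfolding b diff_conv_add_uminus by (rule power_q_add)
  also have "\<dots> = b"
    by (simp add: power_q_minus s b)
  finally show ?thesis
    unfolding range_to_ac_iff card_k .
qed

lemma C_rational: "C \<subseteq> range to_ac"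
proof
  fix c assume "c \<in> C"
  then have "on_curve (to_ac 0) c"
    using q_gt_1 by (simp add: C_def on_curve_def)
  then show "c \<in> range to_ac" by (rule fibre_rational)
qed

text \<open>The local theory over \<open>'k\<close> itself: it gives local forms with coefficients
  in \<open>'k\<close>, hence values in \<open>'k\<close> at rational points.\<close>

sublocale base: hermitian_base "const emb" x y q n
proof unfold_locales
  show "field_embedding (const emb)"
    by (rule field_embedding_const[OF emb])
  show "Factorial_Ring.prime CHAR('k)" "q = CHAR('k) ^ n"
    using prime_char q_def by simp_all
  have "to_ac ` {c::'k. c ^ q + c = 0} = C"
  proof (intro equalityI subsetI)
    fix c assume c: "c \<in> C"
    with C_rational obtain d where "c = to_ac d" by auto
    with c show "c \<in> to_ac ` {c::'k. c ^ q + c = 0}"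
      by (auto simp: C_def simp flip: to_ac_power to_ac_add)
  qed (auto simp: C_def simp flip: to_ac_power to_ac_add)
  then show "card {c::'k. c ^ q + c = 0} = q"
    using card_C card_image[OF inj_on_subset[OF inj_to_ac subset_UNIV]] by metis
  fix g :: "'k poly poly" assume "degree g < q" "eval2 (const emb) x y g = 0"
  moreover have "degree (map_poly (map_poly to_ac) g) \<le> degree g"
    by (rule degree_le) (simp add: coeff_map_poly coeff_eq_0)
  ultimately have 0: "map_poly (map_poly to_ac) g = 0"
    by (intro indep) (simp_all add: eval2_const[OF emb])
  have "to_ac (coeff (coeff g i) j) = coeff (coeff (map_poly (map_poly to_ac) g) i) j" for i j
    by (simp add: coeff_map_poly)
  then show "g = 0"
    unfolding 0 by (intro poly_eqI) simp
qed (use q_gt_1 curve in auto)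

lemma on_curve_to_ac [simp]: "on_curve (to_ac a) (to_ac b) \<longleftrightarrow> base.on_curve a b"
  unfolding on_curve_def base.on_curve_def
  by (simp only: to_ac_eq_iff flip: to_ac_power to_ac_add)

lemma place_const: "place emb P \<Longrightarrow> place (const emb) P"
  by (intro place.intro place_axioms.intro polynomial_functions.intro field_embedding_const emb)
    (auto simp: place_def place_axioms_def curve_point_def)

abbreviation vk :: "'k \<Rightarrow> 'k \<Rightarrow> 'f \<Rightarrow> int"
  where "vk a b \<equiv> v (to_ac a) (to_ac b)"

text \<open>A function over \<open>'k\<close> that is regular at the point is a nonnegative power of
  x - a times a quotient of polynomials over \<open>'k\<close> that do not vanish there; its value
  is computed within \<open>'k\<close>.\<close>

lemma vk_rational:
  assumes on: "base.on_curve a b"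
  shows "vk a b \<in> rational_points emb x y"
proof -
  have on': "on_curve (to_ac a) (to_ac b)"
    using on by simp
  interpret K: place emb "vk a b"
    by (rule place_v[OF on'])
  interpret k: place "const emb" "vk a b"
    by (rule place_const) unfold_locales
  have eval: "vanishes_at (vk a b) (base.E g - const emb (base.pt_eval a b g))" for g
    using vanishes_at_v[OF on'] by (rule k.vanishes_at_eval2)
  have "\<exists>c. vanishes_at (vk a b) (f - const emb c)"
    if f: "f \<in> base_functions emb x y" "regular_at (vk a b) f" for f
  proof (cases "f = 0")
    case True
    then show ?thesis by (intro exI[of _ 0]) simp
  next
    case False
    obtain m where "base.local_form a b f m"
      using base.local_form_exists[OF on] f False by (auto simp: base_functions_def)
    then obtain g h where gh: "base.pt_eval a b g \<noteq> 0" "base.pt_eval a b h \<noteq> 0"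
        "f * base.E h = (x - const emb a) powi m * base.E g"
      by (auto simp: base.local_form_def)
    note g = k.unit_of_vanishes_diff[OF eval gh(1)] and h = k.unit_of_vanishes_diff[OF eval gh(2)]
    have "vk a b f = vk a b (f * base.E h)"
      using False h by (simp add: K.P_mult)
    also have "\<dots> = m"
      unfolding gh(3) using g x_minus_nonzero v_uniformizer[OF on']
      by (simp add: K.P_mult K.P_power_int)
    finally have m: "m \<ge> 0"
      using f(2) False by (simp add: regular_at_def)
    have x: "vanishes_at (vk a b) ((x - const emb a) ^ nat m - const emb (0 ^ nat m))"
      using vanishes_at_v(1)[OF on'] by (intro k.vanishes_at_power_diff) simp
    have "f = (x - const emb a) ^ nat m * base.E g * inverse (base.E h)"
      using gh(3) h m by (simp add: power_int_def field_simps)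
    then show ?thesis
      using k.vanishes_at_mult_diff[OF k.vanishes_at_mult_diff[OF x eval]
          k.vanishes_at_inverse_diff[OF eval gh(2)], of g] by metis
  qed
  with K.curve_point show ?thesis
    by (auto simp: rational_points_def)
qed

text \<open>The coordinate functions x and y are defined over \<open>'k\<close>, so rationality of
  the point forces their values into \<open>'k\<close>.\<close>

lemma rational_points_cases:
  assumes "P \<in> rational_points emb x y" "P \<noteq> Pinf"
  obtains a b where "base.on_curve a b" "P = vk a b"
proof -
  have "curve_point emb P" using assms(1) by (simp add: rational_points_def)
  then obtain a b where ab: "on_curve a b" "P = v a b"
    using curve_point_cases assms(2) by metis
  interpret place emb P using place_v[OF ab(1)] ab(2) by simp
  note van = vanishes_at_v[OF ab(1), folded ab(2)]
  have "x \<in> base_functions emb x y" "y \<in> base_functions emb x y"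
    unfolding base_functions_def using base.rational_functions_x_minus[of x 0 y]
      base.rational_functions_y_minus[of y 0 x] by simp_all
  then obtain c d where "vanishes_at P (x - const emb c)" "vanishes_at P (y - const emb d)"
    using assms(1) van regular_at_of_vanishes_diff by (force simp: rational_points_def)
  then have "a = to_ac c" "b = to_ac d"
    using vanishes_at_diff_unique van by blast+
  with ab show ?thesis
    by (intro that[of c d]) auto
qed

lemma value_at_eqI:
  assumes "place emb P" "vanishes_at P (f - const emb c)"
  shows "value_at emb P f = c"
proof -
  interpret k: place "const emb" P
    by (rule place_const) fact
  show ?thesis
    unfolding value_at_def using assms(2) k.vanishes_at_diff_unique by blast
qed

text \<open>Write the differential as z dx. At affine points x - a is a uniformizer and the
  coefficient is the order of z; at infinity the change to d(x/y) adds (q - 2)(q + 1). The orders of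
  z sum to 0.\<close>

lemma canonical_divisor_degree:
  assumes "canonical_divisor emb x y K"
  shows "div_degree K = (int q - 2) * (int q + 1)"
proof -
  obtain f g \<delta>0 where *: "derivation emb \<delta>0" "f * \<delta>0 g \<noteq> 0"
      "\<And>P t h. curve_point emb P \<Longrightarrow> P t = 1 \<Longrightarrow> same_differential emb f g h t \<Longrightarrow>
        Poly_Mapping.lookup K P = P h"
    using assms unfolding canonical_divisor_def by blast
  have "\<delta>0 x \<noteq> 0"
    using derivation_zero[OF *(1)] *(2) by auto
  \<comment> \<open>One derivation with \<open>\<delta>0 x\<close> nonzero suffices to define the
    coefficient of dx, because any two derivations are proportional.\<close>
  define z where "z = f * \<delta>0 g / \<delta>0 x"
  have z: "f * \<delta> g = z * \<delta> x" if "derivation emb \<delta>" for \<delta>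
    using derivation_proportional[OF *(1) that, of g] \<open>\<delta>0 x \<noteq> 0\<close>
    by (simp add: z_def field_simps)
  have "z \<noteq> 0"
    using *(2) \<open>\<delta>0 x \<noteq> 0\<close> by (simp add: z_def)
  have affine: "Poly_Mapping.lookup K (v a b) = v a b z" if "on_curve a b" for a b
  proof (rule *(3))
    show "curve_point emb (v a b)" by (rule curve_point_v[OF that])
    show "v a b (x - emb a) = 1" by (rule v_uniformizer[OF that])
    show "same_differential emb f g z (x - emb a)"
      unfolding same_differential_def
    proof (intro allI impI)
      fix \<delta> assume \<delta>: "derivation emb \<delta>"
      have "\<delta> (x - emb a) = \<delta> x"
        using derivation_eq(1)[OF \<delta>, of "x - emb a" "emb a"] derivation_eq(3)[OF \<delta>] by simp
      then show "f * \<delta> g = z * \<delta> (x - emb a)"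
        using z[OF \<delta>] by simp
    qed
  qed
  have "Poly_Mapping.lookup K Pinf = Pinf (- z / y ^ (q - 2))"
  proof (rule *(3))
    show "curve_point emb Pinf" by (rule inf.curve_point)
    show "Pinf (x / y) = 1"
      using inf.x_nonzero inf.y_nonzero by (simp add: inf.P_divide inf.P_x inf.P_y)
    have "f * \<delta> g = - z / y ^ (q - 2) * \<delta> (x / y)" if "derivation emb \<delta>" for \<delta>
      unfolding z[OF that] using derivation_x_over_y[OF that] inf.y_nonzero
      by (simp add: field_simps)
    then show "same_differential emb f g (- z / y ^ (q - 2)) (x / y)"
      by (simp add: same_differential_def)
  qed
  also have "\<dots> = Pinf z + (int q - 2) * (int q + 1)"
    using \<open>z \<noteq> 0\<close> inf.y_nonzero q_gt_1
    by (simp add: inf.P_divide inf.P_power inf.P_y of_nat_diff algebra_simps)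
  finally have Kinf: "Poly_Mapping.lookup K Pinf = Pinf z + (int q - 2) * (int q + 1)" .
  obtain S where S: "finite S" "\<And>a b. on_curve a b \<Longrightarrow> v a b z \<noteq> 0 \<Longrightarrow> a \<in> S"
      "(\<Sum>a\<in>S. \<Sum>b\<in>fibre a. v a b z) = - Pinf z"
    using sum_v_eq_minus_Pinf[OF \<open>z \<noteq> 0\<close>] by blast
  define T where "T = Sigma S fibre"
  have "finite T"
    using S(1) finite_fibre by (simp add: T_def)
  have T: "on_curve a b" if "(a, b) \<in> T" for a b
    using that by (simp add: T_def fibre_def)
  have inj: "inj_on (\<lambda>(a, b). v a b) T"
    by (rule inj_onI, clarify) (use v_inj[OF T T] in blast)
  have keys: "Poly_Mapping.keys K \<subseteq> insert Pinf ((\<lambda>(a, b). v a b) ` T)"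
  proof
    fix P assume P: "P \<in> Poly_Mapping.keys K"
    then have "curve_point emb P"
      using assms by (auto simp: canonical_divisor_def is_divisor_def)
    then show "P \<in> insert Pinf ((\<lambda>(a, b). v a b) ` T)"
    proof (cases rule: curve_point_cases)
      case (2 a b)
      with P affine have "v a b z \<noteq> 0"
        by (auto simp: in_keys_iff)
      with 2 S(2) show ?thesis
        by (force simp: T_def fibre_def)
    qed simp
  qed
  have "div_degree K = (\<Sum>P\<in>insert Pinf ((\<lambda>(a, b). v a b) ` T). Poly_Mapping.lookup K P)"
    unfolding div_degree_def using keys \<open>finite T\<close>
    by (intro sum.mono_neutral_left) (auto simp: in_keys_iff)
  also have "\<dots> = Poly_Mapping.lookup K Pinf + (\<Sum>P\<in>(\<lambda>(a, b). v a b) ` T. Poly_Mapping.lookup K P)"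
    using \<open>finite T\<close> T v_neq_Pinf by (subst sum.insert) force+
  also have "(\<Sum>P\<in>(\<lambda>(a, b). v a b) ` T. Poly_Mapping.lookup K P) = (\<Sum>(a, b)\<in>T. v a b z)"
    unfolding sum.reindex[OF inj] using T affine by (intro sum.cong) auto
  also have "\<dots> = - Pinf z"
    unfolding T_def S(3)[symmetric] using S(1) finite_fibre by (simp add: sum.Sigma)
  finally show ?thesis
    using Kinf by simp
qed

section \<open>Divisors supported on the two special points\<close>

definition two_point :: "int \<Rightarrow> int \<Rightarrow> 'f divisor"
  where "two_point a b = Poly_Mapping.single Pinf a + Poly_Mapping.single (v 0 0) b"

definition code_points :: "('k \<times> 'k) set"
  where "code_points = {(a, b). base.on_curve a b \<and> b \<noteq> 0}"

lemma lookup_two_point: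
  "Poly_Mapping.lookup (two_point a b) P = (if P = Pinf then a else if P = v 0 0 then b else 0)"
  using v_neq_Pinf[OF on_curve_0]
  by (auto simp: two_point_def Poly_Mapping.lookup_add lookup_single when_def)

lemma degree_two_point: "div_degree (two_point a b) = a + b"
proof -
  have "div_degree (two_point a b) = (\<Sum>P\<in>{Pinf, v 0 0}. Poly_Mapping.lookup (two_point a b) P)"
    unfolding div_degree_def
    by (intro sum.mono_neutral_left) (auto simp: in_keys_iff lookup_two_point split: if_splits)
  then show ?thesis
    using v_neq_Pinf[OF on_curve_0] by (simp add: lookup_two_point)
qed

lemma riemann_roch_two_point_iff:
  assumes "f \<noteq> 0"
  shows "f \<in> riemann_roch_space emb x y (two_point a b) \<longleftrightarrow>
    f \<in> base_functions emb x y \<and> Pinf f \<ge> - a \<and> v 0 0 f \<ge> - b \<and>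
    (\<forall>c d. on_curve c d \<longrightarrow> (c, d) \<noteq> (0, 0) \<longrightarrow> v c d f \<ge> 0)"
proof -
  have "(\<forall>P. curve_point emb P \<longrightarrow> P f + Poly_Mapping.lookup (two_point a b) P \<ge> 0) \<longleftrightarrow>
    Pinf f \<ge> - a \<and> v 0 0 f \<ge> - b \<and> (\<forall>c d. on_curve c d \<longrightarrow> (c, d) \<noteq> (0, 0) \<longrightarrow> v c d f \<ge> 0)"
    (is "?L \<longleftrightarrow> ?R")
  proof
    assume L: ?L
    show ?R
    proof (intro conjI allI impI)
      show "Pinf f \<ge> - a"
        using L[rule_format, OF inf.curve_point] by (simp add: lookup_two_point)
      show "v 0 0 f \<ge> - b"
        using L[rule_format, OF curve_point_v[OF on_curve_0]] v_neq_Pinf[OF on_curve_0]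
        by (simp add: lookup_two_point)
      fix c d assume on: "on_curve c d" "(c, d) \<noteq> (0, 0)"
      then have "v c d \<noteq> v 0 0"
        using v_inj[OF on(1) on_curve_0] by auto
      then show "v c d f \<ge> 0"
        using L[rule_format, OF curve_point_v[OF on(1)]] v_neq_Pinf[OF on(1)]
        by (simp add: lookup_two_point)
    qed
  next
    assume R: ?R
    show ?L
    proof (intro allI impI)
      fix P assume "curve_point emb P"
      then show "P f + Poly_Mapping.lookup (two_point a b) P \<ge> 0"
      proof (cases rule: curve_point_cases)
        case 1
        with R show ?thesis by (simp add: lookup_two_point)
      next
        case (2 c d)
        with R v_neq_Pinf[OF 2(1)] show ?thesis
          by (cases "(c, d) = (0, 0)") (auto simp: lookup_two_point)
      qed
    qed
  qed
  with assms show ?thesis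
    by (simp add: riemann_roch_space_def)
qed

text \<open>Multiplication by y^c clears the pole at P0 at the price of c (q + 1) at infinity;
  elsewhere on the affine curve y is a unit, so a polynomial results. The exponent
  \<open>b0 + 1\<close> always makes the inequality strict and gives a zero at P0; \<open>b0\<close>
  is admissible only for b1 = 0.\<close>

lemma affine_equation:
  assumes "f \<in> riemann_roch_space emb x y (two_point a b)" "b \<le> c * int (q + 1)"
  obtains g where "degree g < q" "f * y powi c = E g"
    "\<And>j. coeff g j \<noteq> 0 \<Longrightarrow> int (q * degree (coeff g j) + (q + 1) * j) \<le> a + c * int (q + 1)"
    "b < c * int (q + 1) \<Longrightarrow> pt_eval 0 0 g = 0"
proof (cases "f = 0")
  case True
  then show ?thesis
    using q_gt_1 by (intro that[of 0]) auto
next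
  case False
  note f = assms(1)[unfolded riemann_roch_two_point_iff[OF False]]
  have nz: "f * y powi c \<noteq> 0"
    using False inf.y_nonzero by simp
  have v: "v d e (f * y powi c) = v d e f + c * v d e y" if "on_curve d e" for d e
  proof -
    interpret place emb "v d e" by (rule place_v[OF that])
    show ?thesis using False inf.y_nonzero by (simp add: P_mult P_power_int)
  qed
  have v0: "v 0 0 (f * y powi c) \<ge> c * int (q + 1) - b"
    using f v[OF on_curve_0] v_0_y by simp
  have "regular_at (v d e) (f * y powi c)" if "on_curve d e" for d e
  proof (cases "(d, e) = (0, 0)")
    case True
    with v0 assms(2) show ?thesis by (simp add: regular_at_def)
  next
    case False
    then have "v d e y = 0"
      using v_y[OF that] that on_curve_y_0 by auto
    with f that False v[OF that] show ?thesis by (auto simp: regular_at_def)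
  qed
  then obtain g where g: "degree g < q" "f * y powi c = E g"
    using regular_affine_imp_poly by blast
  have "Pinf (E g) = Pinf f - c * int (q + 1)"
    unfolding g(2)[symmetric] using False inf.y_nonzero
    by (simp add: inf.P_mult inf.P_power_int inf.P_y algebra_simps)
  with f have "Pinf (E g) \<ge> - (a + c * int (q + 1))" by simp
  then have coeff: "int (q * degree (coeff g j) + (q + 1) * j) \<le> a + c * int (q + 1)"
    if "coeff g j \<noteq> 0" for j
    using Pinf_poly_ge_imp[OF g(1) _ that] by blast
  have "pt_eval 0 0 g = 0" if "b < c * int (q + 1)"
  proof -
    have "vanishes_at (v 0 0) (E g)"
      using v0 that g(2) by (simp add: vanishes_at_def)
    then show ?thesis
      using v_vanishes_poly[OF on_curve_0] by blast
  qed
  with g coeff that show ?thesis by blast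
qed

lemma vanishes_at_E: "on_curve a b \<Longrightarrow> vanishes_at (v a b) (E g - emb (pt_eval a b g))"
proof -
  assume on: "on_curve a b"
  interpret place emb "v a b" by (rule place_v[OF on])
  show ?thesis
    using vanishes_at_v[OF on] by (rule vanishes_at_eval2)
qed

lemma vanishes_at_divide_y:
  assumes "on_curve a b" "b \<noteq> 0" "vanishes_at (v a b) (f * y - emb (b * c))"
  shows "vanishes_at (v a b) (f - emb c)"
proof -
  interpret place emb "v a b" by (rule place_v[OF assms(1)])
  have "vanishes_at (v a b) ((f * y) * inverse y - emb ((b * c) * inverse b))"
    by (rule vanishes_at_mult_diff[OF assms(3)
          vanishes_at_inverse_diff[OF vanishes_at_v(2)[OF assms(1)] assms(2)]])
  then show ?thesis
    using inf.y_nonzero assms(2) by (simp add: field_simps)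
qed

text \<open>
  In the applications \<open>T\<close> lies on a line, with \<open>y\<close> as a coordinate on it; \<open>m = - 1\<close> forces \<open>p = 0\<close>.
\<close>

definition polynomial_on :: "('k \<times> 'k) set \<Rightarrow> 'f set \<Rightarrow> int \<Rightarrow> int \<Rightarrow> bool"
  where "polynomial_on T L c m \<longleftrightarrow> T \<subseteq> code_points \<and> inj_on snd T \<and>
    (\<forall>f\<in>L. \<exists>p. (\<forall>j. coeff p j \<noteq> 0 \<longrightarrow> int j \<le> m) \<and>
      (\<forall>(a, b)\<in>T. vanishes_at (vk a b) (f * y powi c - emb (poly p (to_ac b)))))"

section \<open>Restriction of the functions to a line\<close>

lemma card_base_fibre: "card {b. base.on_curve a b} = q"
proof -
  have "to_ac ` {b. base.on_curve a b} = fibre (to_ac a)"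
  proof (intro equalityI subsetI)
    fix b assume b: "b \<in> fibre (to_ac a)"
    then obtain c where "b = to_ac c"
      using fibre_rational[of a b] by (auto simp: fibre_def)
    with b show "b \<in> to_ac ` {b. base.on_curve a b}"
      by (simp add: fibre_def)
  qed (auto simp: fibre_def)
  then show ?thesis
    using card_fibre[of "to_ac a"] card_image[OF inj_on_subset[OF inj_to_ac subset_UNIV]] by metis
qed

lemma base_on_curve_iff: "base.on_curve a b \<longleftrightarrow> b ^ q + b = a ^ (q + 1)"
  by (simp add: base.on_curve_def)

lemma y_powi_Suc: "y powi (c + 1) = y powi c * y"
  using inf.y_nonzero by (simp add: power_int_add)

text \<open>With the exponent \<open>b0 + 1\<close>, the restriction to x = 0 vanishes at y = 0, and
  dividing by y returns to the exponent \<open>b0\<close>. A term y^(j+1) has weight (q + 1)(j + 1)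
  < (q + 1)(k + 2), hence j <= k.\<close>

lemma polynomial_on_vertical_line:
  assumes "a < a0 * int (q + 1) + int (q + 1)" "b < b0 * int (q + 1) + int (q + 1)"
  shows "polynomial_on ({0} \<times> ({b. base.on_curve 0 b} - {0}))
    (riemann_roch_space emb x y (two_point a b)) b0 (a0 + b0)"
  unfolding polynomial_on_def
proof (intro conjI ballI)
  fix f assume f: "f \<in> riemann_roch_space emb x y (two_point a b)"
  have b: "b < (b0 + 1) * int (q + 1)"
    using assms(2) by (simp add: algebra_simps)
  obtain g where g: "degree g < q" "f * y powi (b0 + 1) = E g"
    "\<And>j. coeff g j \<noteq> 0 \<Longrightarrow> int (q * degree (coeff g j) + (q + 1) * j) \<le> a + (b0 + 1) * int (q + 1)"
    "pt_eval 0 0 g = 0"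
    using affine_equation[OF f less_imp_le[OF b]] b by metis
  define g0 where "g0 = map_poly (\<lambda>p. poly p 0) g"
  have "poly g0 0 = 0"
    using g(4) unfolding g0_def poly_poly_map_poly .
  then obtain p where p: "g0 = pCons 0 p"
    by (cases g0) auto
  have "int j \<le> a0 + b0" if "coeff p j \<noteq> 0" for j
  proof -
    have "coeff g0 (Suc j) \<noteq> 0"
      using that by (simp add: p)
    then have "coeff g (Suc j) \<noteq> 0"
      by (auto simp: g0_def coeff_map_poly)
    from g(3)[OF this] have "int (q + 1) * int (Suc j) \<le> a + (b0 + 1) * int (q + 1)"
      by (rule order_trans[rotated]) (simp add: algebra_simps)
    also have "\<dots> < int (q + 1) * (a0 + b0 + 2)"
      using assms(1) by (simp add: algebra_simps)
    finally have "int (Suc j) < a0 + b0 + 2"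
      by (simp add: mult_less_cancel_left_pos)
    then show ?thesis by simp
  qed
  moreover have "vanishes_at (vk 0 b) (f * y powi b0 - emb (poly p (to_ac b)))"
    if "base.on_curve 0 b" "b \<noteq> 0" for b
  proof -
    have on: "on_curve (to_ac 0) (to_ac b)" by (simp only: on_curve_to_ac that)
    have "pt_eval (to_ac 0) (to_ac b) g = to_ac b * poly p (to_ac b)"
      by (simp add: poly_poly_map_poly p flip: g0_def)
    with vanishes_at_E[OF on, of g]
    have "vanishes_at (vk 0 b) (f * y powi b0 * y - emb (to_ac b * poly p (to_ac b)))"
      unfolding g(2)[symmetric] y_powi_Suc by (simp only: mult.assoc)
    from vanishes_at_divide_y[OF on _ this] that(2) show ?thesis
      by simp
  qed
  ultimately show "\<exists>p. (\<forall>j. coeff p j \<noteq> 0 \<longrightarrow> int j \<le> a0 + b0) \<and>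
      (\<forall>(a, b)\<in>{0} \<times> ({b. base.on_curve 0 b} - {0}).
        vanishes_at (vk a b) (f * y powi b0 - emb (poly p (to_ac b))))"
    by (intro exI[of _ p]) auto
qed (auto simp: code_points_def inj_on_def)

text \<open>As b is a multiple of q + 1, the exponent \<open>b0\<close> itself clears the pole at
  P0, and the weight bound gives j <= k without a division by y. No point with x = 1 has y = 0, so
  the whole fibre lies in D.\<close>

lemma polynomial_on_line_x_1:
  assumes "a < a0 * int (q + 1) + int (q + 1)"
  shows "polynomial_on ({1} \<times> {b. base.on_curve 1 b})
    (riemann_roch_space emb x y (two_point a (b0 * int (q + 1)))) b0 (a0 + b0)"
  unfolding polynomial_on_def
proof (intro conjI ballI)
  fix f assume f: "f \<in> riemann_roch_space emb x y (two_point a (b0 * int (q + 1)))"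
  obtain g where g: "degree g < q" "f * y powi b0 = E g"
    "\<And>j. coeff g j \<noteq> 0 \<Longrightarrow> int (q * degree (coeff g j) + (q + 1) * j) \<le> a + b0 * int (q + 1)"
    using affine_equation[OF f order_refl] by metis
  define p where "p = map_poly (\<lambda>p. poly p 1) g"
  have "int j \<le> a0 + b0" if "coeff p j \<noteq> 0" for j
  proof -
    have "coeff g j \<noteq> 0"
      using that by (auto simp: p_def coeff_map_poly)
    from g(3)[OF this] have "int (q + 1) * int j \<le> a + b0 * int (q + 1)"
      by (rule order_trans[rotated]) (simp add: algebra_simps)
    also have "\<dots> < int (q + 1) * (a0 + b0 + 1)"
      using assms by (simp add: algebra_simps)
    finally have "int j < a0 + b0 + 1"
      by (simp add: mult_less_cancel_left_pos)
    then show ?thesis by simp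
  qed
  moreover have "vanishes_at (vk 1 b) (f * y powi b0 - emb (poly p (to_ac b)))"
    if "base.on_curve 1 b" for b
  proof -
    have "on_curve (to_ac 1) (to_ac b)" by (simp only: on_curve_to_ac that)
    from vanishes_at_E[OF this, of g] show ?thesis
      by (simp add: p_def poly_poly_map_poly g(2))
  qed
  ultimately show "\<exists>p. (\<forall>j. coeff p j \<noteq> 0 \<longrightarrow> int j \<le> a0 + b0) \<and>
      (\<forall>(a, b)\<in>{1} \<times> {b. base.on_curve 1 b}.
        vanishes_at (vk a b) (f * y powi b0 - emb (poly p (to_ac b))))"
    by (intro exI[of _ p]) auto
qed (use q_gt_1 in \<open>auto simp: code_points_def inj_on_def base_on_curve_iff power_0_left\<close>)

text \<open>On x = y the total degree counts. With a1 = 0 and k = q - 2 it is at most q - 1, and the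
  zero at P0 allows one factor y to be removed, leaving q - 2 = k.\<close>

lemma polynomial_on_diagonal:
  assumes "b < b0 * int (q + 1) + int (q + 1)" "a0 + b0 = int q - 2"
  shows "polynomial_on {(b, b) | b. b \<noteq> 0 \<and> base.on_curve b b}
    (riemann_roch_space emb x y (two_point (a0 * int (q + 1)) b)) b0 (a0 + b0)"
  unfolding polynomial_on_def
proof (intro conjI ballI)
  fix f assume f: "f \<in> riemann_roch_space emb x y (two_point (a0 * int (q + 1)) b)"
  have b: "b < (b0 + 1) * int (q + 1)"
    using assms(1) by (simp add: algebra_simps)
  obtain g where g: "degree g < q" "f * y powi (b0 + 1) = E g"
    "\<And>j. coeff g j \<noteq> 0 \<Longrightarrow> int (q * degree (coeff g j) + (q + 1) * j) \<le> a0 * int (q + 1) + (b0 + 1) * int (q + 1)"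
    "pt_eval 0 0 g = 0"
    using affine_equation[OF f less_imp_le[OF b]] b by metis
  define r where "r = poly g [:0, 1:]"
  have r: "poly r c = pt_eval c c g" for c
    unfolding r_def by (induction g) simp_all
  then obtain p where p: "r = pCons 0 p"
    using g(4) by (cases r) (metis poly_pCons mult_zero_left add.right_neutral)
  have "degree r \<le> q - 1"
    unfolding r_def poly_altdef
  proof (rule degree_sum_le)
    fix j assume "j \<in> {..degree g}"
    show "degree (coeff g j * [:0, 1:] ^ j) \<le> q - 1"
    proof (cases "coeff g j = 0")
      case False
      have "int (q * degree (coeff g j) + (q + 1) * j) \<le> (a0 + b0 + 1) * int (q + 1)"
        using g(3)[OF False] by (simp add: algebra_simps)
      \<comment> \<open>The bound lies just below q^2, the weight of x^q, so i + j < q for every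
        term; a positive a1 would admit x^q.\<close>
      also have "\<dots> = int q * int q - 1"
      proof -
        have "a0 + b0 + 1 = int q - 1" using assms(2) by simp
        then show ?thesis by (simp only:) (simp add: algebra_simps)
      qed
      finally have "int q * int (degree (coeff g j) + j) < int q * int q"
        by (simp add: algebra_simps)
      then have "degree (coeff g j) + j < q"
        using q_gt_1 by (simp add: mult_less_cancel_left_pos)
      moreover have "degree (coeff g j * [:0, 1:] ^ j) \<le> degree (coeff g j) + j"
        using degree_mult_le[of "coeff g j" "[:0, 1:] ^ j"] degree_power_le[of "[:0, 1:]" j]
        by (simp add: degree_power_eq)
      ultimately show ?thesis by linarith
    qed simp
  qed simp
  have "int j \<le> a0 + b0" if "coeff p j \<noteq> 0" for j
  proof -
    have "coeff r (Suc j) \<noteq> 0"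
      using that by (simp add: p)
    then have "Suc j \<le> q - 1"
      using le_degree[of r "Suc j"] \<open>degree r \<le> q - 1\<close> by simp
    then show ?thesis using assms(2) by simp
  qed
  moreover have "vanishes_at (vk b b) (f * y powi b0 - emb (poly p (to_ac b)))"
    if "base.on_curve b b" "b \<noteq> 0" for b
  proof -
    have on: "on_curve (to_ac b) (to_ac b)" using that by simp
    have "pt_eval (to_ac b) (to_ac b) g = to_ac b * poly p (to_ac b)"
      by (simp add: p flip: r)
    with vanishes_at_E[OF on, of g]
    have "vanishes_at (vk b b) (f * y powi b0 * y - emb (to_ac b * poly p (to_ac b)))"
      unfolding g(2)[symmetric] y_powi_Suc by (simp only: mult.assoc)
    from vanishes_at_divide_y[OF on _ this] that(2) show ?thesis
      by simp
  qed
  ultimately show "\<exists>p. (\<forall>j. coeff p j \<noteq> 0 \<longrightarrow> int j \<le> a0 + b0) \<and>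
      (\<forall>(a, b)\<in>{(b, b) | b. b \<noteq> 0 \<and> base.on_curve b b}.
        vanishes_at (vk a b) (f * y powi b0 - emb (poly p (to_ac b))))"
    by (intro exI[of _ p]) auto
qed (auto simp: code_points_def inj_on_def)

text \<open>On the line \<open>x = y\<close> the curve is \<open>c\<^sup>q + c = 1\<close> for \<open>c = 1 / y\<close>.\<close>

lemma card_diagonal: "card {(b, b) | b. b \<noteq> 0 \<and> base.on_curve b b} = q"
proof -
  have on: "base.on_curve (inverse b) (inverse b) \<longleftrightarrow> base.on_curve 1 b" if "b \<noteq> 0" for b
  proof -
    have "inverse b ^ q + inverse b = inverse b ^ (q + 1) \<longleftrightarrow> b ^ q + b = 1"
      using that by (auto simp: field_simps)
    then show ?thesis by (simp add: base_on_curve_iff)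
  qed
  have "bij_betw (\<lambda>b. (inverse b, inverse b)) {b. base.on_curve 1 b} {(b, b) | b. b \<noteq> 0 \<and> base.on_curve b b}"
  proof (rule bij_betwI[where g = "\<lambda>(b, _). inverse b"])
    show "(\<lambda>b. (inverse b, inverse b)) \<in> {b. base.on_curve 1 b} \<rightarrow> {(b, b) | b. b \<noteq> 0 \<and> base.on_curve b b}"
    proof clarify
      fix b assume b: "base.on_curve 1 b"
      then have "b \<noteq> 0"
        using q_gt_1 by (auto simp: base_on_curve_iff power_0_left)
      with b on show "\<exists>c. (inverse b, inverse b) = (c, c) \<and> c \<noteq> 0 \<and> base.on_curve c c"
        by (intro exI[of _ "inverse b"]) simp
    qed
    show "(\<lambda>(b, _). inverse b) \<in> {(b, b) | b. b \<noteq> 0 \<and> base.on_curve b b} \<rightarrow> {b. base.on_curve 1 b}"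
    proof clarify
      fix b :: 'k assume "b \<noteq> 0" "base.on_curve b b"
      then show "base.on_curve 1 (inverse b)"
        using on[of "inverse b"] by simp
    qed
  qed auto
  from bij_betw_same_card[OF this] card_base_fibre[of 1] show ?thesis
    by (simp only:)
qed

section \<open>Code coordinates and the minimum distance of the dual\<close>

abbreviation pt :: "'k \<times> 'k \<Rightarrow> 'f \<Rightarrow> int"
  where "pt t \<equiv> vk (fst t) (snd t)"

lemma pt_inj: "inj_on pt code_points"
proof (rule inj_onI)
  fix s t assume "s \<in> code_points" "t \<in> code_points" "pt s = pt t"
  then have "to_ac (fst s) = to_ac (fst t) \<and> to_ac (snd s) = to_ac (snd t)"
    by (intro v_inj) (auto simp: code_points_def)
  then show "s = t" by (simp add: prod_eq_iff)
qed

lemma rational_points_eq: "rational_points emb x y - {Pinf, v 0 0} = pt ` code_points"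
proof (intro equalityI subsetI)
  fix P assume P: "P \<in> rational_points emb x y - {Pinf, v 0 0}"
  then obtain a b where ab: "base.on_curve a b" "P = vk a b"
    using rational_points_cases by blast
  have "b \<noteq> 0"
  proof
    assume "b = 0"
    moreover from this have "a = 0"
      using ab(1) base_on_curve_iff[of a 0] q_gt_1 by (simp add: power_0_left)
    ultimately have "P = v 0 0" using ab by simp
    with P show False by simp
  qed
  with ab show "P \<in> pt ` code_points"
    by (intro image_eqI[of _ _ "(a, b)"]) (auto simp: code_points_def)
next
  fix P assume "P \<in> pt ` code_points"
  then obtain a b where ab: "base.on_curve a b" "b \<noteq> 0" "P = vk a b"
    by (auto simp: code_points_def)
  then have on: "on_curve (to_ac a) (to_ac b)" by simp
  have "P \<noteq> v 0 0"
    using v_inj[OF on on_curve_0] ab by auto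
  then show "P \<in> rational_points emb x y - {Pinf, v 0 0}"
    using vk_rational[OF ab(1)] v_neq_Pinf[OF on] ab(3) by simp
qed

lemma place_pt: "t \<in> code_points \<Longrightarrow> place emb (pt t)"
  by (intro place_v) (auto simp: code_points_def)

lemma value_at_pt:
  assumes "f \<in> riemann_roch_space emb x y (two_point a b)" "t \<in> code_points"
  shows "vanishes_at (pt t) (f - const emb (value_at emb (pt t) f))"
proof -
  have on: "on_curve (to_ac (fst t)) (to_ac (snd t))" "snd t \<noteq> 0"
    using assms(2) by (auto simp: code_points_def)
  have "regular_at (pt t) f"
  proof (cases "f = 0")
    case False
    with assms(1) on have "pt t f \<ge> 0"
      by (simp add: riemann_roch_two_point_iff)
    then show ?thesis by (simp add: regular_at_def)
  qed (simp add: regular_at_def)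
  moreover have "pt t \<in> rational_points emb x y"
    using assms(2) by (intro vk_rational) (auto simp: code_points_def)
  moreover have "f \<in> base_functions emb x y"
    using assms(1) by (simp add: riemann_roch_space_def)
  ultimately obtain c where c: "vanishes_at (pt t) (f - const emb c)"
    by (auto simp: rational_points_def)
  with value_at_eqI[OF place_pt[OF assms(2)] c] show ?thesis by simp
qed

text \<open>The factor \<open>snd t powi c\<close> turns the value of f into the value of f y^c, a
  polynomial in y of degree at most \<open>card T - 2\<close>; what remains is the vanishing of the
  top interpolation coefficient.\<close>

lemma dual_relation:
  assumes "polynomial_on T (riemann_roch_space emb x y (two_point a b)) c m"
    and "finite T" "int (card T) = m + 2"
    and f: "f \<in> riemann_roch_space emb x y (two_point a b)"
  shows "(\<Sum>t\<in>T. (snd t powi c / (\<Prod>l\<in>snd ` T - {snd t}. snd t - l)) * value_at emb (pt t) f) = 0"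
proof -
  have T: "T \<subseteq> code_points" "inj_on snd T"
    using assms(1) by (auto simp: polynomial_on_def)
  obtain p where p: "\<And>j. coeff p j \<noteq> 0 \<Longrightarrow> int j \<le> m"
      "\<And>a b. (a, b) \<in> T \<Longrightarrow> vanishes_at (vk a b) (f * y powi c - emb (poly p (to_ac b)))"
    using assms(1) f unfolding polynomial_on_def by blast
  have val: "to_ac (value_at emb (pt t) f) * to_ac (snd t) powi c = poly p (to_ac (snd t))"
    if t: "t \<in> T" for t
  proof -
    have tp: "t \<in> code_points" using t T by blast
    then have on: "on_curve (to_ac (fst t)) (to_ac (snd t))" and "snd t \<noteq> 0"
      by (auto simp: code_points_def)
    interpret place emb "pt t" by (rule place_pt[OF tp])
    have "vanishes_at (pt t) (y powi c - emb (to_ac (snd t) powi c))"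
      using \<open>snd t \<noteq> 0\<close> by (intro vanishes_at_power_int_diff vanishes_at_v(2)[OF on]) simp
    from vanishes_at_mult_diff[OF value_at_pt[OF f tp] this]
    show ?thesis
      using p(2)[of "fst t" "snd t"] t by (intro vanishes_at_diff_unique) simp_all
  qed
  \<comment> \<open>The polynomial p has coefficients in the closure, so the sum is evaluated there
    and brought back along the injective \<open>to_ac\<close>.\<close>
  define S where "S = to_ac ` snd ` T"
  have inj: "inj_on to_ac A" for A :: "'k set"
    by (rule inj_on_subset[OF inj_to_ac subset_UNIV])
  have card: "card S = card T"
    unfolding S_def by (simp add: card_image inj T(2))
  have prod: "to_ac (\<Prod>l\<in>snd ` T - {s}. s - l) = (\<Prod>l\<in>S - {to_ac s}. to_ac s - l)" for s
  proof -
    have "S - {to_ac s} = to_ac ` (snd ` T - {s})"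
      by (auto simp: S_def)
    then show ?thesis
      by (simp add: to_ac_prod prod.reindex[OF inj])
  qed
  have powi: "to_ac (s powi c) = to_ac s powi c" for s :: 'k
    by (simp add: power_int_def)
  have "to_ac (\<Sum>t\<in>T. (snd t powi c / (\<Prod>l\<in>snd ` T - {snd t}. snd t - l)) * value_at emb (pt t) f)
      = (\<Sum>t\<in>T. poly p (to_ac (snd t)) / (\<Prod>l\<in>S - {to_ac (snd t)}. to_ac (snd t) - l))"
    unfolding to_ac_sum by (intro sum.cong refl) (simp add: prod powi mult.commute flip: val)
  also have "\<dots> = (\<Sum>s\<in>S. poly p s / (\<Prod>l\<in>S - {s}. s - l))"
    unfolding S_def by (simp add: sum.reindex inj T(2))
  also have "\<dots> = 0"
  proof (rule sum_lagrange_weights)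
    show "finite S" using assms(2) by (simp add: S_def)
    fix j assume "coeff p j \<noteq> 0"
    from p(1)[OF this] assms(3) card show "j + 1 < card S" by simp
  qed
  finally show ?thesis by simp
qed

text \<open>The function is \<open>y powi (- b0)\<close> times a product of lines through the points other than \<open>t0\<close>.\<close>

lemma separating_function:
  assumes "I \<subseteq> code_points" "finite I" "t0 \<in> I" "int (card I) \<le> a0 + b0 + 1"
    and "a0 * int (q + 1) \<le> a" "b0 * int (q + 1) \<le> b"
  obtains f where "f \<in> riemann_roch_space emb x y (two_point a b)" "value_at emb (pt t0) f \<noteq> 0"
    "\<And>t. t \<in> I \<Longrightarrow> t \<noteq> t0 \<Longrightarrow> value_at emb (pt t) f = 0"
proof -
  \<comment> \<open>A line through t that misses t0: vertical if the x-coordinates differ, otherwise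
    horizontal, since then the y-coordinates differ.\<close>
  define line where "line t = (if fst t \<noteq> fst t0 then x - const emb (fst t) else y - const emb (snd t))"
    for t :: "'k \<times> 'k"
  define lv where "lv t s = (if fst t \<noteq> fst t0 then fst s - fst t else snd s - snd t)"
    for t s :: "'k \<times> 'k"
  define J where "J = I - {t0}"
  \<comment> \<open>The power of y has order -b0 (q + 1) at P0 and b0 (q + 1) at infinity. Each of
    the at most k lines has pole order at most q + 1, which leaves order at least -a0 (q + 1) at
    infinity.\<close>
  define f where "f = y powi (- b0) * (\<Prod>t\<in>J. line t)"
  have "card I = Suc (card J)"
    unfolding J_def using assms(2,3) by (rule card.remove)
  with assms(2,4) have J: "finite J" "int (card J) \<le> a0 + b0"
    by (simp_all add: J_def)
  have line_E: "\<exists>g. line t = E g" for t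
    by (intro exI[of _ "if fst t \<noteq> fst t0 then [:[:- to_ac (fst t), 1:]:] else [:[:- to_ac (snd t):], 1:]"])
      (simp add: line_def emb.hom_uminus)
  have y_minus: "y - emb c \<noteq> 0 \<and> Pinf (y - emb c) = - int (q + 1)" for c
    using inf.P_add_less[of y "emb (- c)"] inf.y_nonzero inf.P_y by (simp add: emb.hom_uminus)
  have x_minus: "x - emb c \<noteq> 0 \<and> Pinf (x - emb c) = - int q" for c
    using inf.P_add_less[of x "emb (- c)"] inf.x_nonzero inf.P_x q_gt_1 by (simp add: emb.hom_uminus)
  have line_nz: "line t \<noteq> 0" and line_inf: "Pinf (line t) \<ge> - int (q + 1)" for t
    using x_minus y_minus by (auto simp: line_def)
  have prod_nz: "(\<Prod>t\<in>J. line t) \<noteq> 0"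
    using J line_nz by simp
  then have f_nz: "f \<noteq> 0"
    using inf.y_nonzero by (simp add: f_def)
  have v_f: "v c d f \<ge> - b0 * v c d y" if on: "on_curve c d" for c d
  proof -
    interpret place emb "v c d" by (rule place_v[OF on])
    have "v c d (line t) \<ge> 0" for t
      using line_E[of t] v_poly_nonneg[OF on] by auto
    then have "v c d (\<Prod>t\<in>J. line t) \<ge> 0"
      using J line_nz by (simp add: P_prod sum_nonneg)
    then show ?thesis
      using prod_nz inf.y_nonzero by (simp add: f_def P_mult P_power_int)
  qed
  have base: "f \<in> base_functions emb x y"
    unfolding base_functions_def f_def line_def
    using base.rational_functions_y_minus[of y 0 x]
    by (intro base.rational_functions_mult base.rational_functions_power_int base.rational_functions_prod)
      (auto intro: base.rational_functions_x_minus base.rational_functions_y_minus)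
  have "Pinf f \<ge> - a"
  proof -
    have "(a0 + b0) * int (q + 1) \<ge> int (card J) * int (q + 1)"
      using J(2) by (intro mult_right_mono) simp_all
    moreover have "Pinf (\<Prod>t\<in>J. line t) \<ge> int (card J) * - int (q + 1)"
      using J(1) line_nz line_inf sum_bounded_below[of J "- int (q + 1)" "\<lambda>t. Pinf (line t)"]
      by (simp add: inf.P_prod)
    moreover have "Pinf f = b0 * int (q + 1) + Pinf (\<Prod>t\<in>J. line t)"
      using prod_nz inf.y_nonzero by (simp add: f_def inf.P_mult inf.P_power_int inf.P_y algebra_simps)
    ultimately show ?thesis
      using assms(5) by (simp add: algebra_simps)
  qed
  moreover have "v 0 0 f \<ge> - b"
    using v_f[OF on_curve_0] v_0_y assms(6) by simp
  moreover have "v c d f \<ge> 0" if "on_curve c d" "(c, d) \<noteq> (0, 0)" for c d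
    using v_f[OF that(1)] v_y[OF that(1)] that on_curve_y_0 by (cases "d = 0") auto
  ultimately have RR: "f \<in> riemann_roch_space emb x y (two_point a b)"
    using base by (simp add: riemann_roch_two_point_iff[OF f_nz])
  have val: "value_at emb (pt s) f = snd s powi (- b0) * (\<Prod>t\<in>J. lv t s)" if "s \<in> I" for s
  proof (rule value_at_eqI)
    have s: "s \<in> code_points" using that assms(1) by blast
    then have on: "on_curve (to_ac (fst s)) (to_ac (snd s))" and "snd s \<noteq> 0"
      by (auto simp: code_points_def)
    show "place emb (pt s)" by (rule place_pt[OF s])
    then interpret k: place "const emb" "pt s"
      by (rule place_const)
    have x: "vanishes_at (pt s) (x - const emb (fst s))" and y: "vanishes_at (pt s) (y - const emb (snd s))"
      by (rule vanishes_at_v[OF on])+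
    have "vanishes_at (pt s) (line t - const emb (lv t s))" for t
      using x y by (simp add: line_def lv_def emb.hom_minus)
    then show "vanishes_at (pt s) (f - const emb (snd s powi (- b0) * (\<Prod>t\<in>J. lv t s)))"
      unfolding f_def using y \<open>snd s \<noteq> 0\<close>
      by (intro k.vanishes_at_mult_diff k.vanishes_at_power_int_diff k.vanishes_at_prod_diff)
  qed
  have "value_at emb (pt t0) f \<noteq> 0"
  proof -
    have "lv t t0 \<noteq> 0" if "t \<in> J" for t
      using that by (auto simp: lv_def J_def prod_eq_iff)
    moreover have "snd t0 \<noteq> 0"
      using assms(1,3) by (auto simp: code_points_def)
    ultimately show ?thesis
      using J(1) by (simp add: val[OF assms(3)])
  qed
  moreover have "value_at emb (pt t) f = 0" if "t \<in> I" "t \<noteq> t0" for t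
  proof -
    have "t \<in> J" "lv t t = 0" using that by (auto simp: J_def lv_def)
    then have "(\<Prod>s\<in>J. lv s t) = 0"
      using J(1) by (intro prod_zero) auto
    then show ?thesis by (simp add: val[OF that(1)])
  qed
  ultimately show ?thesis
    using that RR by blast
qed

lemma min_distance_dual:
  assumes Ps: "distinct Ps" "set Ps = rational_points emb x y - {Pinf, v 0 0}"
    and T: "polynomial_on T (riemann_roch_space emb x y (two_point a b)) b0 (a0 + b0)"
    and card_T: "int (card T) = a0 + b0 + 2" "card T > 0"
    and ab: "a0 * int (q + 1) \<le> a" "b0 * int (q + 1) \<le> b"
  shows "min_distance (length Ps) (dual_code (length Ps) (ag_code emb x y Ps (two_point a b))) = card T"
proof -
  let ?L = "riemann_roch_space emb x y (two_point a b)"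
  let ?n = "length Ps"
  \<comment> \<open>Positions in the list are translated to coordinate pairs, so that sums over the
    codeword become sums over affine points.\<close>
  define \<gamma> where "\<gamma> i = the_inv_into code_points pt (Ps ! i)" for i
  have "bij_betw ((!) Ps) {..<?n} (pt ` code_points)"
    using bij_betw_nth[OF Ps(1) refl refl] Ps(2) rational_points_eq by simp
  then have bij: "bij_betw \<gamma> {..<?n} code_points"
    using bij_betw_trans[OF _ bij_betw_the_inv_into[OF bij_betw_imageI[OF pt_inj refl]]]
    unfolding \<gamma>_def comp_def by blast
  have Ps_nth: "Ps ! i = pt (\<gamma> i)" if "i < ?n" for i
  proof -
    have "Ps ! i \<in> pt ` code_points"
      using that nth_mem[of i Ps] Ps(2) rational_points_eq by simp
    then show ?thesis
      unfolding \<gamma>_def by (rule f_the_inv_into_f[OF pt_inj, symmetric])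
  qed
  have code: "ag_code emb x y Ps (two_point a b) = (\<lambda>f. vec ?n (\<lambda>i. value_at emb (pt (\<gamma> i)) f)) ` ?L"
    unfolding ag_code_def by (intro image_cong refl eq_vecI) (simp_all add: Ps_nth)
  have scalar: "w \<bullet> vec ?n h = (\<Sum>i<?n. vec_index w i * h i)" for w :: "'k vec" and h
    unfolding scalar_prod_def by (simp add: atLeast0LessThan)
  have dual: "w \<in> dual_code ?n (ag_code emb x y Ps (two_point a b)) \<longleftrightarrow>
      dim_vec w = ?n \<and> (\<forall>f\<in>?L. (\<Sum>i<?n. vec_index w i * value_at emb (pt (\<gamma> i)) f) = 0)" for w
    unfolding dual_code_def code mem_Collect_eq carrier_vec_def ball_simps scalar ..
  have T_sub: "T \<subseteq> code_points"
    using T by (simp add: polynomial_on_def)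
  have "finite T"
    using card_T(2) by (rule card_ge_0_finite)
  \<comment> \<open>The weights of \<open>dual_relation\<close>, extended by 0. They are nonzero on
    T because code points have nonzero y-coordinate, and the denominator omits the zero
    factor.\<close>
  define W where "W t = (if t \<in> T then snd t powi b0 / (\<Prod>l\<in>snd ` T - {snd t}. snd t - l) else 0)" for t
  define w where "w = vec ?n (\<lambda>i. W (\<gamma> i))"
  have W_nz: "W t = 0 \<longleftrightarrow> t \<notin> T" for t
    using \<open>finite T\<close> T_sub by (auto simp: W_def code_points_def)
  have weight: "hamming_weight w = card T"
  proof -
    have "bij_betw \<gamma> {i. i < ?n \<and> \<gamma> i \<in> T} T"
    proof (rule bij_betw_subset[OF bij])
      show "\<gamma> ` {i. i < ?n \<and> \<gamma> i \<in> T} = T"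
      proof (intro equalityI subsetI)
        fix t assume "t \<in> T"
        with T_sub have "t \<in> \<gamma> ` {..<?n}"
          using bij by (auto simp: bij_betw_def)
        with \<open>t \<in> T\<close> show "t \<in> \<gamma> ` {i. i < ?n \<and> \<gamma> i \<in> T}"
          by auto
      qed auto
    qed auto
    moreover have "{i. i < dim_vec w \<and> vec_index w i \<noteq> 0} = {i. i < ?n \<and> \<gamma> i \<in> T}"
      by (auto simp: w_def W_nz)
    ultimately show ?thesis
      unfolding hamming_weight_def by (simp add: bij_betw_same_card)
  qed
  have "w \<in> dual_code ?n (ag_code emb x y Ps (two_point a b))"
    unfolding dual
  proof (intro conjI ballI)
    fix f assume f: "f \<in> ?L"
    have "(\<Sum>i<?n. vec_index w i * value_at emb (pt (\<gamma> i)) f) = (\<Sum>i<?n. W (\<gamma> i) * value_at emb (pt (\<gamma> i)) f)"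
      by (simp add: w_def)
    also have "\<dots> = (\<Sum>t\<in>code_points. W t * value_at emb (pt t) f)"
      by (rule sum.reindex_bij_betw[OF bij])
    also have "\<dots> = (\<Sum>t\<in>T. W t * value_at emb (pt t) f)"
      using T_sub bij_betw_finite[OF bij] by (intro sum.mono_neutral_right) (auto simp: W_def)
    also have "\<dots> = 0"
      using dual_relation[OF T \<open>finite T\<close> card_T(1) f] by (simp add: W_def)
    finally show "(\<Sum>i<?n. vec_index w i * value_at emb (pt (\<gamma> i)) f) = 0" .
  qed (simp add: w_def)
  moreover have "w \<noteq> 0\<^sub>v ?n"
  proof
    assume "w = 0\<^sub>v ?n"
    then have "hamming_weight w = 0" by (simp add: hamming_weight_def)
    with weight card_T(2) show False by simp
  qed
  moreover have "card T \<le> hamming_weight u"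
    if u: "u \<in> dual_code ?n (ag_code emb x y Ps (two_point a b))" "u \<noteq> 0\<^sub>v ?n" for u
  proof (rule ccontr)
    \<comment> \<open>A lighter word is supported on at most k + 1 points. A function separating one
      of them from the others pairs with it in a single nonzero term, contradicting duality.\<close>
    assume less: "\<not> card T \<le> hamming_weight u"
    have dim: "dim_vec u = ?n" using u(1) by (simp add: dual)
    define N where "N = {i. i < ?n \<and> vec_index u i \<noteq> 0}"
    have N: "N \<subseteq> {..<?n}" by (auto simp: N_def)
    have "N \<noteq> {}"
    proof
      assume "N = {}"
      then have "u = 0\<^sub>v ?n"
        using dim by (intro eq_vecI) (auto simp: N_def)
      with u(2) show False ..
    qed
    then obtain i0 where i0: "i0 \<in> N" by blast
    have inj: "inj_on \<gamma> N"
      using bij N by (auto simp: bij_betw_def intro: inj_on_subset)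
    have "int (card (\<gamma> ` N)) \<le> a0 + b0 + 1"
    proof -
      have "card (\<gamma> ` N) = hamming_weight u"
        unfolding card_image[OF inj] by (simp add: hamming_weight_def N_def dim)
      with less card_T(1) show ?thesis by simp
    qed
    moreover have "\<gamma> ` N \<subseteq> code_points"
      using bij N by (auto simp: bij_betw_def)
    moreover have "finite (\<gamma> ` N)"
      using N finite_subset by blast
    ultimately obtain f where f: "f \<in> ?L" "value_at emb (pt (\<gamma> i0)) f \<noteq> 0"
        "\<And>t. t \<in> \<gamma> ` N \<Longrightarrow> t \<noteq> \<gamma> i0 \<Longrightarrow> value_at emb (pt t) f = 0"
      using separating_function[of "\<gamma> ` N" "\<gamma> i0" a0 b0 a b] i0 ab by blast
    have "0 = (\<Sum>i<?n. vec_index u i * value_at emb (pt (\<gamma> i)) f)"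
      using u(1) f(1) by (simp add: dual)
    also have "\<dots> = (\<Sum>i\<in>{i0}. vec_index u i * value_at emb (pt (\<gamma> i)) f)"
    proof (rule sum.mono_neutral_right)
      show "\<forall>i\<in>{..<?n} - {i0}. vec_index u i * value_at emb (pt (\<gamma> i)) f = 0"
      proof
        fix i assume i: "i \<in> {..<?n} - {i0}"
        show "vec_index u i * value_at emb (pt (\<gamma> i)) f = 0"
        proof (cases "i \<in> N")
          case True
          with i i0 inj have "\<gamma> i \<noteq> \<gamma> i0" by (auto simp: inj_on_def)
          with True f(3) show ?thesis by simp
        qed (use i in \<open>simp add: N_def\<close>)
      qed
    qed (use i0 N in auto)
    finally show False
      using f(2) i0 by (simp add: N_def)
  qed
  ultimately show ?thesis
    unfolding min_distance_def using weight by (intro Least_equality) auto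
qed

section \<open>What the linear equivalences force\<close>

lemma v_eq_v_0_iff: "on_curve c d \<Longrightarrow> v c d = v 0 0 \<longleftrightarrow> (c, d) = (0, 0)"
  using v_inj[of c d 0 0] by auto

text \<open>Dividing the function of the equivalence by y^b0 leaves a divisor b1 (P0 - Pinf) with 0
  <= b1 <= q, and no such positive multiple is principal.\<close>

lemma lin_equiv_Pinf_imp:
  assumes "lin_equiv emb x y (two_point a b) (Poly_Mapping.single Pinf s)"
    and "b = b0 * (int q + 1) + b1" "0 \<le> b1" "b1 \<le> int q"
  shows "b1 = 0"
proof -
  obtain f where f: "f \<noteq> 0"
      "\<And>P. curve_point emb P \<Longrightarrow>
        Poly_Mapping.lookup (two_point a b) P - Poly_Mapping.lookup (Poly_Mapping.single Pinf s) P = P f"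
    using assms(1) by (auto simp: lin_equiv_def)
  have vf: "v c d f = (if (c, d) = (0, 0) then b else 0)" if "on_curve c d" for c d
    using f(2)[OF curve_point_v[OF that]] v_neq_Pinf[OF that]
    by (simp add: lookup_two_point lookup_single when_def v_eq_v_0_iff[OF that])
  define h where "h = f * y powi (- b0)"
  have h: "h \<noteq> 0" using f(1) inf.y_nonzero by (simp add: h_def)
  have vh: "v c d h = v c d f - b0 * v c d y" if "on_curve c d" for c d
  proof -
    interpret place emb "v c d" by (rule place_v[OF that])
    show ?thesis
      using f(1) inf.y_nonzero by (simp add: h_def P_mult P_power_int)
  qed
  have "v 0 0 h = b1"
    using vh[OF on_curve_0] vf[OF on_curve_0] v_0_y assms(2) by (simp add: algebra_simps)
  moreover have "v c d h = 0" if "on_curve c d" "(c, d) \<noteq> (0, 0)" for c d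
  proof -
    have "d \<noteq> 0" using that on_curve_y_0 by auto
    with that show ?thesis
      using vh[OF that(1)] vf[OF that(1)] v_y[OF that(1)] by auto
  qed
  ultimately show ?thesis
    using small_multiple_of_P0[OF h] assms(3,4) by simp
qed

text \<open>The argument of the other case with the roles of the two points exchanged: only the
  order at infinity is known, and degree 0 transfers it to P0.\<close>

lemma lin_equiv_P0_imp:
  assumes "lin_equiv emb x y (two_point a b) (Poly_Mapping.single (v 0 0) t)"
    and "a = a0 * (int q + 1) + a1" "0 \<le> a1" "a1 \<le> int q"
  shows "a1 = 0"
proof -
  obtain f where f: "f \<noteq> 0"
      "\<And>P. curve_point emb P \<Longrightarrow>
        Poly_Mapping.lookup (two_point a b) P - Poly_Mapping.lookup (Poly_Mapping.single (v 0 0) t) P = P f"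
    using assms(1) by (auto simp: lin_equiv_def)
  have vf: "v c d f = 0" if "on_curve c d" "(c, d) \<noteq> (0, 0)" for c d
    using f(2)[OF curve_point_v[OF that(1)]] v_neq_Pinf[OF that(1)] that(2)
    by (auto simp: lookup_two_point lookup_single when_def v_eq_v_0_iff[OF that(1)]
        eq_commute[of "v 0 0" "v c d"] split: if_splits)
  \<comment> \<open>The product with y^a0 has order a1 at infinity; its inverse therefore has order
    a1 at P0, as \<open>small_multiple_of_P0\<close> requires.\<close>
  define h where "h = inverse (f * y powi a0)"
  have h: "h \<noteq> 0" using f(1) inf.y_nonzero by (simp add: h_def)
  have vh: "v c d h = 0" if on: "on_curve c d" "(c, d) \<noteq> (0, 0)" for c d
  proof -
    interpret place emb "v c d" by (rule place_v[OF on(1)])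
    have "d \<noteq> 0" using on on_curve_y_0 by auto
    then show ?thesis
      using f(1) inf.y_nonzero vf[OF on] v_y[OF on(1)]
      by (simp add: h_def P_mult P_power_int P_inverse del: inverse_mult_distrib)
  qed
  have "Pinf f = a"
    using f(2)[OF inf.curve_point] v_neq_Pinf[OF on_curve_0]
    by (auto simp: lookup_two_point lookup_single when_def)
  then have "Pinf h = - a1"
    using f(1) inf.y_nonzero assms(2)
    by (simp add: h_def inf.P_mult inf.P_power_int inf.P_inverse inf.P_y algebra_simps
        del: inverse_mult_distrib)
  then have "v 0 0 h = a1"
    using v_0_eq_minus_Pinf[OF h vh] by simp
  then show ?thesis
    using small_multiple_of_P0[OF h vh] assms(3,4) by simp
qed

lemma polynomial_on_subset: "polynomial_on T L c m \<Longrightarrow> T' \<subseteq> T \<Longrightarrow> polynomial_on T' L c m"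
  unfolding polynomial_on_def by (blast intro: inj_on_subset)

end

section \<open>From the stated hypotheses to the theorem\<close>

lemma CHAR_eq_of_card:
  assumes "Factorial_Ring.prime p" "card (UNIV :: 'k::{field,finite} set) = p ^ m"
  shows "CHAR('k) = p"
proof -
  have "CHAR('k) > 0"
    by (rule finite_imp_CHAR_pos) simp
  then have prime: "Factorial_Ring.prime CHAR('k)"
    by (rule prime_CHAR_semidom)
  have "CHAR('k) dvd p ^ m"
    using CHAR_dvd_CARD[where ?'a = 'k] assms(2) by simp
  then have "CHAR('k) dvd p"
    using prime by (rule prime_dvd_power[rotated])
  then show ?thesis
    using assms(1) prime by (simp add: primes_dvd_imp_eq)
qed

text \<open>The characteristic follows from the cardinality of \<open>'k\<close>. The assumption
  \<open>indep\<close> is supplied by \<open>P_eval2\<close> at the given point at infinity.\<close>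

lemma hermitian_curve_code:
  fixes emb :: "'k::{field,finite} alg_closure \<Rightarrow> 'f::field"
  assumes "hermitian_curve q emb x y" "point_at_infinity emb x y Pinf"
  obtains n where "hermitian_code emb x y q n Pinf"
proof -
  have q: "primepow q" "card (UNIV :: 'k set) = q\<^sup>2" and emb: "field_embedding emb"
    and curve: "y ^ q + y = x ^ (q + 1)" and all: "rational_functions emb x y = UNIV"
    using assms(1) by (auto simp: hermitian_curve_def)
  obtain p n where p: "Factorial_Ring.prime p" "n > 0" "q = p ^ n"
    using q(1) by (auto simp: primepow_def)
  have CHAR: "CHAR('k) = p"
    using p q(2) by (intro CHAR_eq_of_card[where m = "n * 2"]) (simp_all add: power_mult)
  have q_gt_1: "q > 1"
    using primepow_gt_Suc_0[OF q(1)] by simp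
  have "CHAR('k) dvd q"
    using p CHAR by simp
  then have q0: "of_nat q = (0 :: 'k alg_closure)"
    by (simp add: of_nat_eq_0_iff_char_dvd)
  obtain e where "pole_place emb Pinf x y q e"
    using point_at_infinity_pole_place[OF emb assms(2) curve q_gt_1] .
  then interpret pole_place emb Pinf x y q e .
  have "hermitian_code emb x y q n Pinf"
    by unfold_locales
      (use p CHAR q_gt_1 q(2) curve all assms(2) card_additive_kernel[OF q_gt_1 q0] P_eval2 in auto)
  then show ?thesis by (rule that)
qed

theorem theorem3p5:
  fixes emb :: "'k::{field,finite} alg_closure \<Rightarrow> 'f::field"
    and x y :: 'f and q :: nat
    and Pinf P0 :: "'f \<Rightarrow> int" and Ps :: "('f \<Rightarrow> int) list"
    and G K :: "'f divisor"
    and a b a0 a1 b0 b1 :: int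
  assumes "hermitian_curve q emb x y"
    and "point_at_infinity emb x y Pinf"
    and "affine_point emb x y 0 0 P0"
    and "distinct Ps" and "set Ps = rational_points emb x y - {Pinf, P0}"
    and "canonical_divisor emb x y K"
    and "div_degree G < div_degree K \<or>
         (div_degree K \<le> div_degree G \<and> div_degree G \<le> div_degree K + int q \<and>
          ((\<exists>s. lin_equiv emb x y G (Poly_Mapping.single Pinf s)) \<or>
           (\<exists>t. lin_equiv emb x y G (Poly_Mapping.single P0 t))))"
    and "G = Poly_Mapping.single Pinf a + Poly_Mapping.single P0 b"
    and "a = a0 * (int q + 1) + a1" and "0 \<le> a1" and "a1 \<le> int q"
    and "b = b0 * (int q + 1) + b1" and "0 \<le> b1" and "b1 \<le> int q"
    and "a0 + b0 + 2 \<ge> 1"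
  shows "int (min_distance (length Ps) (dual_code (length Ps) (ag_code emb x y Ps G))) = a0 + b0 + 2"
proof -
  obtain n where "hermitian_code emb x y q n Pinf"
    using hermitian_curve_code[OF assms(1,2)] .
  then interpret hermitian_code emb x y q n Pinf .
  have P0: "P0 = v 0 0"
    using assms(3) by (intro affine_place) (simp_all add: affine_point_def)
  have G: "G = two_point a b"
    by (simp add: assms(8) two_point_def P0)
  let ?L = "riemann_roch_space emb x y (two_point a b)"
  have ab: "a0 * int (q + 1) \<le> a" "b0 * int (q + 1) \<le> b"
      "a < a0 * int (q + 1) + int (q + 1)" "b < b0 * int (q + 1) + int (q + 1)"
    using assms(9-14) by (simp_all add: algebra_simps)
  have degK: "div_degree K = (int q - 2) * (int q + 1)"
    by (rule canonical_divisor_degree[OF assms(6)])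
  have degG: "div_degree G = (a0 + b0) * (int q + 1) + a1 + b1"
    by (simp add: G degree_two_point assms(9,12) algebra_simps)
  have "\<exists>T. polynomial_on T ?L b0 (a0 + b0) \<and> a0 + b0 + 2 \<le> int (card T)"
  proof (cases "a0 + b0 < int q - 2")
    case True
    \<comment> \<open>Of the q rational points with x = 0, the origin is excluded from D; q - 1
      points suffice as k + 2 <= q - 1.\<close>
    have "card ({b. base.on_curve 0 b} - {0}) = q - 1"
    proof -
      have "0 \<in> {b. base.on_curve 0 b}"
        using q_gt_1 by (simp add: base_on_curve_iff power_0_left)
      from card_Diff_singleton[OF this] show ?thesis
        by (simp only: card_base_fibre)
    qed
    then have "a0 + b0 + 2 \<le> int (card ({0} \<times> ({b. base.on_curve 0 b} - {0})))"
      using True q_gt_1 by (simp add: card_cartesian_product of_nat_diff)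
    then show ?thesis
      using polynomial_on_vertical_line[OF ab(3,4)] by blast
  next
    case False
    then have "(int q - 2) * (int q + 1) \<le> (a0 + b0) * (int q + 1)"
      by (intro mult_right_mono) simp_all
    then have "\<not> div_degree G < div_degree K"
      unfolding degG degK using assms(10,13) by linarith
    then have deg: "div_degree G \<le> div_degree K + int q" and
      equiv: "(\<exists>s. lin_equiv emb x y (two_point a b) (Poly_Mapping.single Pinf s)) \<or>
        (\<exists>t. lin_equiv emb x y (two_point a b) (Poly_Mapping.single (v 0 0) t))"
      using assms(7) G P0 by auto
    have "(a0 + b0) * (int q + 1) < (int q - 1) * (int q + 1)"
      using deg degG degK assms(10,13) by (simp add: algebra_simps)
    then have "a0 + b0 < int q - 1"
      by (simp add: mult_less_cancel_right_pos)
    with False have k: "a0 + b0 = int q - 2" by simp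
    from equiv show ?thesis
    proof
      assume "\<exists>s. lin_equiv emb x y (two_point a b) (Poly_Mapping.single Pinf s)"
      then have "b1 = 0"
        using lin_equiv_Pinf_imp assms(12-14) by blast
      then have "b = b0 * int (q + 1)"
        by (simp add: assms(12) algebra_simps)
      then have "polynomial_on ({1} \<times> {b. base.on_curve 1 b}) ?L b0 (a0 + b0)"
        using polynomial_on_line_x_1[OF ab(3)] by simp
      moreover have "a0 + b0 + 2 \<le> int (card ({1 :: 'k} \<times> {b. base.on_curve 1 b}))"
        by (simp add: card_cartesian_product card_base_fibre k)
      ultimately show ?thesis by blast
    next
      assume "\<exists>t. lin_equiv emb x y (two_point a b) (Poly_Mapping.single (v 0 0) t)"
      then have "a1 = 0"
        using lin_equiv_P0_imp assms(9-11) by blast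
      then have "a = a0 * int (q + 1)"
        by (simp add: assms(9) algebra_simps)
      then have "polynomial_on {(b, b) | b. b \<noteq> 0 \<and> base.on_curve b b} ?L b0 (a0 + b0)"
        using polynomial_on_diagonal[OF ab(4) k] by simp
      moreover have "a0 + b0 + 2 \<le> int (card {(b :: 'k, b) | b. b \<noteq> 0 \<and> base.on_curve b b})"
        unfolding card_diagonal by (simp add: k)
      ultimately show ?thesis by blast
    qed
  qed
  then obtain T where T: "polynomial_on T ?L b0 (a0 + b0)" "a0 + b0 + 2 \<le> int (card T)"
    by blast
  \<comment> \<open>The line may carry more points than needed; exactly k + 2 of them are kept, so
    that the dual word attains the lower bound. The set is nonempty since k + 2 >= 1.\<close>
  then have "nat (a0 + b0 + 2) \<le> card T" by simp
  then obtain T' where T': "T' \<subseteq> T" "card T' = nat (a0 + b0 + 2)"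
    using obtain_subset_with_card_n by metis
  have "min_distance (length Ps) (dual_code (length Ps) (ag_code emb x y Ps (two_point a b))) = card T'"
    by (rule min_distance_dual[OF assms(4) _ polynomial_on_subset[OF T(1) T'(1)] _ _ ab(1,2)])
      (use assms(5,15) T'(2) P0 in auto)
  with T'(2) assms(15) show ?thesis
    by (simp add: G)
qed

end
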